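(* Consider the interconnected closed-loop system with actuator failures $$\dot x_i=A_i(\alpha)x_i+B_i(\alpha)u_i^F+\sum_{j=1,j\ne i}^NG_{ij}\,g_{ij}(t,x_j),\quad u_i^F=\Lambda_iu_i+\phi_i(u_i),\quad u_i=K_ix_i,\quad x_i(0)=x_{i0},\qquad i=1,\dots,N,$$ with $A_i(\alpha)=\sum_{k=1}^L\alpha_kA_{i_k}$, $B_i(\alpha)=\sum_{k=1}^L\alpha_kB_{i_k}$, $\alpha\in\Pi=\{\alpha\in\mathbb{R}^L:\sum_{k=1}^L\alpha_k=1,\ \alpha_k\ge0\}$. Assume: (1) there are known constant matrices $W_{ij}$ with $\|g_{ij}(t,x_j)\|\le\|W_{ij}x_j\|$ for all $i$, all $j\ne i$, all $x_j\in\mathbb{R}^{n_j}$ and all $t\ge0$; (2) $W_i:=\sum_{j=1,j\ne i}^NW_{ji}^TW_{ji}>0$ for all $i$; (3) each cost matrix $R_i$ is invertible and $R_i-I<0$. Let $G_i$ be the block row matrix formed by the $G_{ij}$, $j\neq i$, and put $$\hat B_{i_k}=B_{i_k}\bigl(I+(I-R_i)^{-1}R_i\bigr)\Lambda_i,\quad E_{i_k}=(G_i,\ B_{i_k}),\quad C_i=\begin{pmatrix}I\\ I\end{pmatrix},\quad F_i=\begin{pmatrix}\Lambda_i\\ \Gamma_i\\ R_i\Lambda_i\end{pmatrix},$$ $$Q_{11}^i=\begin{pmatrix}-I&0\\0&R_i-I\end{pmatrix},\quad Q_{22}^i=\begin{pmatrix}-Q_i^{-1}&0\\0&-W_i^{-1}\end{pmatrix},\quad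 Q_{33}^i=\begin{pmatrix}-R_i^{-1}&0&0\\0&-I&0\\0&0&R_i-I\end{pmatrix}.$$ Suppose that, for each $i=1,\dots,N$, there exist symmetric positive definite matrices $Y_{i_k}\in\mathbb{R}^{n_i\times n_i}$ ($k=1,\dots,L$) and matrices $V_i\in\mathbb{R}^{n_i\times n_i}$, $N_i\in\mathbb{R}^{s_i\times n_i}$ such that for all $k=1,\dots,L$ and all $i=1,\dots,N$ $$\begin{pmatrix}-(V_i+V_i^T)&*&*&*&*&*\\ A_{i_k}V_i+Y_{i_k}+\hat B_{i_k}N_i&-Y_{i_k}&*&*&*&*\\ 0&E_{i_k}^T&Q_{11}^i&*&*&*\\ C_iV_i&0&0&Q_{22}^i&*&*\\ F_iN_i&0&0&0&Q_{33}^i&*\\ V_i&0&0&0&0&-Y_{i_k}\end{pmatrix}<0,\qquad \begin{pmatrix}-Y_{i_k}&*\\ E_{i_k}^T&Q_{11}^i\end{pmatrix}<0 .$$ Then the set of state feedback controls $u_i=K_ix_i$, $i=1,\dots,N$, is a reliable guaranteed cost control with Lyapunov function $V(x,\alpha)=\sum_{i=1}^Nx_i^TX_i(\alpha)x_i$, where $$K_i=N_iV_i^{-1},\qquad X_i(\alpha)=\sum_{k=1}^L\alpha_kY_{i_k}^{-1}.$$ Moreover, for any $x_i(0)=x_{i0}$, the cost function satisfies $$J<\sum_{i=1}^Nx_{i0}^TX_i(\alpha)x_{i0}.$$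
   Context: Here $x_i\in\mathbb{R}^{n_i}$ is the state, $u_i\in\mathbb{R}^{s_i}$ the control and $u_i^F\in\mathbb{R}^{s_i}$ the actual (possibly faulty) actuator signal of the $i$th subsystem; $A_{i_k}\in\mathbb{R}^{n_i\times n_i}$, $B_{i_k}\in\mathbb{R}^{n_i\times s_i}$ and $G_{ij}\in\mathbb{R}^{n_i\times l_i}$ are constant matrices; $\alpha\in\Pi$ is a constant uncertain parameter. The interconnection functions $g_{ij}(t,x_j)\in\mathbb{R}^{l_i}$ are unknown, continuous and sufficiently smooth in $x_j$ and piecewise continuous in $t$. $\|\cdot\|$ is the Euclidean norm and $I$ an identity matrix of suitable size. Failure model: $\Lambda_i=\mathrm{diag}(\lambda_{i1},\dots,\lambda_{is_i})$ is a diagonal positive definite matrix, $\Gamma_i=\mathrm{diag}(\gamma_{i1},\dots,\gamma_{is_i})$ is a diagonal positive semidefinite matrix, and $\phi_i(u_i)=(\phi_{i1}(u_{i1}),\dots,\phi_{is_i}(u_{is_i}))$ is an uncertain function satisfying $\phi_{ij}^2(u_{ij})\le\gamma_{ij}^2u_{ij}^2$ for $j=1,\dots,s_i$. Cost function: $J=J(x,u^F)=\sum_{i=1}^N\int_0^\infty\bigl(x_i^TQ_ix_i+(u_i^F)^TR_iu_i^F\bigr)\,dt$, where $Q_i\in\mathbb{R}^{n_i\times n_i}$ and $R_i\in\mathbb{R}^{s_i\times s_i}$ are given constant symmetric positive definite matrices. Definition: the controls $u_i=K_ix_i$ ($i=1,\dots,N$) are a reliable guaranteed cost control with Lyapunov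 function $\sum_ix_i^TX_i(\alpha)x_i$ if, for every $\alpha\in\Pi$ and all admissible $g_{ij}$ and $\phi_i$, along the trajectories of the closed-loop system (for $x=(x_1,\dots,x_N)\ne0$) $$\sum_{i=1}^N\Bigl(\frac{d}{dt}\bigl(x_i^TX_i(\alpha)x_i\bigr)+x_i^TQ_ix_i+(u_i^F)^TR_iu_i^F\Bigr)<0 ,$$ so that the cost $J(x,u^F)$ is bounded by a specified constant and the closed-loop system is asymptotically stable. In symmetric block matrices $*$ denotes the block induced by symmetry (transpose of the mirrored block); $M<0$ / $M>0$ means negative / positive definite.
   Formalization: The Lyapunov property is proved for X_i(α) = (Σ_k α_k Y_ik)^{-1}, because it fails in general for Σ_k α_k Y_ik^{-1}; the cost bound is proved for both matrices, and only for x_0 ≠ 0, since at x_0 = 0 it would read 0 < 0. *)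

theory Defs
  imports
    "HOL-Analysis.Analysis"
    "Jordan_Normal_Form.Gauss_Jordan_Elimination"
begin

unbundle no inner_syntax
unbundle no vec_syntax

text \<open>The dimensions of the subsystems depend on the subsystem index, so vectors and matrices are
  the carrier-based ones of \<open>Jordan_Normal_Form\<close>. Subsystem, vertex and coordinate indices start
  at 0. The type of vectors carries no topology; the analytic notions are therefore spelled out
  with the Euclidean norm below, or componentwise.\<close>

definition vnorm :: "real vec \<Rightarrow> real" where
  "vnorm v = sqrt (v \<bullet> v)"

definition quad :: "real mat \<Rightarrow> real vec \<Rightarrow> real" where
  "quad M v = v \<bullet> (M *\<^sub>v v)"

definition pos_def :: "real mat \<Rightarrow> bool" where
  "pos_def M \<longleftrightarrow> M\<^sup>T = M \<and>
    (\<forall>v\<in>carrier_vec (dim_row M). v \<noteq> 0\<^sub>v (dim_row M) \<longrightarrow> 0 < quad M v)"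

definition pos_semidef :: "real mat \<Rightarrow> bool" where
  "pos_semidef M \<longleftrightarrow> M\<^sup>T = M \<and> (\<forall>v\<in>carrier_vec (dim_row M). 0 \<le> quad M v)"

definition neg_def :: "real mat \<Rightarrow> bool" where
  "neg_def M \<longleftrightarrow> M\<^sup>T = M \<and>
    (\<forall>v\<in>carrier_vec (dim_row M). v \<noteq> 0\<^sub>v (dim_row M) \<longrightarrow> quad M v < 0)"

definition minv :: "real mat \<Rightarrow> real mat" where
  "minv M = the (mat_inverse M)"

definition msum :: "nat \<Rightarrow> nat \<Rightarrow> ('k \<Rightarrow> real mat) \<Rightarrow> 'k set \<Rightarrow> real mat" where
  "msum nr nc M I = mat nr nc (\<lambda>rc. \<Sum>k\<in>I. M k $$ rc)"

definition hcat :: "nat \<Rightarrow> real mat list \<Rightarrow> real mat" where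
  "hcat nr Ms =
    foldr (\<lambda>A B. four_block_mat A B (0\<^sub>m 0 (dim_col A)) (0\<^sub>m 0 (dim_col B))) Ms (0\<^sub>m nr 0)"

definition vcat :: "nat \<Rightarrow> real mat list \<Rightarrow> real mat" where
  "vcat nc Ms = foldr append_rows Ms (0\<^sub>m 0 nc)"

definition block_mat :: "real mat list list \<Rightarrow> real mat" where
  "block_mat Mss =
    vcat (sum_list (map dim_col (hd Mss))) (map (\<lambda>Ms. hcat (dim_row (hd Ms)) Ms) Mss)"

text \<open>The argument lists the rows of the block lower triangle, diagonal included; the blocks above
  the diagonal are the transposes of the mirrored ones.\<close>
definition sym_block_mat :: "real mat list list \<Rightarrow> real mat" where
  "sym_block_mat Mss =
    block_mat (map (\<lambda>i. map (\<lambda>j. if j \<le> i then Mss ! i ! j else (Mss ! j ! i)\<^sup>T)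
      [0..<length Mss]) [0..<length Mss])"

definition continuous_vec :: "nat \<Rightarrow> (real vec \<Rightarrow> real) \<Rightarrow> bool" where
  "continuous_vec n f \<longleftrightarrow> (\<forall>y\<in>carrier_vec n. \<forall>e>0. \<exists>d>0. \<forall>z\<in>carrier_vec n.
    vnorm (z - y) < d \<longrightarrow> \<bar>f z - f y\<bar> < e)"

definition C1_vec :: "nat \<Rightarrow> nat \<Rightarrow> (real vec \<Rightarrow> real vec) \<Rightarrow> bool" where
  "C1_vec n m f \<longleftrightarrow> (\<exists>D.
    (\<forall>y\<in>carrier_vec n. D y \<in> carrier_mat m n \<and>
      (\<forall>e>0. \<exists>d>0. \<forall>z\<in>carrier_vec n. vnorm (z - y) < d \<longrightarrow>
        vnorm (f z - f y - D y *\<^sub>v (z - y)) \<le> e * vnorm (z - y))) \<and>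
    (\<forall>r<m. \<forall>c<n. continuous_vec n (\<lambda>y. D y $$ (r, c))))"

definition piecewise_continuous :: "(real \<Rightarrow> real) \<Rightarrow> bool" where
  "piecewise_continuous f \<longleftrightarrow>
    (\<forall>b. finite {t. 0 \<le> t \<and> t \<le> b \<and> \<not> continuous (at t within {0..}) f}) \<and>
    (\<forall>t\<ge>0. \<exists>c. (f \<longlongrightarrow> c) (at_right t)) \<and>
    (\<forall>t>0. \<exists>c. (f \<longlongrightarrow> c) (at_left t))"

record interconnection =
  subs :: nat
  verts :: nat
  xdim :: "nat \<Rightarrow> nat"
  udim :: "nat \<Rightarrow> nat"
  gdim :: "nat \<Rightarrow> nat"
  Av :: "nat \<Rightarrow> nat \<Rightarrow> real mat"
  Bv :: "nat \<Rightarrow> nat \<Rightarrow> real mat"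
  Gc :: "nat \<Rightarrow> nat \<Rightarrow> real mat"
  Wc :: "nat \<Rightarrow> nat \<Rightarrow> real mat"
  Lam :: "nat \<Rightarrow> real mat"
  Gam :: "nat \<Rightarrow> real mat"
  Qw :: "nat \<Rightarrow> real mat"
  Rw :: "nat \<Rightarrow> real mat"

text \<open>The number of rows of the bounding matrices \<open>Wc\<close> is arbitrary.\<close>
definition well_formed :: "interconnection \<Rightarrow> bool" where
  "well_formed S \<longleftrightarrow> 0 < subs S \<and> 0 < verts S \<and> (\<forall>i<subs S.
    (\<forall>k<verts S. Av S i k \<in> carrier_mat (xdim S i) (xdim S i) \<and>
                 Bv S i k \<in> carrier_mat (xdim S i) (udim S i)) \<and>
    (\<forall>j<subs S. j \<noteq> i \<longrightarrow> Gc S i j \<in> carrier_mat (xdim S i) (gdim S i) \<and>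
                          dim_col (Wc S i j) = xdim S j) \<and>
    Lam S i \<in> carrier_mat (udim S i) (udim S i) \<and> diagonal_mat (Lam S i) \<and> pos_def (Lam S i) \<and>
    Gam S i \<in> carrier_mat (udim S i) (udim S i) \<and> diagonal_mat (Gam S i) \<and> pos_semidef (Gam S i) \<and>
    Qw S i \<in> carrier_mat (xdim S i) (xdim S i) \<and> pos_def (Qw S i) \<and>
    Rw S i \<in> carrier_mat (udim S i) (udim S i) \<and> pos_def (Rw S i))"

definition params :: "interconnection \<Rightarrow> real vec set" where
  "params S = {\<alpha> \<in> carrier_vec (verts S). (\<Sum>k<verts S. \<alpha> $ k) = 1 \<and> (\<forall>k<verts S. 0 \<le> \<alpha> $ k)}"

definition A_of :: "interconnection \<Rightarrow> real vec \<Rightarrow> nat \<Rightarrow> real mat" where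
  "A_of S \<alpha> i = msum (xdim S i) (xdim S i) (\<lambda>k. \<alpha> $ k \<cdot>\<^sub>m Av S i k) {..<verts S}"

definition B_of :: "interconnection \<Rightarrow> real vec \<Rightarrow> nat \<Rightarrow> real mat" where
  "B_of S \<alpha> i = msum (xdim S i) (udim S i) (\<lambda>k. \<alpha> $ k \<cdot>\<^sub>m Bv S i k) {..<verts S}"

definition admissible_coupling ::
    "interconnection \<Rightarrow> (nat \<Rightarrow> nat \<Rightarrow> real \<Rightarrow> real vec \<Rightarrow> real vec) \<Rightarrow> bool" where
  "admissible_coupling S g \<longleftrightarrow> (\<forall>i<subs S. \<forall>j<subs S. j \<noteq> i \<longrightarrow>
    (\<forall>t\<ge>0. \<forall>y\<in>carrier_vec (xdim S j). g i j t y \<in> carrier_vec (gdim S i) \<and>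
      vnorm (g i j t y) \<le> vnorm (Wc S i j *\<^sub>v y)) \<and>
    (\<forall>t\<ge>0. C1_vec (xdim S j) (gdim S i) (g i j t)) \<and>
    (\<forall>y\<in>carrier_vec (xdim S j). \<forall>r<gdim S i. piecewise_continuous (\<lambda>t. g i j t y $ r)))"

definition admissible_fault ::
    "interconnection \<Rightarrow> (nat \<Rightarrow> nat \<Rightarrow> real \<Rightarrow> real) \<Rightarrow> bool" where
  "admissible_fault S \<phi> \<longleftrightarrow>
    (\<forall>i<subs S. \<forall>j<udim S i. \<forall>v. (\<phi> i j v)\<^sup>2 \<le> (Gam S i $$ (j, j))\<^sup>2 * v\<^sup>2)"

text \<open>The signal \<open>u\<^sub>i\<^sup>F\<close> under \<open>u\<^sub>i = K\<^sub>i x\<^sub>i\<close>. The tuple of all subsystem states is a function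
  \<open>nat \<Rightarrow> real vec\<close> of which only the values below \<open>subs S\<close> matter.\<close>
definition actuator :: "interconnection \<Rightarrow> (nat \<Rightarrow> real mat) \<Rightarrow> (nat \<Rightarrow> nat \<Rightarrow> real \<Rightarrow> real) \<Rightarrow>
    (nat \<Rightarrow> real vec) \<Rightarrow> nat \<Rightarrow> real vec" where
  "actuator S K \<phi> \<xi> i =
    (let u = K i *\<^sub>v \<xi> i in Lam S i *\<^sub>v u + vec (udim S i) (\<lambda>j. \<phi> i j (u $ j)))"

definition vector_field :: "interconnection \<Rightarrow> (nat \<Rightarrow> real mat) \<Rightarrow> real vec \<Rightarrow>
    (nat \<Rightarrow> nat \<Rightarrow> real \<Rightarrow> real vec \<Rightarrow> real vec) \<Rightarrow> (nat \<Rightarrow> nat \<Rightarrow> real \<Rightarrow> real) \<Rightarrow>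
    real \<Rightarrow> (nat \<Rightarrow> real vec) \<Rightarrow> nat \<Rightarrow> real vec" where
  "vector_field S K \<alpha> g \<phi> t \<xi> i =
    A_of S \<alpha> i *\<^sub>v \<xi> i + B_of S \<alpha> i *\<^sub>v actuator S K \<phi> \<xi> i +
    finsum_vec TYPE(real) (xdim S i) (\<lambda>j. Gc S i j *\<^sub>v g i j t (\<xi> j)) ({..<subs S} - {i})"

definition horizon :: "ereal \<Rightarrow> real set" where
  "horizon T = {t. 0 \<le> t \<and> ereal t < T}"

definition ode_at :: "interconnection \<Rightarrow> (nat \<Rightarrow> real mat) \<Rightarrow> real vec \<Rightarrow>
    (nat \<Rightarrow> nat \<Rightarrow> real \<Rightarrow> real vec \<Rightarrow> real vec) \<Rightarrow> (nat \<Rightarrow> nat \<Rightarrow> real \<Rightarrow> real) \<Rightarrow>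
    ereal \<Rightarrow> (real \<Rightarrow> nat \<Rightarrow> real vec) \<Rightarrow> real \<Rightarrow> bool" where
  "ode_at S K \<alpha> g \<phi> T x t \<longleftrightarrow> (\<forall>i<subs S. \<forall>r<xdim S i.
    ((\<lambda>\<tau>. x \<tau> i $ r) has_real_derivative vector_field S K \<alpha> g \<phi> t (x t) i $ r)
      (at t within horizon T))"

text \<open>As the right-hand side is only piecewise continuous in time, a solution is a continuous
  function that satisfies the differential equation up to finitely many times in every bounded
  interval. Solutions on bounded horizons are included.\<close>
definition trajectory :: "interconnection \<Rightarrow> (nat \<Rightarrow> real mat) \<Rightarrow> real vec \<Rightarrow>
    (nat \<Rightarrow> nat \<Rightarrow> real \<Rightarrow> real vec \<Rightarrow> real vec) \<Rightarrow> (nat \<Rightarrow> nat \<Rightarrow> real \<Rightarrow> real) \<Rightarrow>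
    ereal \<Rightarrow> (real \<Rightarrow> nat \<Rightarrow> real vec) \<Rightarrow> bool" where
  "trajectory S K \<alpha> g \<phi> T x \<longleftrightarrow>
    (\<forall>i<subs S. (\<forall>t\<in>horizon T. x t i \<in> carrier_vec (xdim S i)) \<and>
      (\<forall>r<xdim S i. continuous_on (horizon T) (\<lambda>t. x t i $ r))) \<and>
    (\<forall>b. finite {t\<in>horizon T. t \<le> b \<and> \<not> ode_at S K \<alpha> g \<phi> T x t})"

definition nonzero_state :: "interconnection \<Rightarrow> (nat \<Rightarrow> real vec) \<Rightarrow> bool" where
  "nonzero_state S \<xi> \<longleftrightarrow> (\<exists>i<subs S. \<xi> i \<noteq> 0\<^sub>v (xdim S i))"

definition state_norm :: "interconnection \<Rightarrow> (nat \<Rightarrow> real vec) \<Rightarrow> real" where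
  "state_norm S \<xi> = sqrt (\<Sum>i<subs S. (vnorm (\<xi> i))\<^sup>2)"

definition stage_cost :: "interconnection \<Rightarrow> (nat \<Rightarrow> real mat) \<Rightarrow> (nat \<Rightarrow> nat \<Rightarrow> real \<Rightarrow> real) \<Rightarrow>
    (nat \<Rightarrow> real vec) \<Rightarrow> nat \<Rightarrow> real" where
  "stage_cost S K \<phi> \<xi> i = quad (Qw S i) (\<xi> i) + quad (Rw S i) (actuator S K \<phi> \<xi> i)"

text \<open>The integrand is nonnegative, so the cost is an element of \<open>[0, \<infinity>]\<close>. Admissible faults
  need not be measurable; for a nonmeasurable integrand the value is the lower integral.\<close>
definition cost :: "interconnection \<Rightarrow> (nat \<Rightarrow> real mat) \<Rightarrow> (nat \<Rightarrow> nat \<Rightarrow> real \<Rightarrow> real) \<Rightarrow>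
    (real \<Rightarrow> nat \<Rightarrow> real vec) \<Rightarrow> ennreal" where
  "cost S K \<phi> x = (\<integral>\<^sup>+t\<in>{0..}. ennreal (\<Sum>i<subs S. stage_cost S K \<phi> (x t) i) \<partial>lborel)"

definition asymptotically_stable :: "interconnection \<Rightarrow> (nat \<Rightarrow> real mat) \<Rightarrow> real vec \<Rightarrow>
    (nat \<Rightarrow> nat \<Rightarrow> real \<Rightarrow> real vec \<Rightarrow> real vec) \<Rightarrow> (nat \<Rightarrow> nat \<Rightarrow> real \<Rightarrow> real) \<Rightarrow> bool" where
  "asymptotically_stable S K \<alpha> g \<phi> \<longleftrightarrow>
    (\<forall>e>0. \<exists>d>0. \<forall>T x. trajectory S K \<alpha> g \<phi> T x \<and> state_norm S (x 0) < d \<longrightarrow>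
      (\<forall>t\<in>horizon T. state_norm S (x t) < e)) \<and>
    (\<forall>x. trajectory S K \<alpha> g \<phi> \<infinity> x \<longrightarrow> ((\<lambda>t. state_norm S (x t)) \<longlongrightarrow> 0) at_top)"

definition reliable_guaranteed_cost_control ::
    "interconnection \<Rightarrow> (nat \<Rightarrow> real mat) \<Rightarrow> (nat \<Rightarrow> real vec \<Rightarrow> real mat) \<Rightarrow> bool" where
  "reliable_guaranteed_cost_control S K X \<longleftrightarrow>
    (\<forall>i<subs S. K i \<in> carrier_mat (udim S i) (xdim S i)) \<and>
    (\<forall>\<alpha>\<in>params S. \<forall>i<subs S. X i \<alpha> \<in> carrier_mat (xdim S i) (xdim S i) \<and> pos_def (X i \<alpha>)) \<and>
    (\<forall>\<alpha>\<in>params S. \<forall>g \<phi>. admissible_coupling S g \<and> admissible_fault S \<phi> \<longrightarrow>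
      (\<forall>T x. trajectory S K \<alpha> g \<phi> T x \<longrightarrow>
        (\<forall>t\<in>horizon T. ode_at S K \<alpha> g \<phi> T x t \<and> nonzero_state S (x t) \<longrightarrow>
          (\<exists>D. (\<forall>i<subs S. ((\<lambda>\<tau>. quad (X i \<alpha>) (x \<tau> i)) has_real_derivative D i)
                  (at t within horizon T)) \<and>
               (\<Sum>i<subs S. D i + stage_cost S K \<phi> (x t) i) < 0))) \<and>
      asymptotically_stable S K \<alpha> g \<phi>) \<and>
    (\<forall>\<xi>. \<exists>c. \<forall>\<alpha>\<in>params S. \<forall>g \<phi> x.
      admissible_coupling S g \<and> admissible_fault S \<phi> \<and> trajectory S K \<alpha> g \<phi> \<infinity> x \<and>
      (\<forall>i<subs S. x 0 i = \<xi> i) \<longrightarrow> cost S K \<phi> x \<le> ennreal c)"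

definition W_of :: "interconnection \<Rightarrow> nat \<Rightarrow> real mat" where
  "W_of S i = msum (xdim S i) (xdim S i) (\<lambda>j. (Wc S j i)\<^sup>T * Wc S j i) ({..<subs S} - {i})"

definition G_row :: "interconnection \<Rightarrow> nat \<Rightarrow> real mat" where
  "G_row S i = hcat (xdim S i) (map (Gc S i) (filter (\<lambda>j. j \<noteq> i) [0..<subs S]))"

definition B_hat :: "interconnection \<Rightarrow> nat \<Rightarrow> nat \<Rightarrow> real mat" where
  "B_hat S i k = (let I = 1\<^sub>m (udim S i) in
    Bv S i k * (I + minv (I - Rw S i) * Rw S i) * Lam S i)"

definition E_mat :: "interconnection \<Rightarrow> nat \<Rightarrow> nat \<Rightarrow> real mat" where
  "E_mat S i k = hcat (xdim S i) [G_row S i, Bv S i k]"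

definition C_mat :: "interconnection \<Rightarrow> nat \<Rightarrow> real mat" where
  "C_mat S i = vcat (xdim S i) [1\<^sub>m (xdim S i), 1\<^sub>m (xdim S i)]"

definition F_mat :: "interconnection \<Rightarrow> nat \<Rightarrow> real mat" where
  "F_mat S i = vcat (udim S i) [Lam S i, Gam S i, Rw S i * Lam S i]"

definition Q11 :: "interconnection \<Rightarrow> nat \<Rightarrow> real mat" where
  "Q11 S i = diag_block_mat [- 1\<^sub>m (dim_col (G_row S i)), Rw S i - 1\<^sub>m (udim S i)]"

definition Q22 :: "interconnection \<Rightarrow> nat \<Rightarrow> real mat" where
  "Q22 S i = diag_block_mat [- minv (Qw S i), - minv (W_of S i)]"

definition Q33 :: "interconnection \<Rightarrow> nat \<Rightarrow> real mat" where
  "Q33 S i = diag_block_mat [- minv (Rw S i), - 1\<^sub>m (udim S i), Rw S i - 1\<^sub>m (udim S i)]"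

definition lmi1 :: "interconnection \<Rightarrow> nat \<Rightarrow> nat \<Rightarrow> real mat \<Rightarrow> real mat \<Rightarrow> real mat \<Rightarrow> real mat" where
  "lmi1 S i k Y V N = (let n = xdim S i; s = udim S i; e = dim_row (Q11 S i) in
    sym_block_mat
     [[- (V + V\<^sup>T)],
      [Av S i k * V + Y + B_hat S i k * N, - Y],
      [0\<^sub>m e n, (E_mat S i k)\<^sup>T, Q11 S i],
      [C_mat S i * V, 0\<^sub>m (2 * n) n, 0\<^sub>m (2 * n) e, Q22 S i],
      [F_mat S i * N, 0\<^sub>m (3 * s) n, 0\<^sub>m (3 * s) e, 0\<^sub>m (3 * s) (2 * n), Q33 S i],
      [V, 0\<^sub>m n n, 0\<^sub>m n e, 0\<^sub>m n (2 * n), 0\<^sub>m n (3 * s), - Y]])"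

definition lmi2 :: "interconnection \<Rightarrow> nat \<Rightarrow> nat \<Rightarrow> real mat \<Rightarrow> real mat" where
  "lmi2 S i k Y = sym_block_mat [[- Y], [(E_mat S i k)\<^sup>T, Q11 S i]]"

text \<open>Two ways of interpolating the vertex matrices. They agree at the vertices of the parameter
  simplex, and the second one dominates the first one in the Loewner order, but in general only
  the first one gives a Lyapunov function: the matrix inequalities are affine in the vertex data
  together with \<open>Y\<close>, not with \<open>Y\<close> inverted.\<close>
definition inv_of_mean :: "interconnection \<Rightarrow> (nat \<Rightarrow> nat \<Rightarrow> real mat) \<Rightarrow> nat \<Rightarrow> real vec \<Rightarrow> real mat" where
  "inv_of_mean S Y i \<alpha> =
    minv (msum (xdim S i) (xdim S i) (\<lambda>k. \<alpha> $ k \<cdot>\<^sub>m Y i k) {..<verts S})"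

definition mean_of_inv :: "interconnection \<Rightarrow> (nat \<Rightarrow> nat \<Rightarrow> real mat) \<Rightarrow> nat \<Rightarrow> real vec \<Rightarrow> real mat" where
  "mean_of_inv S Y i \<alpha> =
    msum (xdim S i) (xdim S i) (\<lambda>k. \<alpha> $ k \<cdot>\<^sub>m minv (Y i k)) {..<verts S}"

end

theory Submission
  imports Defs "Jordan_Normal_Form.Determinant"
begin

text \<open>The matrix inequalities enter through the values of their quadratic forms at one well chosen
  vector. Fix a parameter \<open>\<alpha>\<close> and a subsystem; let \<open>Y\<close> be the mean of the \<open>Y\<^sub>k\<close> with the weights \<open>\<alpha>\<^sub>k\<close>, and
  \<open>P = Y\<inverse>\<close>, \<open>u = K x\<close>, \<open>v = \<Lambda> u + p\<close> with \<open>p\<close> the fault, and \<open>w\<close> the stacked coupling values.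
  Where one usually takes Schur complements, the vector that realises them is inserted
  directly: with \<open>h = R \<Lambda> u\<close> and \<open>e = (I - R)\<inverse> h\<close> it is
  \<open>(V\<inverse> x, P x, (w, p - e), (Q x, W x), (h, \<Gamma> u, e), P x)\<close>.
  It does not depend on the vertex, and the inequality is affine in the vertex data including \<open>Y\<^sub>k\<close>,
  so the average over the vertices is an inequality for \<open>A(\<alpha>)\<close>, \<open>B(\<alpha>)\<close> and \<open>Y\<close>. As \<open>Y P x = x\<close>, the auxiliary
  vector \<open>V\<inverse> x\<close> drops out and
  \<open>2 P x \<bullet> (A x + B v + G w) + x \<bullet> Q x + v \<bullet> R v + x \<bullet> W x - |w|\<^sup>2 + |\<Gamma> u|\<^sup>2 - |p|\<^sup>2 \<le> - c (x \<bullet> P x)\<close>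
  remains (\<open>vertex_dissipation\<close>, \<open>subsystem_dissipation\<close>), with some \<open>c > 0\<close> because definite forms are
  coercive (\<open>pos_def_coercive\<close>).

  The fault satisfies \<open>|p| \<le> |\<Gamma> u|\<close>, and summed over the subsystems the coupling energies \<open>|w|\<^sup>2\<close> are
  at most the terms \<open>x \<bullet> W x\<close>. What is left is that the derivative of the Lyapunov function plus
  the running cost is at most \<open>- c\<close> times the Lyapunov function (\<open>system_dissipation\<close>). This gives
  exponential decay, hence asymptotic stability, and by integration the bound of the cost by the initial
  value of the Lyapunov function; the term with \<open>c\<close> makes the bound strict. Solutions may violate the
  differential equation at isolated times and the running cost may be nonmeasurable in time, so the
  integration uses the fundamental theorem of calculus with exceptional points and compares lower
  integrals (\<open>nn_integral_dissipated_le\<close>).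

  The bound with the mean of the inverses follows because inversion is convex on positive definite
  matrices (\<open>quad_inv_of_mean_le\<close>).\<close>

section \<open>Positive definite matrices on carriers\<close>

lemma mult_mat_vec_zero:
  fixes M :: "real mat"
  assumes "M \<in> carrier_mat nr nc"
  shows "M *\<^sub>v 0\<^sub>v nc = 0\<^sub>v nr"
  using assms by (intro eq_vecI) auto

lemma scalar_prod_sum: "v \<bullet> w = (\<Sum>i<dim_vec w. v $ i * w $ i)"
  by (simp add: scalar_prod_def atLeast0LessThan)

lemma scalar_prod_self_nonneg: "0 \<le> (v::real vec) \<bullet> v"
  by (simp add: scalar_prod_sum sum_nonneg)

lemma scalar_prod_self_pos:
  fixes v :: "real vec"
  assumes "v \<in> carrier_vec n" "v \<noteq> 0\<^sub>v n"
  shows "0 < v \<bullet> v"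
proof -
  obtain i where i: "i < n" "v $ i \<noteq> 0" using assms by (metis carrier_vecD eq_vecI index_zero_vec)
  have "0 < (\<Sum>i<dim_vec v. v $ i * v $ i)"
    by (rule sum_pos2[of _ i]) (use i assms in \<open>auto simp: zero_less_mult_iff\<close>)
  then show ?thesis by (simp add: scalar_prod_sum)
qed

lemma form_sum:
  fixes M :: "real mat"
  assumes "M \<in> carrier_mat nr nc" "v \<in> carrier_vec nr" "w \<in> carrier_vec nc"
  shows "v \<bullet> (M *\<^sub>v w) = (\<Sum>r<nr. \<Sum>c<nc. v $ r * M $$ (r, c) * w $ c)"
proof -
  have "row M r \<bullet> w = (\<Sum>c<nc. M $$ (r, c) * w $ c)" if "r < nr" for r
    using assms that by (simp add: scalar_prod_sum)
  then show ?thesis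
    using assms by (simp add: scalar_prod_sum sum_distrib_left mult.assoc)
qed

lemma quad_sum:
  assumes "M \<in> carrier_mat n n" "v \<in> carrier_vec n"
  shows "quad M v = (\<Sum>r<n. \<Sum>c<n. v $ r * M $$ (r, c) * v $ c)"
  unfolding quad_def by (rule form_sum[OF assms assms(2)])

lemma sym_form_commute:
  fixes M :: "real mat"
  assumes "M \<in> carrier_mat n n" "M\<^sup>T = M" "v \<in> carrier_vec n" "w \<in> carrier_vec n"
  shows "v \<bullet> (M *\<^sub>v w) = w \<bullet> (M *\<^sub>v v)"
proof -
  have "v \<bullet> (M *\<^sub>v w) = (M\<^sup>T *\<^sub>v v) \<bullet> w"
    using transpose_vec_mult_scalar[OF assms(1,4,3)] by simp
  also have "\<dots> = w \<bullet> (M *\<^sub>v v)"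
    using assms by (subst comm_scalar_prod[of _ n]) auto
  finally show ?thesis .
qed

lemma quad_upper_bound:
  assumes "M \<in> carrier_mat n n"
  shows "\<exists>C>0. \<forall>v\<in>carrier_vec n. quad M v \<le> C * (v \<bullet> v)"
proof -
  define C where "C = 1 + (\<Sum>r<n. \<Sum>c<n. \<bar>M $$ (r, c)\<bar>)"
  have "0 < C" unfolding C_def by (intro add_pos_nonneg sum_nonneg) auto
  moreover have "quad M v \<le> C * (v \<bullet> v)" if v: "v \<in> carrier_vec n" for v
  proof -
    have le: "v $ i * v $ i \<le> v \<bullet> v" if "i < n" for i
      using v that unfolding scalar_prod_sum
      by (intro member_le_sum) auto
    have "v $ r * M $$ (r, c) * v $ c \<le> \<bar>M $$ (r, c)\<bar> * (v \<bullet> v)" if "r < n" "c < n" for r c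
    proof -
      have "0 \<le> (\<bar>v $ r\<bar> - \<bar>v $ c\<bar>)\<^sup>2" by simp
      then have "\<bar>v $ r\<bar> * \<bar>v $ c\<bar> \<le> v \<bullet> v"
        using le[OF that(1)] le[OF that(2)] by (simp add: power2_eq_square algebra_simps)
      then have "\<bar>M $$ (r, c)\<bar> * (\<bar>v $ r\<bar> * \<bar>v $ c\<bar>) \<le> \<bar>M $$ (r, c)\<bar> * (v \<bullet> v)"
        by (rule mult_left_mono) simp
      moreover have "v $ r * M $$ (r, c) * v $ c \<le> \<bar>v $ r * M $$ (r, c) * v $ c\<bar>" by simp
      ultimately show ?thesis by (simp add: abs_mult algebra_simps)
    qed
    then have "quad M v \<le> (\<Sum>r<n. \<Sum>c<n. \<bar>M $$ (r, c)\<bar> * (v \<bullet> v))"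
      unfolding quad_sum[OF assms v] by (intro sum_mono) auto
    also have "\<dots> = (C - 1) * (v \<bullet> v)" by (simp add: C_def sum_distrib_right)
    also have "\<dots> \<le> C * (v \<bullet> v)"
      using scalar_prod_self_nonneg[of v] by (intro mult_right_mono) auto
    finally show ?thesis .
  qed
  ultimately show ?thesis by blast
qed

lemma minv_inverse:
  assumes M: "M \<in> carrier_mat n n"
    and inj: "\<And>v. v \<in> carrier_vec n \<Longrightarrow> M *\<^sub>v v = 0\<^sub>v n \<Longrightarrow> v = 0\<^sub>v n"
  shows "minv M \<in> carrier_mat n n" "M * minv M = 1\<^sub>m n" "minv M * M = 1\<^sub>m n"
proof -
  have "Determinant.det M \<noteq> 0" using det_0_iff_vec_prod_zero_field[OF M] inj by blast
  then have "M \<in> Units (ring_mat TYPE(real) n ())"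
    by (rule det_non_zero_imp_unit[OF M])
  then obtain B where B: "mat_inverse M = Some B"
    using mat_inverse(1)[OF M, where b = "()"] by (cases "mat_inverse M") auto
  then show "minv M \<in> carrier_mat n n" "M * minv M = 1\<^sub>m n" "minv M * M = 1\<^sub>m n"
    using mat_inverse(2)[OF M B] by (simp_all add: minv_def)
qed

lemma pos_def_pos:
  assumes "pos_def M" "M \<in> carrier_mat n n" "v \<in> carrier_vec n" "v \<noteq> 0\<^sub>v n"
  shows "0 < quad M v"
  using assms by (auto simp: pos_def_def)

lemma quad_zero: "M \<in> carrier_mat n n \<Longrightarrow> quad M (0\<^sub>v n) = 0"
  by (simp add: quad_def mult_mat_vec_zero)

lemma pos_def_nonneg:
  assumes "pos_def M" "M \<in> carrier_mat n n" "v \<in> carrier_vec n"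
  shows "0 \<le> quad M v"
  using pos_def_pos[OF assms] quad_zero[OF assms(2)] by (cases "v = 0\<^sub>v n") auto

lemma pos_def_inj:
  assumes "pos_def M" "M \<in> carrier_mat n n" "v \<in> carrier_vec n" "M *\<^sub>v v = 0\<^sub>v n"
  shows "v = 0\<^sub>v n"
  using pos_def_pos[OF assms(1-3)] assms by (force simp: quad_def)

lemma pos_def_minv:
  assumes "pos_def M" "M \<in> carrier_mat n n"
  shows "minv M \<in> carrier_mat n n" "M * minv M = 1\<^sub>m n" "minv M * M = 1\<^sub>m n"
  using minv_inverse[OF assms(2) pos_def_inj[OF assms]] by simp_all

lemma mult_minv_vec:
  assumes "M \<in> carrier_mat n n" "minv M \<in> carrier_mat n n" "M * minv M = 1\<^sub>m n"
    "v \<in> carrier_vec n"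
  shows "M *\<^sub>v (minv M *\<^sub>v v) = v"
  using assms by (simp flip: assoc_mult_mat_vec)

lemma pos_def_mult_minv_vec:
  assumes "pos_def M" "M \<in> carrier_mat n n" "v \<in> carrier_vec n"
  shows "M *\<^sub>v (minv M *\<^sub>v v) = v" "minv M *\<^sub>v (M *\<^sub>v v) = v"
  using assms pos_def_minv[OF assms(1,2)] by (simp_all flip: assoc_mult_mat_vec)

lemma pos_def_minv_pos_def:
  assumes "pos_def M" "M \<in> carrier_mat n n"
  shows "pos_def (minv M)"
proof -
  note i = pos_def_minv[OF assms(1,2)]
  have T: "M\<^sup>T = M" using assms by (simp add: pos_def_def)
  have "(minv M)\<^sup>T * M = 1\<^sub>m n"
    using arg_cong[OF i(2), of transpose_mat] transpose_mult[OF assms(2) i(1)] T by simp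
  then have "(minv M)\<^sup>T * (M * minv M) = 1\<^sub>m n * minv M"
    using i assms by (subst assoc_mult_mat[symmetric, of _ n n _ n _ n]) auto
  then have sym: "(minv M)\<^sup>T = minv M" using i by simp
  have "0 < quad (minv M) v" if v: "v \<in> carrier_vec n" "v \<noteq> 0\<^sub>v n" for v
  proof -
    let ?w = "minv M *\<^sub>v v"
    have w: "?w \<in> carrier_vec n" using i v by simp
    have Mw: "M *\<^sub>v ?w = v" by (rule pos_def_mult_minv_vec[OF assms v(1)])
    then have "?w \<noteq> 0\<^sub>v n" using v mult_mat_vec_zero[OF assms(2)] by auto
    then have "0 < quad M ?w" by (rule pos_def_pos[OF assms w])
    also have "quad M ?w = quad (minv M) v"
      unfolding quad_def Mw by (rule comm_scalar_prod[OF w v(1)])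
    finally show ?thesis .
  qed
  with sym i(1) show ?thesis by (auto simp: pos_def_def)
qed

text \<open>If \<open>C\<close> bounds the form of \<open>M\<close> inverse, then \<open>M\<close> is at least \<open>1 / C\<close> times the identity: this is
  the nonnegativity of the form of \<open>M\<close> at \<open>v - w / C\<close> with \<open>M w = v\<close>. The sphere, and hence a
  compactness argument on a type without topology, is avoided.\<close>
lemma pos_def_coercive:
  assumes "pos_def M" "M \<in> carrier_mat n n"
  shows "\<exists>m>0. \<forall>v\<in>carrier_vec n. m * (v \<bullet> v) \<le> quad M v"
proof -
  note i = pos_def_minv[OF assms(1,2)]
  have T: "M\<^sup>T = M" using assms by (simp add: pos_def_def)
  obtain C where C: "C > 0" "\<And>v. v \<in> carrier_vec n \<Longrightarrow> quad (minv M) v \<le> C * (v \<bullet> v)"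
    using quad_upper_bound[OF i(1)] by blast
  have "1 / C * (v \<bullet> v) \<le> quad M v" if v: "v \<in> carrier_vec n" for v
  proof -
    define w where "w = minv M *\<^sub>v v"
    have w: "w \<in> carrier_vec n" using i v by (simp add: w_def)
    have Mw: "M *\<^sub>v w = v" unfolding w_def by (rule pos_def_mult_minv_vec[OF assms v])
    have sw: "(1/C) \<cdot>\<^sub>v w \<in> carrier_vec n" using w by simp
    have Mv: "M *\<^sub>v v \<in> carrier_vec n" using assms v by simp
    have "0 \<le> quad M (v - (1/C) \<cdot>\<^sub>v w)"
      by (rule pos_def_nonneg[OF assms]) (use v w in simp)
    also have "M *\<^sub>v (v - (1/C) \<cdot>\<^sub>v w) = M *\<^sub>v v - (1/C) \<cdot>\<^sub>v v"
      using assms(2) v w sw Mw by (simp add: mult_minus_distrib_mat_vec[OF assms(2) v sw] mult_mat_vec[OF assms(2) w])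
    then have "quad M (v - (1/C) \<cdot>\<^sub>v w) = (v - (1/C) \<cdot>\<^sub>v w) \<bullet> (M *\<^sub>v v - (1/C) \<cdot>\<^sub>v v)"
      by (simp add: quad_def)
    also have "\<dots> = quad M v - (1/C) * (v \<bullet> v) - (1/C) * (w \<bullet> (M *\<^sub>v v)) + (1/C)\<^sup>2 * (w \<bullet> v)"
      using v w Mv by (simp add: minus_scalar_prod_distrib[of _ n] scalar_prod_minus_distrib[of _ n]
          quad_def power2_eq_square algebra_simps)
    also have "w \<bullet> (M *\<^sub>v v) = v \<bullet> v"
      using sym_form_commute[OF assms(2) T w v] Mw by simp
    also have "w \<bullet> v = quad (minv M) v"
      unfolding quad_def w_def[symmetric] by (rule comm_scalar_prod[OF w v])
    also have "(1/C)\<^sup>2 * quad (minv M) v \<le> (1/C)\<^sup>2 * (C * (v \<bullet> v))"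
      by (rule mult_left_mono[OF C(2)[OF v]]) simp
    finally show ?thesis using C(1) by (simp add: power2_eq_square)
  qed
  then show ?thesis using C(1) by (intro exI[of _ "1/C"]) auto
qed

lemma quad_uminus:
  assumes "M \<in> carrier_mat n n" "v \<in> carrier_vec n"
  shows "quad (- M) v = - quad M v"
  using assms by (simp add: quad_def)

lemma neg_def_square:
  assumes "neg_def M"
  shows "M \<in> carrier_mat (dim_row M) (dim_row M)"
proof -
  have "M\<^sup>T = M" using assms by (simp add: neg_def_def)
  then have "dim_row M = dim_col M" using index_transpose_mat(2)[of M] by simp
  then show ?thesis by (intro carrier_matI) simp_all
qed

lemma neg_def_uminus_pos_def:
  assumes "neg_def M"
  shows "pos_def (- M)"
  unfolding pos_def_def
proof (intro conjI ballI impI)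
  have T: "M\<^sup>T = M" using assms unfolding neg_def_def by (rule conjunct1)
  show "(- M)\<^sup>T = - M" by (simp only: transpose_uminus T)
next
  fix v :: "real vec"
  assume v: "v \<in> carrier_vec (dim_row (- M))" "v \<noteq> 0\<^sub>v (dim_row (- M))"
  then have "quad M v < 0" using assms by (simp add: neg_def_def)
  then show "0 < quad (- M) v" using v quad_uminus[OF neg_def_square[OF assms]] by simp
qed

lemma neg_def_coercive:
  assumes "neg_def M"
  shows "\<exists>m>0. \<forall>v\<in>carrier_vec (dim_row M). quad M v \<le> - m * (v \<bullet> v)"
proof -
  obtain n where n: "M \<in> carrier_mat n n" "dim_row M = n" using neg_def_square[OF assms] by blast
  obtain m where "m > 0" "\<forall>v\<in>carrier_vec n. m * (v \<bullet> v) \<le> quad (- M) v"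
    using pos_def_coercive[OF neg_def_uminus_pos_def[OF assms], of n] n(1) by auto
  then show ?thesis using quad_uminus[OF n(1)] n(2) by (intro exI[of _ m]) auto
qed

section \<open>Quadratic forms of block matrices\<close>

definition vconcat :: "real vec list \<Rightarrow> real vec" where
  "vconcat vs = foldr append_vec vs (0\<^sub>v 0)"

lemma vconcat_simps [simp]:
  "vconcat [] = 0\<^sub>v 0"
  "vconcat (v # vs) = v @\<^sub>v vconcat vs"
  by (simp_all add: vconcat_def)

lemma dim_vconcat: "dim_vec (vconcat vs) = sum_list (map dim_vec vs)"
  by (induction vs) auto

lemma scalar_prod_vconcat:
  assumes "length us = length vs" "\<And>i. i < length vs \<Longrightarrow> dim_vec (us ! i) = dim_vec (vs ! i)"
  shows "vconcat us \<bullet> vconcat vs = (\<Sum>i<length vs. us ! i \<bullet> vs ! i)"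
  using assms
proof (induction us vs rule: list_induct2)
  case (Cons u us v vs)
  have d: "dim_vec (us ! i) = dim_vec (vs ! i)" if "i < length vs" for i
    using Cons.prems[of "Suc i"] that by simp
  have "map dim_vec us = map dim_vec vs"
    using d Cons.hyps by (intro nth_equalityI) auto
  then have d': "dim_vec (vconcat us) = dim_vec (vconcat vs)" by (simp add: dim_vconcat)
  have "(u @\<^sub>v vconcat us) \<bullet> (v @\<^sub>v vconcat vs) = u \<bullet> v + vconcat us \<bullet> vconcat vs"
    by (rule scalar_prod_append[OF carrier_vecI carrier_vecI carrier_vecI carrier_vecI])
      (use Cons.prems[of 0] d' in simp_all)
  then show ?case using Cons.IH[OF d] by (simp add: sum.lessThan_Suc_shift del: sum.lessThan_Suc)
qed simp

lemma hcat_Cons: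
  "hcat nr (M # Ms) = four_block_mat M (hcat nr Ms) (0\<^sub>m 0 (dim_col M)) (0\<^sub>m 0 (dim_col (hcat nr Ms)))"
  by (simp add: hcat_def)

text \<open>The product is tested against a vector \<open>u\<close>, so that its value is a sum of numbers and no sum of
  vectors has to be formed.\<close>
lemma hcat_mult_vconcat:
  assumes "length Ms = length vs"
    and "\<And>i. i < length vs \<Longrightarrow> Ms ! i \<in> carrier_mat nr (dim_vec (vs ! i))"
    and u: "u \<in> carrier_vec nr"
  shows "hcat nr Ms \<in> carrier_mat nr (dim_vec (vconcat vs)) \<and>
    u \<bullet> (hcat nr Ms *\<^sub>v vconcat vs) = (\<Sum>i<length vs. u \<bullet> (Ms ! i *\<^sub>v vs ! i))"
  using assms(1,2)
proof (induction Ms vs rule: list_induct2)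
  case Nil
  have "hcat nr [] *\<^sub>v 0\<^sub>v 0 = 0\<^sub>v nr" by (intro eq_vecI) (auto simp: hcat_def)
  then show ?case using u by (simp add: hcat_def)
next
  case (Cons M Ms v vs)
  let ?H = "hcat nr Ms" and ?w = "vconcat vs"
  define p q where "p = dim_vec v" and "q = dim_vec ?w"
  then have vw: "v \<in> carrier_vec p" "?w \<in> carrier_vec q" by simp_all
  have M: "M \<in> carrier_mat nr p" using Cons.prems[of 0] by (simp add: p_def)
  have H: "?H \<in> carrier_mat nr q"
    and IH: "u \<bullet> (?H *\<^sub>v ?w) = (\<Sum>i<length vs. u \<bullet> (Ms ! i *\<^sub>v vs ! i))"
    using Cons.IH Cons.prems[of "Suc _"] by (auto simp: q_def)
  have eq: "hcat nr (M # Ms) = four_block_mat M ?H (0\<^sub>m 0 p) (0\<^sub>m 0 q)"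
    using M H by (simp add: hcat_Cons)
  have "hcat nr (M # Ms) *\<^sub>v (v @\<^sub>v ?w) =
      (M *\<^sub>v v + ?H *\<^sub>v ?w) @\<^sub>v (0\<^sub>m 0 p *\<^sub>v v + 0\<^sub>m 0 q *\<^sub>v ?w)"
    unfolding eq
    by (rule four_block_mat_mult_vec[OF M H zero_carrier_mat zero_carrier_mat vw])
  also have "\<dots> = M *\<^sub>v v + ?H *\<^sub>v ?w" using M H by (intro eq_vecI) auto
  finally have "u \<bullet> (hcat nr (M # Ms) *\<^sub>v (v @\<^sub>v ?w)) = u \<bullet> (M *\<^sub>v v) + u \<bullet> (?H *\<^sub>v ?w)"
    using u M H vw by (simp add: scalar_prod_add_distrib[of _ nr])
  moreover have "hcat nr (M # Ms) \<in> carrier_mat nr (p + q)"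
    unfolding eq using M H by (intro carrier_matI) auto
  ultimately show ?case using IH by (simp add: sum.lessThan_Suc_shift p_def q_def del: sum.lessThan_Suc)
qed

lemma vcat_mult_vec:
  assumes "length Ms = length us"
    and "\<And>i. i < length us \<Longrightarrow> Ms ! i \<in> carrier_mat (dim_vec (us ! i)) nc"
    and v: "v \<in> carrier_vec nc"
  shows "vcat nc Ms \<in> carrier_mat (dim_vec (vconcat us)) nc \<and>
    vconcat us \<bullet> (vcat nc Ms *\<^sub>v v) = (\<Sum>i<length us. us ! i \<bullet> (Ms ! i *\<^sub>v v))"
  using assms(1,2)
proof (induction Ms us rule: list_induct2)
  case Nil
  then show ?case by (simp add: vcat_def scalar_prod_sum)
next
  case (Cons M Ms u us)
  let ?H = "vcat nc Ms" and ?w = "vconcat us"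
  define p q where "p = dim_vec u" and "q = dim_vec ?w"
  then have uw: "u \<in> carrier_vec p" "?w \<in> carrier_vec q" by simp_all
  have M: "M \<in> carrier_mat p nc" using Cons.prems[of 0] by (simp add: p_def)
  have H: "?H \<in> carrier_mat q nc"
    and IH: "?w \<bullet> (?H *\<^sub>v v) = (\<Sum>i<length us. us ! i \<bullet> (Ms ! i *\<^sub>v v))"
    using Cons.IH Cons.prems[of "Suc _"] by (auto simp: q_def)
  have eq: "vcat nc (M # Ms) = M @\<^sub>r ?H" by (simp add: vcat_def)
  have "(M @\<^sub>r ?H) *\<^sub>v v = (M *\<^sub>v v) @\<^sub>v (?H *\<^sub>v v)" by (rule mat_mult_append[OF M H v])
  then have "(u @\<^sub>v ?w) \<bullet> ((M @\<^sub>r ?H) *\<^sub>v v) = u \<bullet> (M *\<^sub>v v) + ?w \<bullet> (?H *\<^sub>v v)"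
    using M H uw v by (simp add: scalar_prod_append[of _ p _ q])
  moreover have "M @\<^sub>r ?H \<in> carrier_mat (p + q) nc" using M H by simp
  ultimately show ?case using IH by (simp add: eq sum.lessThan_Suc_shift p_def q_def del: sum.lessThan_Suc)
qed

lemma quad_block_mat:
  assumes len: "length Mss = length zs" "zs \<noteq> []"
    and row: "\<And>i. i < length zs \<Longrightarrow> length (Mss ! i) = length zs"
    and carr: "\<And>i j. i < length zs \<Longrightarrow> j < length zs \<Longrightarrow>
      Mss ! i ! j \<in> carrier_mat (dim_vec (zs ! i)) (dim_vec (zs ! j))"
  shows "dim_row (block_mat Mss) = dim_vec (vconcat zs)"
    and "quad (block_mat Mss) (vconcat zs) =
      (\<Sum>i<length zs. \<Sum>j<length zs. zs ! i \<bullet> (Mss ! i ! j *\<^sub>v zs ! j))"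
proof -
  let ?Hs = "map (\<lambda>Ms. hcat (dim_row (hd Ms)) Ms) Mss" and ?z = "vconcat zs"
  have "map dim_col (Mss ! 0) = map dim_vec zs"
    using carr[of 0] row[of 0] len(2) by (intro nth_equalityI) auto
  moreover have "hd Mss = Mss ! 0" using len by (intro hd_conv_nth) auto
  ultimately have nc: "sum_list (map dim_col (hd Mss)) = dim_vec ?z"
    by (simp add: dim_vconcat)
  have H: "?Hs ! i \<in> carrier_mat (dim_vec (zs ! i)) (dim_vec ?z) \<and>
      zs ! i \<bullet> (?Hs ! i *\<^sub>v ?z) = (\<Sum>j<length zs. zs ! i \<bullet> (Mss ! i ! j *\<^sub>v zs ! j))"
    if i: "i < length zs" for i
  proof -
    have "hd (Mss ! i) = Mss ! i ! 0" using row[OF i] len by (intro hd_conv_nth) auto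
    then have "dim_row (hd (Mss ! i)) = dim_vec (zs ! i)" using carr[OF i, of 0] len by auto
    then have "?Hs ! i = hcat (dim_vec (zs ! i)) (Mss ! i)" using i len by simp
    then show ?thesis
      using hcat_mult_vconcat[OF row[OF i] carr[OF i] carrier_vec_dim_vec] by simp
  qed
  have eq: "block_mat Mss = vcat (dim_vec ?z) ?Hs" unfolding block_mat_def nc ..
  have v: "vcat (dim_vec ?z) ?Hs \<in> carrier_mat (dim_vec ?z) (dim_vec ?z) \<and>
      ?z \<bullet> (vcat (dim_vec ?z) ?Hs *\<^sub>v ?z) = (\<Sum>i<length zs. zs ! i \<bullet> (?Hs ! i *\<^sub>v ?z))"
    using H len(1) by (intro vcat_mult_vec carrier_vec_dim_vec) auto
  show "dim_row (block_mat Mss) = dim_vec ?z"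
    unfolding eq using v by (rule carrier_matD(1)[OF conjunct1])
  show "quad (block_mat Mss) ?z = (\<Sum>i<length zs. \<Sum>j<length zs. zs ! i \<bullet> (Mss ! i ! j *\<^sub>v zs ! j))"
    unfolding eq using v H by (simp add: quad_def)
qed

lemma sum_symmetrized:
  fixes a :: "nat \<Rightarrow> nat \<Rightarrow> real"
  shows "(\<Sum>i<m. \<Sum>j<m. if j \<le> i then a i j else a j i) =
    (\<Sum>i<m. a i i + 2 * (\<Sum>j<i. a i j))"
proof (induction m)
  case (Suc m)
  have "(\<Sum>i<m. \<Sum>j<Suc m. if j \<le> i then a i j else a j i) =
      (\<Sum>i<m. (\<Sum>j<m. if j \<le> i then a i j else a j i) + a m i)"
    by (intro sum.cong) auto
  then show ?case using Suc by (simp add: sum.distrib)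
qed simp

text \<open>A block above the diagonal is a transpose, so it contributes the same number as its mirror image
  below the diagonal; this is the factor \<open>2\<close>.\<close>
lemma quad_sym_block_mat:
  assumes len: "length Mss = length zs" "zs \<noteq> []"
    and carr: "\<And>i j. i < length zs \<Longrightarrow> j \<le> i \<Longrightarrow>
      Mss ! i ! j \<in> carrier_mat (dim_vec (zs ! i)) (dim_vec (zs ! j))"
  shows "dim_row (sym_block_mat Mss) = dim_vec (vconcat zs)"
    and "quad (sym_block_mat Mss) (vconcat zs) =
      (\<Sum>i<length zs. zs ! i \<bullet> (Mss ! i ! i *\<^sub>v zs ! i) + 2 * (\<Sum>j<i. zs ! i \<bullet> (Mss ! i ! j *\<^sub>v zs ! j)))"
proof -
  define Bss where "Bss = map (\<lambda>i. map (\<lambda>j. if j \<le> i then Mss ! i ! j else (Mss ! j ! i)\<^sup>T)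
      [0..<length Mss]) [0..<length Mss]"
  have nth: "Bss ! i ! j = (if j \<le> i then Mss ! i ! j else (Mss ! j ! i)\<^sup>T)"
    if "i < length zs" "j < length zs" for i j
    using that len by (simp add: Bss_def)
  have blk: "length Bss = length zs" "\<And>i. i < length zs \<Longrightarrow> length (Bss ! i) = length zs"
    "\<And>i j. i < length zs \<Longrightarrow> j < length zs \<Longrightarrow>
      Bss ! i ! j \<in> carrier_mat (dim_vec (zs ! i)) (dim_vec (zs ! j))"
    using len carr by (auto simp: Bss_def nth)
  have eq: "sym_block_mat Mss = block_mat Bss" by (simp add: sym_block_mat_def Bss_def)
  show "dim_row (sym_block_mat Mss) = dim_vec (vconcat zs)"
    unfolding eq using quad_block_mat(1)[OF blk(1) len(2) blk(2,3)] by blast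
  let ?a = "\<lambda>i j. zs ! i \<bullet> (Mss ! i ! j *\<^sub>v zs ! j)"
  have "zs ! i \<bullet> (Bss ! i ! j *\<^sub>v zs ! j) = (if j \<le> i then ?a i j else ?a j i)"
    if ij: "i < length zs" "j < length zs" for i j
  proof (cases "j \<le> i")
    case False
    then have c: "Mss ! j ! i \<in> carrier_mat (dim_vec (zs ! j)) (dim_vec (zs ! i))"
      using carr ij by simp
    have "zs ! i \<bullet> ((Mss ! j ! i)\<^sup>T *\<^sub>v zs ! j) = ((Mss ! j ! i)\<^sup>T *\<^sub>v zs ! j) \<bullet> zs ! i"
      by (rule comm_scalar_prod[OF carrier_vec_dim_vec mult_mat_vec_carrier[OF _ carrier_vec_dim_vec]])
        (use c in simp)
    also have "\<dots> = ?a j i"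
      by (rule transpose_vec_mult_scalar[OF c carrier_vec_dim_vec carrier_vec_dim_vec])
    finally show ?thesis using False ij by (simp add: nth)
  qed (simp add: nth ij)
  then have "quad (block_mat Bss) (vconcat zs) =
      (\<Sum>i<length zs. \<Sum>j<length zs. if j \<le> i then ?a i j else ?a j i)"
    using quad_block_mat(2)[OF blk(1) len(2) blk(2,3)] by simp
  then show "quad (sym_block_mat Mss) (vconcat zs) =
      (\<Sum>i<length zs. ?a i i + 2 * (\<Sum>j<i. ?a i j))"
    unfolding eq sum_symmetrized .
qed

lemma quad_diag_block_mat:
  assumes "length Ms = length zs"
    and "\<And>i. i < length zs \<Longrightarrow> Ms ! i \<in> carrier_mat (dim_vec (zs ! i)) (dim_vec (zs ! i))"
  shows "diag_block_mat Ms \<in> carrier_mat (dim_vec (vconcat zs)) (dim_vec (vconcat zs)) \<and>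
    quad (diag_block_mat Ms) (vconcat zs) = (\<Sum>i<length zs. quad (Ms ! i) (zs ! i))"
  using assms
proof (induction Ms zs rule: list_induct2)
  case Nil
  then show ?case by (simp add: quad_def scalar_prod_sum)
next
  case (Cons M Ms z zs)
  let ?H = "diag_block_mat Ms" and ?w = "vconcat zs"
  define p q where "p = dim_vec z" and "q = dim_vec ?w"
  then have zw: "z \<in> carrier_vec p" "?w \<in> carrier_vec q" by simp_all
  have M: "M \<in> carrier_mat p p" using Cons.prems[of 0] by (simp add: p_def)
  have H: "?H \<in> carrier_mat q q"
    and IH: "quad ?H ?w = (\<Sum>i<length zs. quad (Ms ! i) (zs ! i))"
    using Cons.IH Cons.prems[of "Suc _"] by (auto simp: q_def)
  have eq: "diag_block_mat (M # Ms) = four_block_mat M (0\<^sub>m p q) (0\<^sub>m q p) ?H"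
    using M H by (simp add: Let_def)
  have "diag_block_mat (M # Ms) *\<^sub>v (z @\<^sub>v ?w) =
      (M *\<^sub>v z + 0\<^sub>m p q *\<^sub>v ?w) @\<^sub>v (0\<^sub>m q p *\<^sub>v z + ?H *\<^sub>v ?w)"
    unfolding eq by (rule four_block_mat_mult_vec[OF M zero_carrier_mat zero_carrier_mat H zw])
  also have "\<dots> = (M *\<^sub>v z) @\<^sub>v (?H *\<^sub>v ?w)"
    using M H zw by (intro arg_cong2[of _ _ _ _ append_vec] eq_vecI) auto
  finally have "quad (diag_block_mat (M # Ms)) (z @\<^sub>v ?w) = quad M z + quad ?H ?w"
    using M H zw by (simp add: quad_def scalar_prod_append[of _ p _ q])
  moreover have "diag_block_mat (M # Ms) \<in> carrier_mat (p + q) (p + q)"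
    unfolding eq by (rule four_block_carrier_mat[OF M H])
  ultimately show ?case using IH by (simp add: sum.lessThan_Suc_shift p_def q_def del: diag_block_mat.simps sum.lessThan_Suc)
qed

section \<open>The quadratic form of the first matrix inequality\<close>

lemma scalar_prod_zero_mat:
  "x \<in> carrier_vec nr \<Longrightarrow> z \<in> carrier_vec nc \<Longrightarrow> x \<bullet> (0\<^sub>m nr nc *\<^sub>v z) = (0::real)"
  by (simp add: scalar_prod_sum)

lemma less_six_cases:
  "(i::nat) < 6 \<longleftrightarrow> i = 0 \<or> i = 1 \<or> i = 2 \<or> i = 3 \<or> i = 4 \<or> i = 5"
  by auto

text \<open>The position of the zero blocks in the first matrix inequality decides which pairs of components
  interact. Keeping the other blocks abstract separates this from their contents.\<close>
lemma quad_lmi_pattern: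
  assumes c: "L \<in> carrier_mat n n" "M \<in> carrier_mat n n" "Y \<in> carrier_mat n n"
    "D \<in> carrier_mat e n" "Q1 \<in> carrier_mat e e" "C \<in> carrier_mat p n" "Q2 \<in> carrier_mat p p"
    "F \<in> carrier_mat q n" "Q3 \<in> carrier_mat q q" "V \<in> carrier_mat n n"
    and z: "z1 \<in> carrier_vec n" "z2 \<in> carrier_vec n" "z3 \<in> carrier_vec e" "z4 \<in> carrier_vec p"
    "z5 \<in> carrier_vec q" "z6 \<in> carrier_vec n"
  defines "Mss \<equiv> [[L], [M, - Y], [0\<^sub>m e n, D, Q1], [C, 0\<^sub>m p n, 0\<^sub>m p e, Q2],
      [F, 0\<^sub>m q n, 0\<^sub>m q e, 0\<^sub>m q p, Q3], [V, 0\<^sub>m n n, 0\<^sub>m n e, 0\<^sub>m n p, 0\<^sub>m n q, - Y]]"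
    and "zs \<equiv> [z1, z2, z3, z4, z5, z6]"
  shows "dim_row (sym_block_mat Mss) = dim_vec (vconcat zs)"
    and "quad (sym_block_mat Mss) (vconcat zs) =
      quad L z1 + 2 * (z2 \<bullet> (M *\<^sub>v z1)) - quad Y z2 + 2 * (z3 \<bullet> (D *\<^sub>v z2)) + quad Q1 z3
      + 2 * (z4 \<bullet> (C *\<^sub>v z1)) + quad Q2 z4 + 2 * (z5 \<bullet> (F *\<^sub>v z1)) + quad Q3 z5
      + 2 * (z6 \<bullet> (V *\<^sub>v z1)) - quad Y z6"
proof -
  have len: "length Mss = length zs" "zs \<noteq> []" "length zs = 6" by (simp_all add: Mss_def zs_def)
  have carr: "Mss ! i ! j \<in> carrier_mat (dim_vec (zs ! i)) (dim_vec (zs ! j))"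
    if ij: "i < length zs" "j \<le> i" for i j
  proof -
    have "i < 6" "j < 6" using ij len by simp_all
    then show ?thesis using c z ij(2)
      unfolding less_six_cases Mss_def zs_def by (elim disjE) simp_all
  qed
  show "dim_row (sym_block_mat Mss) = dim_vec (vconcat zs)"
    by (rule quad_sym_block_mat(1)[OF len(1,2) carr])
  have six: "(\<Sum>i<6. f i) = f 0 + f 1 + f 2 + f 3 + f 4 + f 5" for f :: "nat \<Rightarrow> real"
    by (simp add: eval_nat_numeral)
  have low: "(\<Sum>j<1. f j) = f 0" "(\<Sum>j<2. f j) = f 0 + f 1" "(\<Sum>j<3. f j) = f 0 + f 1 + f 2"
    "(\<Sum>j<4. f j) = f 0 + f 1 + f 2 + f 3" "(\<Sum>j<5. f j) = f 0 + f 1 + f 2 + f 3 + f 4"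
    for f :: "nat \<Rightarrow> real"
    by (simp_all add: eval_nat_numeral)
  have uY: "z2 \<bullet> (- Y *\<^sub>v z2) = - quad Y z2" "z6 \<bullet> (- Y *\<^sub>v z6) = - quad Y z6"
    using quad_uminus[OF c(3) z(2)] quad_uminus[OF c(3) z(6)] by (simp_all add: quad_def)
  have nth: "zs ! 0 = z1" "zs ! 1 = z2" "zs ! 2 = z3" "zs ! 3 = z4" "zs ! 4 = z5" "zs ! 5 = z6"
    "Mss ! 0 = [L]" "Mss ! 1 = [M, - Y]" "Mss ! 2 = [0\<^sub>m e n, D, Q1]"
    "Mss ! 3 = [C, 0\<^sub>m p n, 0\<^sub>m p e, Q2]" "Mss ! 4 = [F, 0\<^sub>m q n, 0\<^sub>m q e, 0\<^sub>m q p, Q3]"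
    "Mss ! 5 = [V, 0\<^sub>m n n, 0\<^sub>m n e, 0\<^sub>m n p, 0\<^sub>m n q, - Y]"
    by (simp_all add: Mss_def zs_def)
  have "quad (sym_block_mat Mss) (vconcat zs) = (\<Sum>i<6. zs ! i \<bullet> (Mss ! i ! i *\<^sub>v zs ! i) +
      2 * (\<Sum>j<i. zs ! i \<bullet> (Mss ! i ! j *\<^sub>v zs ! j)))"
    using quad_sym_block_mat(2)[OF len(1,2) carr] unfolding len(3) .
  also have "\<dots> = quad L z1 + 2 * (z2 \<bullet> (M *\<^sub>v z1)) - quad Y z2 + 2 * (z3 \<bullet> (D *\<^sub>v z2)) + quad Q1 z3
      + 2 * (z4 \<bullet> (C *\<^sub>v z1)) + quad Q2 z4 + 2 * (z5 \<bullet> (F *\<^sub>v z1)) + quad Q3 z5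
      + 2 * (z6 \<bullet> (V *\<^sub>v z1)) - quad Y z6"
    unfolding six low nth
    by (simp add: scalar_prod_zero_mat z uY quad_def[of L] quad_def[of Q1] quad_def[of Q2] quad_def[of Q3])
  finally show "quad (sym_block_mat Mss) (vconcat zs) =
      quad L z1 + 2 * (z2 \<bullet> (M *\<^sub>v z1)) - quad Y z2 + 2 * (z3 \<bullet> (D *\<^sub>v z2)) + quad Q1 z3
      + 2 * (z4 \<bullet> (C *\<^sub>v z1)) + quad Q2 z4 + 2 * (z5 \<bullet> (F *\<^sub>v z1)) + quad Q3 z5
      + 2 * (z6 \<bullet> (V *\<^sub>v z1)) - quad Y z6" .
qed

lemma scalar_prod_mat_add:
  fixes M :: "real mat"
  assumes "M \<in> carrier_mat nr nc" "N \<in> carrier_mat nr nc" "x \<in> carrier_vec nr" "z \<in> carrier_vec nc"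
  shows "x \<bullet> ((M + N) *\<^sub>v z) = x \<bullet> (M *\<^sub>v z) + x \<bullet> (N *\<^sub>v z)"
  using assms by (simp add: add_mult_distrib_mat_vec[of _ nr nc] scalar_prod_add_distrib[of _ nr])

lemma quad_transpose:
  fixes V :: "real mat"
  assumes "V \<in> carrier_mat n n" "z \<in> carrier_vec n"
  shows "z \<bullet> (V\<^sup>T *\<^sub>v z) = z \<bullet> (V *\<^sub>v z)"
proof -
  have "z \<bullet> (V\<^sup>T *\<^sub>v z) = (V\<^sup>T *\<^sub>v z) \<bullet> z"
    by (rule comm_scalar_prod[of _ n]) (use assms in simp_all)
  then show ?thesis using transpose_vec_mult_scalar[OF assms(1,2,2)] by simp
qed

lemma quad_minus:
  assumes "M \<in> carrier_mat n n" "N \<in> carrier_mat n n" "z \<in> carrier_vec n"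
  shows "quad (M - N) z = quad M z - quad N z"
proof -
  have "(M - N) *\<^sub>v z = M *\<^sub>v z - N *\<^sub>v z" using assms by (simp add: minus_mult_distrib_mat_vec[of _ n n])
  then show ?thesis using assms by (simp add: quad_def scalar_prod_minus_distrib[of _ n])
qed

lemma quad_one: "z \<in> carrier_vec n \<Longrightarrow> quad (1\<^sub>m n) z = z \<bullet> z"
  by (simp add: quad_def)

lemma sum_nth_eq_sum_set:
  fixes f :: "nat \<Rightarrow> real"
  assumes "distinct js"
  shows "(\<Sum>l<length js. f (js ! l)) = sum f (set js)"
  by (rule sum.reindex_bij_betw[OF bij_betw_nth[OF assms refl refl]])

text \<open>The order in which the coupling matrices are listed in \<^const>\<open>G_row\<close>.\<close>
definition others :: "interconnection \<Rightarrow> nat \<Rightarrow> nat list" where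
  "others S i = filter (\<lambda>j. j \<noteq> i) [0..<subs S]"

lemma others_distinct_set: "distinct (others S i)" "set (others S i) = {..<subs S} - {i}"
  by (auto simp: others_def)

lemma G_row_mult:
  assumes S: "well_formed S" "i < subs S"
    and w: "\<And>j. j < subs S \<Longrightarrow> j \<noteq> i \<Longrightarrow> w j \<in> carrier_vec (gdim S i)"
    and y: "y \<in> carrier_vec (xdim S i)"
  defines "ws \<equiv> vconcat (map w (others S i))"
  shows "G_row S i \<in> carrier_mat (xdim S i) (dim_vec ws)"
    and "y \<bullet> (G_row S i *\<^sub>v ws) = (\<Sum>j\<in>{..<subs S} - {i}. y \<bullet> (Gc S i j *\<^sub>v w j))"
    and "ws \<bullet> ws = (\<Sum>j\<in>{..<subs S} - {i}. w j \<bullet> w j)"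
proof -
  have mem: "others S i ! l < subs S \<and> others S i ! l \<noteq> i" if "l < length (others S i)" for l
    using nth_mem[OF that] others_distinct_set(2)[of S i] by auto
  have "hcat (xdim S i) (map (Gc S i) (others S i)) \<in> carrier_mat (xdim S i) (dim_vec ws) \<and>
    y \<bullet> (hcat (xdim S i) (map (Gc S i) (others S i)) *\<^sub>v ws) =
    (\<Sum>l<length (map w (others S i)). y \<bullet> (map (Gc S i) (others S i) ! l *\<^sub>v map w (others S i) ! l))"
    unfolding ws_def
  proof (rule hcat_mult_vconcat[OF _ _ y])
    fix l assume l: "l < length (map w (others S i))"
    then have "Gc S i (others S i ! l) \<in> carrier_mat (xdim S i) (gdim S i)"
      using S mem[of l] by (auto simp: well_formed_def)
    then show "map (Gc S i) (others S i) ! l \<in> carrier_mat (xdim S i) (dim_vec (map w (others S i) ! l))"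
      using l w[of "others S i ! l"] mem[of l] by simp
  qed simp
  then have H: "G_row S i \<in> carrier_mat (xdim S i) (dim_vec ws)"
    "y \<bullet> (G_row S i *\<^sub>v ws) =
      (\<Sum>l<length (others S i). y \<bullet> (Gc S i (others S i ! l) *\<^sub>v w (others S i ! l)))"
    by (simp_all add: G_row_def others_def[symmetric])
  show "G_row S i \<in> carrier_mat (xdim S i) (dim_vec ws)" by (rule H(1))
  show "y \<bullet> (G_row S i *\<^sub>v ws) = (\<Sum>j\<in>{..<subs S} - {i}. y \<bullet> (Gc S i j *\<^sub>v w j))"
    unfolding H(2) others_distinct_set(2)[symmetric]
    by (rule sum_nth_eq_sum_set[OF others_distinct_set(1), of "\<lambda>j. y \<bullet> (Gc S i j *\<^sub>v w j)"])
  have "ws \<bullet> ws = (\<Sum>l<length (others S i). w (others S i ! l) \<bullet> w (others S i ! l))"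
    unfolding ws_def by (subst scalar_prod_vconcat) auto
  then show "ws \<bullet> ws = (\<Sum>j\<in>{..<subs S} - {i}. w j \<bullet> w j)"
    unfolding others_distinct_set(2)[symmetric]
    using sum_nth_eq_sum_set[OF others_distinct_set(1), of "\<lambda>j. w j \<bullet> w j"] by simp
qed

lemma W_of_carrier: "W_of S i \<in> carrier_mat (xdim S i) (xdim S i)"
  by (simp add: W_of_def msum_def)

lemma R_gap:
  assumes "neg_def (R - 1\<^sub>m s)" "R \<in> carrier_mat s s"
  shows "pos_def (1\<^sub>m s - R)"
proof -
  have "- (R - 1\<^sub>m s) = 1\<^sub>m s - R" using assms(2) by (intro eq_matI) auto
  then show ?thesis using neg_def_uminus_pos_def[OF assms(1)] by simp
qed

text \<open>The form at an arbitrary vector that is split along all block boundaries, also those inside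
  \<^const>\<open>E_mat\<close>, \<^const>\<open>C_mat\<close>, \<^const>\<open>F_mat\<close> and the diagonal blocks. The vector is chosen later.\<close>
lemma quad_lmi1:
  fixes V N Y :: "real mat"
  assumes S: "well_formed S" "i < subs S" "k < verts S"
    and W: "pos_def (W_of S i)" and R: "neg_def (Rw S i - 1\<^sub>m (udim S i))"
    and c: "Y \<in> carrier_mat (xdim S i) (xdim S i)" "V \<in> carrier_mat (xdim S i) (xdim S i)"
      "N \<in> carrier_mat (udim S i) (xdim S i)"
    and w: "\<forall>j<subs S. j \<noteq> i \<longrightarrow> w j \<in> carrier_vec (gdim S i)"
    and z: "z1 \<in> carrier_vec (xdim S i)" "z2 \<in> carrier_vec (xdim S i)" "p \<in> carrier_vec (udim S i)"
      "a \<in> carrier_vec (xdim S i)" "b \<in> carrier_vec (xdim S i)" "q \<in> carrier_vec (udim S i)"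
      "d \<in> carrier_vec (udim S i)" "f \<in> carrier_vec (udim S i)" "z6 \<in> carrier_vec (xdim S i)"
  defines "zz \<equiv> vconcat [z1, z2, vconcat [vconcat (map w (others S i)), p], vconcat [a, b],
      vconcat [q, d, f], z6]"
    and "u \<equiv> N *\<^sub>v z1"
  shows "dim_row (lmi1 S i k Y V N) = dim_vec zz"
    and "quad (lmi1 S i k Y V N) zz =
      - 2 * (z1 \<bullet> (V *\<^sub>v z1))
      + 2 * (z2 \<bullet> (Av S i k *\<^sub>v (V *\<^sub>v z1)) + z2 \<bullet> (Y *\<^sub>v z1)
        + z2 \<bullet> (Bv S i k *\<^sub>v (Lam S i *\<^sub>v u
            + minv (1\<^sub>m (udim S i) - Rw S i) *\<^sub>v (Rw S i *\<^sub>v (Lam S i *\<^sub>v u))))) - quad Y z2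
      + 2 * ((\<Sum>j\<in>{..<subs S} - {i}. z2 \<bullet> (Gc S i j *\<^sub>v w j)) + z2 \<bullet> (Bv S i k *\<^sub>v p))
      - (\<Sum>j\<in>{..<subs S} - {i}. w j \<bullet> w j) + quad (Rw S i - 1\<^sub>m (udim S i)) p
      + 2 * (a \<bullet> (V *\<^sub>v z1) + b \<bullet> (V *\<^sub>v z1)) - quad (minv (Qw S i)) a - quad (minv (W_of S i)) b
      + 2 * (q \<bullet> (Lam S i *\<^sub>v u) + d \<bullet> (Gam S i *\<^sub>v u) + f \<bullet> (Rw S i *\<^sub>v (Lam S i *\<^sub>v u)))
      - quad (minv (Rw S i)) q - d \<bullet> d + quad (Rw S i - 1\<^sub>m (udim S i)) f
      + 2 * (z6 \<bullet> (V *\<^sub>v z1)) - quad Y z6"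
proof -
  define n s where "n = xdim S i" and "s = udim S i"
  let ?R = "Rw S i" and ?Q = "Qw S i" and ?W = "W_of S i" and ?L = "Lam S i" and ?G = "Gam S i"
  let ?A = "Av S i k" and ?B = "Bv S i k" and ?H = "minv (1\<^sub>m s - Rw S i)"
  note c = c[folded n_def s_def] and z = z[folded n_def s_def]
  have m: "?R \<in> carrier_mat s s" "?Q \<in> carrier_mat n n" "?L \<in> carrier_mat s s" "?G \<in> carrier_mat s s"
    "?A \<in> carrier_mat n n" "?B \<in> carrier_mat n s" "pos_def ?Q" "pos_def ?R"
    using S by (auto simp: well_formed_def n_def s_def)
  have Wc: "?W \<in> carrier_mat n n" unfolding n_def by (rule W_of_carrier)
  have gap: "1\<^sub>m s - ?R \<in> carrier_mat s s" "pos_def (1\<^sub>m s - ?R)"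
    by (rule minus_carrier_mat[OF m(1)]) (rule R_gap[OF R[folded s_def] m(1)])
  note inv = pos_def_minv(1)[OF m(7,2)] pos_def_minv(1)[OF m(8,1)]
    pos_def_minv(1)[OF W Wc] pos_def_minv(1)[OF gap(2,1)]
  define ws where "ws = vconcat (map w (others S i))"
  define g where "g = dim_vec ws"
  have ws: "ws \<in> carrier_vec g" by (simp add: g_def)
  let ?Gr = "G_row S i"
  have Gc: "?Gr \<in> carrier_mat n g"
    unfolding n_def g_def ws_def by (rule G_row_mult(1)[OF S(1,2)]) (use w z(2) n_def in auto)
  have G2: "z2 \<bullet> (?Gr *\<^sub>v ws) = (\<Sum>j\<in>{..<subs S} - {i}. z2 \<bullet> (Gc S i j *\<^sub>v w j))"
    unfolding ws_def by (rule G_row_mult(2)[OF S(1,2)]) (use w z(2) n_def in auto)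
  have G3: "ws \<bullet> ws = (\<Sum>j\<in>{..<subs S} - {i}. w j \<bullet> w j)"
    unfolding ws_def by (rule G_row_mult(3)[OF S(1,2)]) (use w z(2) n_def in auto)
  have u: "u \<in> carrier_vec s" using c(3) z(1) by (simp add: u_def)
  have Vz: "V *\<^sub>v z1 \<in> carrier_vec n" using c(2) z(1) by simp

  have vc2: "vconcat [x, y] \<in> carrier_vec (l + m)"
    if "x \<in> carrier_vec l" "y \<in> carrier_vec m" for x y l m
    using that by (intro carrier_vecI) simp
  have vc3: "vconcat [x, y, v] \<in> carrier_vec (l + m + r)"
    if "x \<in> carrier_vec l" "y \<in> carrier_vec m" "v \<in> carrier_vec r" for x y v l m r
    using that by (intro carrier_vecI) simp
  have two: "(\<Sum>i<length [x, y]. h i) = h 0 + h 1"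
    and three: "(\<Sum>i<length [x, y, v]. h i) = h 0 + h 1 + h 2"
    for x y v :: "real vec" and h :: "nat \<Rightarrow> real"
    by (simp_all add: eval_nat_numeral)

  have s3: "3 * s = s + (s + s)" by simp

  have "hcat n [?Gr, ?B] \<in> carrier_mat n (dim_vec (vconcat [ws, p])) \<and>
      z2 \<bullet> (hcat n [?Gr, ?B] *\<^sub>v vconcat [ws, p]) =
      (\<Sum>l<length [ws, p]. z2 \<bullet> ([?Gr, ?B] ! l *\<^sub>v [ws, p] ! l))"
    by (rule hcat_mult_vconcat[OF _ _ z(2)]) (use Gc m(6) ws z(3) in \<open>auto simp: less_Suc_eq\<close>)
  then have E: "E_mat S i k \<in> carrier_mat n (g + s)"
    "z2 \<bullet> (E_mat S i k *\<^sub>v vconcat [ws, p]) = z2 \<bullet> (?Gr *\<^sub>v ws) + z2 \<bullet> (?B *\<^sub>v p)"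
    using ws z(3) unfolding two E_mat_def n_def[symmetric] by simp_all
  have z3c: "vconcat [ws, p] \<in> carrier_vec (g + s)" by (rule vc2[OF ws z(3)])
  have ET: "vconcat [ws, p] \<bullet> ((E_mat S i k)\<^sup>T *\<^sub>v z2) = z2 \<bullet> (?Gr *\<^sub>v ws) + z2 \<bullet> (?B *\<^sub>v p)"
    unfolding E(2)[symmetric]
    by (subst comm_scalar_prod[OF z3c]) (use E(1) z3c z(2) transpose_vec_mult_scalar[OF E(1) z3c z(2)] in auto)

  have "vcat n [1\<^sub>m n, 1\<^sub>m n] \<in> carrier_mat (dim_vec (vconcat [a, b])) n \<and>
      vconcat [a, b] \<bullet> (vcat n [1\<^sub>m n, 1\<^sub>m n] *\<^sub>v (V *\<^sub>v z1)) =
      (\<Sum>l<length [a, b]. [a, b] ! l \<bullet> ([1\<^sub>m n, 1\<^sub>m n] ! l *\<^sub>v (V *\<^sub>v z1)))"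
    by (rule vcat_mult_vec[OF _ _ Vz]) (use z in \<open>auto simp: less_Suc_eq\<close>)
  then have C: "C_mat S i \<in> carrier_mat (2 * n) n"
    "vconcat [a, b] \<bullet> (C_mat S i *\<^sub>v (V *\<^sub>v z1)) = a \<bullet> (V *\<^sub>v z1) + b \<bullet> (V *\<^sub>v z1)"
    using z Vz unfolding two C_mat_def n_def[symmetric] by (simp_all add: mult_2)
  have "vcat s [?L, ?G, ?R * ?L] \<in> carrier_mat (dim_vec (vconcat [q, d, f])) s \<and>
      vconcat [q, d, f] \<bullet> (vcat s [?L, ?G, ?R * ?L] *\<^sub>v u) =
      (\<Sum>l<length [q, d, f]. [q, d, f] ! l \<bullet> ([?L, ?G, ?R * ?L] ! l *\<^sub>v u))"
    by (rule vcat_mult_vec[OF _ _ u]) (use z m in \<open>auto simp: less_Suc_eq\<close>)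
  then have F: "F_mat S i \<in> carrier_mat (3 * s) s"
    "vconcat [q, d, f] \<bullet> (F_mat S i *\<^sub>v u) =
      q \<bullet> (?L *\<^sub>v u) + d \<bullet> (?G *\<^sub>v u) + f \<bullet> (?R *\<^sub>v (?L *\<^sub>v u))"
    using z u m unfolding three F_mat_def s_def[symmetric]
    by (simp_all add: assoc_mult_mat_vec[of _ s s _ s] s3)

  have "diag_block_mat [- 1\<^sub>m g, ?R - 1\<^sub>m s] \<in>
        carrier_mat (dim_vec (vconcat [ws, p])) (dim_vec (vconcat [ws, p])) \<and>
      quad (diag_block_mat [- 1\<^sub>m g, ?R - 1\<^sub>m s]) (vconcat [ws, p]) =
      (\<Sum>l<length [ws, p]. quad ([- 1\<^sub>m g, ?R - 1\<^sub>m s] ! l) ([ws, p] ! l))"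
    by (rule quad_diag_block_mat) (use ws z m(1) in \<open>auto simp: less_Suc_eq\<close>)
  moreover have "Q11 S i = diag_block_mat [- 1\<^sub>m g, ?R - 1\<^sub>m s]"
    using Gc by (simp add: Q11_def s_def)
  ultimately have Q1: "Q11 S i \<in> carrier_mat (g + s) (g + s)"
    "quad (Q11 S i) (vconcat [ws, p]) = - (ws \<bullet> ws) + quad (?R - 1\<^sub>m s) p"
    using ws z(3) quad_uminus[OF one_carrier_mat ws] quad_one[OF ws] unfolding two by simp_all
  have "diag_block_mat [- minv ?Q, - minv ?W] \<in>
        carrier_mat (dim_vec (vconcat [a, b])) (dim_vec (vconcat [a, b])) \<and>
      quad (diag_block_mat [- minv ?Q, - minv ?W]) (vconcat [a, b]) =
      (\<Sum>l<length [a, b]. quad ([- minv ?Q, - minv ?W] ! l) ([a, b] ! l))"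
    by (rule quad_diag_block_mat) (use z inv in \<open>auto simp: less_Suc_eq\<close>)
  then have Q2: "Q22 S i \<in> carrier_mat (2 * n) (2 * n)"
    "quad (Q22 S i) (vconcat [a, b]) = - quad (minv ?Q) a - quad (minv ?W) b"
    using z(4,5) quad_uminus[OF inv(1) z(4)] quad_uminus[OF inv(3) z(5)]
    unfolding two Q22_def by (simp_all add: mult_2)
  have "diag_block_mat [- minv ?R, - 1\<^sub>m s, ?R - 1\<^sub>m s] \<in>
        carrier_mat (dim_vec (vconcat [q, d, f])) (dim_vec (vconcat [q, d, f])) \<and>
      quad (diag_block_mat [- minv ?R, - 1\<^sub>m s, ?R - 1\<^sub>m s]) (vconcat [q, d, f]) =
      (\<Sum>l<length [q, d, f]. quad ([- minv ?R, - 1\<^sub>m s, ?R - 1\<^sub>m s] ! l) ([q, d, f] ! l))"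
    by (rule quad_diag_block_mat) (use z inv m(1) in \<open>auto simp: less_Suc_eq\<close>)
  then have Q3: "Q33 S i \<in> carrier_mat (3 * s) (3 * s)"
    "quad (Q33 S i) (vconcat [q, d, f]) = - quad (minv ?R) q - d \<bullet> d + quad (?R - 1\<^sub>m s) f"
    using z(6,7,8) quad_uminus[OF inv(2) z(6)] quad_uminus[OF one_carrier_mat z(7)] quad_one[OF z(7)]
    unfolding three Q33_def s_def[symmetric] by (simp_all add: s3)

  have V1: "quad (- (V + V\<^sup>T)) z1 = - 2 * (z1 \<bullet> (V *\<^sub>v z1))"
    using c z scalar_prod_mat_add[of V n n "V\<^sup>T" z1 z1] quad_transpose[OF c(2) z(1)]
    by (subst quad_uminus[of _ n]) (auto simp: quad_def)
  have BH: "B_hat S i k = ?B * (1\<^sub>m s + ?H * ?R) * ?L"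
    by (simp add: B_hat_def s_def Let_def)
  have HR: "1\<^sub>m s + ?H * ?R \<in> carrier_mat s s" using inv m by simp
  have Bhc: "B_hat S i k \<in> carrier_mat n s" unfolding BH using HR m by simp
  have Lu: "?L *\<^sub>v u \<in> carrier_vec s" "?R *\<^sub>v (?L *\<^sub>v u) \<in> carrier_vec s" using m u by simp_all
  have "(1\<^sub>m s + ?H * ?R) *\<^sub>v (?L *\<^sub>v u) = ?L *\<^sub>v u + ?H *\<^sub>v (?R *\<^sub>v (?L *\<^sub>v u))"
    using inv m Lu by (simp add: add_mult_distrib_mat_vec[of _ s s] assoc_mult_mat_vec[of _ s s _ s])
  moreover have "B_hat S i k *\<^sub>v u = ?B *\<^sub>v ((1\<^sub>m s + ?H * ?R) *\<^sub>v (?L *\<^sub>v u))"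
    unfolding BH using HR m u Lu
    by (simp add: assoc_mult_mat_vec[of _ n s _ s])
  ultimately have Bu: "B_hat S i k *\<^sub>v u = ?B *\<^sub>v (?L *\<^sub>v u + ?H *\<^sub>v (?R *\<^sub>v (?L *\<^sub>v u)))" by simp
  have M2: "z2 \<bullet> ((?A * V + Y + B_hat S i k * N) *\<^sub>v z1) =
      z2 \<bullet> (?A *\<^sub>v (V *\<^sub>v z1)) + z2 \<bullet> (Y *\<^sub>v z1) + z2 \<bullet> (B_hat S i k *\<^sub>v u)"
    using c m z Bhc
    by (simp add: scalar_prod_mat_add[of _ n n] assoc_mult_mat_vec[of _ n n _ n]
        assoc_mult_mat_vec[of _ n s _ n] u_def)

  have c': "- (V + V\<^sup>T) \<in> carrier_mat n n" "?A * V + Y + B_hat S i k * N \<in> carrier_mat n n"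
    "(E_mat S i k)\<^sup>T \<in> carrier_mat (g + s) n" "C_mat S i * V \<in> carrier_mat (2 * n) n"
    "F_mat S i * N \<in> carrier_mat (3 * s) n"
    using c m Bhc E(1) C(1) F(1) by simp_all
  have z4c: "vconcat [a, b] \<in> carrier_vec (2 * n)" using vc2[OF z(4,5)] by (simp add: mult_2)
  have z5c: "vconcat [q, d, f] \<in> carrier_vec (3 * s)" using vc3[OF z(6-8)] by (simp add: s3 add.assoc)
  have e: "dim_row (Q11 S i) = g + s" using Q1(1) by simp
  note pat = quad_lmi_pattern[OF c'(1,2) c(1) c'(3) Q1(1) c'(4) Q2(1) c'(5) Q3(1) c(2)
      z(1,2) z3c z4c z5c z(9)]
  have CV: "(C_mat S i * V) *\<^sub>v z1 = C_mat S i *\<^sub>v (V *\<^sub>v z1)"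
    by (rule assoc_mult_mat_vec[OF C(1) c(2) z(1)])
  have FN: "(F_mat S i * N) *\<^sub>v z1 = F_mat S i *\<^sub>v u"
    unfolding u_def by (rule assoc_mult_mat_vec[OF F(1) c(3) z(1)])
  show "dim_row (lmi1 S i k Y V N) = dim_vec zz"
    unfolding lmi1_def Let_def e zz_def n_def[symmetric] s_def[symmetric] ws_def[symmetric]
    by (rule pat(1))
  have "quad (lmi1 S i k Y V N) zz =
      quad (- (V + V\<^sup>T)) z1 + 2 * (z2 \<bullet> ((?A * V + Y + B_hat S i k * N) *\<^sub>v z1)) - quad Y z2 
      + 2 * (vconcat [ws, p] \<bullet> ((E_mat S i k)\<^sup>T *\<^sub>v z2)) + quad (Q11 S i) (vconcat [ws, p])
      + 2 * (vconcat [a, b] \<bullet> ((C_mat S i * V) *\<^sub>v z1)) + quad (Q22 S i) (vconcat [a, b])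
      + 2 * (vconcat [q, d, f] \<bullet> ((F_mat S i * N) *\<^sub>v z1)) + quad (Q33 S i) (vconcat [q, d, f])
      + 2 * (z6 \<bullet> (V *\<^sub>v z1)) - quad Y z6"
    unfolding lmi1_def Let_def e zz_def n_def[symmetric] s_def[symmetric] ws_def[symmetric]
    by (rule pat(2))
  then show "quad (lmi1 S i k Y V N) zz =
      - 2 * (z1 \<bullet> (V *\<^sub>v z1))
      + 2 * (z2 \<bullet> (?A *\<^sub>v (V *\<^sub>v z1)) + z2 \<bullet> (Y *\<^sub>v z1)
        + z2 \<bullet> (?B *\<^sub>v (?L *\<^sub>v u
            + minv (1\<^sub>m (udim S i) - ?R) *\<^sub>v (?R *\<^sub>v (?L *\<^sub>v u))))) - quad Y z2
      + 2 * ((\<Sum>j\<in>{..<subs S} - {i}. z2 \<bullet> (Gc S i j *\<^sub>v w j)) + z2 \<bullet> (?B *\<^sub>v p))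
      - (\<Sum>j\<in>{..<subs S} - {i}. w j \<bullet> w j) + quad (?R - 1\<^sub>m (udim S i)) p
      + 2 * (a \<bullet> (V *\<^sub>v z1) + b \<bullet> (V *\<^sub>v z1)) - quad (minv ?Q) a - quad (minv ?W) b
      + 2 * (q \<bullet> (?L *\<^sub>v u) + d \<bullet> (?G *\<^sub>v u) + f \<bullet> (?R *\<^sub>v (?L *\<^sub>v u)))
      - quad (minv ?R) q - d \<bullet> d + quad (?R - 1\<^sub>m (udim S i)) f
      + 2 * (z6 \<bullet> (V *\<^sub>v z1)) - quad Y z6"
    unfolding V1 M2 ET Q1(2) CV C(2) Q2(2) FN F(2) Q3(2) Bu G2 G3 s_def[symmetric] by simp
qed

section \<open>Dissipation at a vertex\<close>

lemma quad_add:
  assumes M: "M \<in> carrier_mat n n" "M\<^sup>T = M" and v: "v \<in> carrier_vec n" "w \<in> carrier_vec n"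
  shows "quad M (v + w) = quad M v + 2 * (w \<bullet> (M *\<^sub>v v)) + quad M w"
proof -
  have Mv: "M *\<^sub>v v \<in> carrier_vec n" "M *\<^sub>v w \<in> carrier_vec n" using M v by simp_all
  have "M *\<^sub>v (v + w) = M *\<^sub>v v + M *\<^sub>v w" by (rule mult_add_distrib_mat_vec[OF M(1) v])
  then have "quad M (v + w) = (v + w) \<bullet> (M *\<^sub>v v + M *\<^sub>v w)" by (simp add: quad_def)
  also have "\<dots> = quad M v + v \<bullet> (M *\<^sub>v w) + (w \<bullet> (M *\<^sub>v v) + quad M w)"
    using v Mv by (simp add: add_scalar_prod_distrib[of _ n] scalar_prod_add_distrib[of _ n] quad_def)
  finally show ?thesis using sym_form_commute[OF M v] by simp
qed

lemma quad_diff: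
  assumes M: "M \<in> carrier_mat n n" "M\<^sup>T = M" and v: "v \<in> carrier_vec n" "w \<in> carrier_vec n"
  shows "quad M (v - w) = quad M v - 2 * (v \<bullet> (M *\<^sub>v w)) + quad M w"
proof -
  have Mv: "M *\<^sub>v v \<in> carrier_vec n" "M *\<^sub>v w \<in> carrier_vec n" using M v by simp_all
  have "M *\<^sub>v (v - w) = M *\<^sub>v v - M *\<^sub>v w" by (rule mult_minus_distrib_mat_vec[OF M(1) v])
  then have "quad M (v - w) = (v - w) \<bullet> (M *\<^sub>v v - M *\<^sub>v w)" by (simp add: quad_def)
  also have "\<dots> = quad M v - v \<bullet> (M *\<^sub>v w) - (w \<bullet> (M *\<^sub>v v) - quad M w)"
    using v Mv by (simp add: minus_scalar_prod_distrib[of _ n] scalar_prod_minus_distrib[of _ n] quad_def)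
  finally show ?thesis using sym_form_commute[OF M v] by simp
qed

lemma quad_minv_mult:
  assumes "pos_def M" "M \<in> carrier_mat n n" "v \<in> carrier_vec n"
  shows "quad (minv M) (M *\<^sub>v v) = quad M v"
proof -
  have "quad (minv M) (M *\<^sub>v v) = (M *\<^sub>v v) \<bullet> v"
    using pos_def_mult_minv_vec(2)[OF assms] by (simp add: quad_def)
  also have "\<dots> = quad M v"
    unfolding quad_def by (rule comm_scalar_prod[of _ n]) (use assms in simp_all)
  finally show ?thesis .
qed

lemma vconcat_component_le:
  assumes "l < length vs"
  shows "vs ! l \<bullet> vs ! l \<le> vconcat vs \<bullet> vconcat vs"
proof -
  have "vs ! l \<bullet> vs ! l \<le> (\<Sum>i<length vs. vs ! i \<bullet> vs ! i)"
    using assms by (intro member_le_sum) (auto simp: scalar_prod_self_nonneg)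
  also have "\<dots> = vconcat vs \<bullet> vconcat vs" by (subst scalar_prod_vconcat) auto
  finally show ?thesis .
qed

text \<open>At the vector with first component \<open>z\<close> and all others zero only the term \<open>- 2 (z \<bullet> V z)\<close> survives. If
  \<open>V z = 0\<close>, the form vanishes there, which a negative definite form does at zero only.\<close>
lemma lmi1_V_injective:
  fixes V N Y :: "real mat"
  assumes S: "well_formed S" "i < subs S" "k < verts S"
    and W: "pos_def (W_of S i)" and R: "neg_def (Rw S i - 1\<^sub>m (udim S i))"
    and c: "Y \<in> carrier_mat (xdim S i) (xdim S i)" "V \<in> carrier_mat (xdim S i) (xdim S i)"
      "N \<in> carrier_mat (udim S i) (xdim S i)"
    and lmi: "neg_def (lmi1 S i k Y V N)"
    and z: "z \<in> carrier_vec (xdim S i)" "V *\<^sub>v z = 0\<^sub>v (xdim S i)"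
  shows "z = 0\<^sub>v (xdim S i)"
proof (rule ccontr)
  assume nz: "z \<noteq> 0\<^sub>v (xdim S i)"
  define n s where "n = xdim S i" and "s = udim S i"
  define w where "w = (\<lambda>j::nat. 0\<^sub>v (gdim S i) :: real vec)"
  let ?zz = "vconcat [z, 0\<^sub>v n, vconcat [vconcat (map w (others S i)), 0\<^sub>v s],
      vconcat [0\<^sub>v n, 0\<^sub>v n], vconcat [0\<^sub>v s, 0\<^sub>v s, 0\<^sub>v s], 0\<^sub>v n]"
  have wc: "\<forall>j<subs S. j \<noteq> i \<longrightarrow> w j \<in> carrier_vec (gdim S i)" by (simp add: w_def)
  note zc = z(1)[folded n_def]
  note q = quad_lmi1[OF S W R c wc z(1) zero_carrier_vec zero_carrier_vec zero_carrier_vec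
      zero_carrier_vec zero_carrier_vec zero_carrier_vec zero_carrier_vec zero_carrier_vec,
      folded n_def s_def]
  have inv: "minv (1\<^sub>m s - Rw S i) \<in> carrier_mat s s" "minv (Rw S i) \<in> carrier_mat s s"
    "minv (Qw S i) \<in> carrier_mat n n" "minv (W_of S i) \<in> carrier_mat n n"
    and m: "Rw S i \<in> carrier_mat s s" "Lam S i \<in> carrier_mat s s" "Gam S i \<in> carrier_mat s s"
      "Av S i k \<in> carrier_mat n n" "Bv S i k \<in> carrier_mat n s"
    and Gc: "j < subs S \<Longrightarrow> j \<noteq> i \<Longrightarrow> Gc S i j \<in> carrier_mat n (gdim S i)" for j
  proof -
    have "pos_def (1\<^sub>m s - Rw S i)" "pos_def (Rw S i)" "pos_def (Qw S i)"
      "Rw S i \<in> carrier_mat s s" "Qw S i \<in> carrier_mat n n"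
      "1\<^sub>m s - Rw S i \<in> carrier_mat s s"
      using S R_gap[OF R] minus_carrier_mat[of "Rw S i" s s "1\<^sub>m s"] by (auto simp: well_formed_def n_def s_def)
    then show "minv (1\<^sub>m s - Rw S i) \<in> carrier_mat s s" "minv (Rw S i) \<in> carrier_mat s s"
      "minv (Qw S i) \<in> carrier_mat n n" "minv (W_of S i) \<in> carrier_mat n n"
      using pos_def_minv(1)[of _ n] pos_def_minv(1)[of _ s] W W_of_carrier[of S i]
      by (auto simp: n_def)
  qed (use S in \<open>auto simp: well_formed_def n_def s_def\<close>)
  note cc = c[folded n_def s_def]
  have d: "dim_row (lmi1 S i k Y V N) = dim_vec ?zz" by (rule q(1))
  have Nz: "N *\<^sub>v z \<in> carrier_vec s" using cc zc by simp
  have Gz: "(\<Sum>j\<in>{..<subs S} - {i}. 0\<^sub>v n \<bullet> (Gc S i j *\<^sub>v w j)) = 0"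
    by (intro sum.neutral ballI) (use Gc in \<open>auto simp: w_def mult_mat_vec_zero[of _ n "gdim S i"]\<close>)
  have wz: "(\<Sum>j\<in>{..<subs S} - {i}. w j \<bullet> w j) = 0"
    by (intro sum.neutral ballI) (auto simp: w_def)
  have "quad (lmi1 S i k Y V N) ?zz = 0"
    unfolding q(2) z(2)[folded n_def] Gz wz
    using inv m cc zc Nz by (simp add: quad_zero[of _ n] quad_zero[of _ s] quad_zero[OF minus_carrier_mat[OF one_carrier_mat]] mult_mat_vec_zero[of _ n n] mult_mat_vec_zero[of _ n s])
  moreover have "0 < ?zz \<bullet> ?zz"
    using vconcat_component_le[of 0 "[z, 0\<^sub>v n, vconcat [vconcat (map w (others S i)), 0\<^sub>v s],
      vconcat [0\<^sub>v n, 0\<^sub>v n], vconcat [0\<^sub>v s, 0\<^sub>v s, 0\<^sub>v s], 0\<^sub>v n]"] scalar_prod_self_pos[OF z(1) nz]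
    by simp
  moreover obtain mm where "mm > 0" "quad (lmi1 S i k Y V N) ?zz \<le> - mm * (?zz \<bullet> ?zz)"
    using neg_def_coercive[OF lmi] carrier_vec_dim_vec[of ?zz] unfolding d by blast
  ultimately show False by (simp add: mult_le_0_iff)
qed

text \<open>The test vector has the components
  \<open>z = V\<inverse> x\<close>, \<open>y\<close>, \<open>(w, p - e)\<close>, \<open>(Q x, W x)\<close>, \<open>(h, \<Gamma> u, e)\<close>, \<open>y\<close>,
  where \<open>h = R \<Lambda> u\<close> and \<open>(I - R) e = h\<close>. The fourth and the fifth component maximise the form when the
  others are given, and turn their block rows into \<open>x \<bullet> Q x\<close>, \<open>x \<bullet> W x\<close> and quadratic terms in \<open>u\<close>.
  The shift of the fault \<open>p\<close> by \<open>e\<close> produces the cross term \<open>2 (p \<bullet> h)\<close> of the control cost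
  \<open>(\<Lambda> u + p) \<bullet> R (\<Lambda> u + p)\<close>; it is compensated by the correction \<open>(I - R)\<inverse> R\<close> in \<^const>\<open>B_hat\<close>, so that \<open>B\<close> acts on
  \<open>\<Lambda> u + p\<close> in the end. The vector \<open>y\<close> stays free here: it will be \<open>P x\<close> with a matrix \<open>P\<close> that does
  not depend on the vertex \<open>k\<close>, and then the first two terms vanish in the average over the vertices.
  The margin \<open>m\<close> comes from the second component of the test vector.\<close>
lemma vertex_dissipation:
  fixes V N Y :: "real mat"
  assumes S: "well_formed S" "i < subs S" "k < verts S"
    and W: "pos_def (W_of S i)" and R: "neg_def (Rw S i - 1\<^sub>m (udim S i))"
    and c: "Y \<in> carrier_mat (xdim S i) (xdim S i)" "V \<in> carrier_mat (xdim S i) (xdim S i)"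
      "N \<in> carrier_mat (udim S i) (xdim S i)"
    and Y: "pos_def Y" and lmi: "neg_def (lmi1 S i k Y V N)"
  shows "\<exists>m>0. \<forall>x\<in>carrier_vec (xdim S i). \<forall>y\<in>carrier_vec (xdim S i).
    \<forall>p\<in>carrier_vec (udim S i). \<forall>w.
    (\<forall>j<subs S. j \<noteq> i \<longrightarrow> w j \<in> carrier_vec (gdim S i)) \<longrightarrow>
    (let z = minv V *\<^sub>v x; u = N *\<^sub>v z; v = Lam S i *\<^sub>v u + p in
      2 * (z \<bullet> (Y *\<^sub>v y) - z \<bullet> x) + 2 * (y \<bullet> x - y \<bullet> (Y *\<^sub>v y))
      + 2 * (y \<bullet> (Av S i k *\<^sub>v x) + y \<bullet> (Bv S i k *\<^sub>v v)
          + (\<Sum>j\<in>{..<subs S} - {i}. y \<bullet> (Gc S i j *\<^sub>v w j)))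
      - (\<Sum>j\<in>{..<subs S} - {i}. w j \<bullet> w j)
      + quad (Qw S i) x + quad (W_of S i) x + quad (Rw S i) v
      + (Gam S i *\<^sub>v u) \<bullet> (Gam S i *\<^sub>v u) - p \<bullet> p \<le> - m * (y \<bullet> y))"
proof -
  define n s where "n = xdim S i" and "s = udim S i"
  let ?R = "Rw S i" and ?Q = "Qw S i" and ?W = "W_of S i" and ?L = "Lam S i" and ?G = "Gam S i"
  let ?A = "Av S i k" and ?B = "Bv S i k" and ?H = "minv (1\<^sub>m s - Rw S i)"
  let ?J = "{..<subs S} - {i}"
  have m: "?R \<in> carrier_mat s s" "?Q \<in> carrier_mat n n" "?L \<in> carrier_mat s s" "?G \<in> carrier_mat s s"
    "?A \<in> carrier_mat n n" "?B \<in> carrier_mat n s" "pos_def ?Q" "pos_def ?R"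
    using S by (auto simp: well_formed_def n_def s_def)
  have RT: "?R\<^sup>T = ?R" using m(8) by (simp add: pos_def_def)
  have YT: "Y\<^sup>T = Y" using Y by (simp add: pos_def_def)
  have Wc: "?W \<in> carrier_mat n n" unfolding n_def by (rule W_of_carrier)
  have gap: "1\<^sub>m s - ?R \<in> carrier_mat s s" "pos_def (1\<^sub>m s - ?R)"
    by (rule minus_carrier_mat[OF m(1)]) (rule R_gap[OF R[folded s_def] m(1)])
  note inv = pos_def_minv(1)[OF m(7,2)] pos_def_minv(1)[OF m(8,1)]
    pos_def_minv(1)[OF W Wc] pos_def_minv(1)[OF gap(2,1)]
  note cc = c[folded n_def s_def]
  have Vinv: "minv V \<in> carrier_mat n n" "V * minv V = 1\<^sub>m n"
    using minv_inverse(1,2)[OF cc(2)] lmi1_V_injective[OF S W R c lmi] by (auto simp: n_def)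
  obtain \<mu> where \<mu>: "\<mu> > 0"
    "\<And>z. z \<in> carrier_vec (dim_row (lmi1 S i k Y V N)) \<Longrightarrow> quad (lmi1 S i k Y V N) z \<le> - \<mu> * (z \<bullet> z)"
    using neg_def_coercive[OF lmi] by blast
  show ?thesis
    unfolding Let_def
  proof (intro exI[of _ \<mu>] conjI \<mu>(1) ballI allI impI)
    fix x y p :: "real vec" and w :: "nat \<Rightarrow> real vec"
    assume x: "x \<in> carrier_vec (xdim S i)" and y: "y \<in> carrier_vec (xdim S i)"
      and p: "p \<in> carrier_vec (udim S i)"
      and w: "\<forall>j<subs S. j \<noteq> i \<longrightarrow> w j \<in> carrier_vec (gdim S i)"
    note x = x[folded n_def] and y = y[folded n_def] and p = p[folded s_def]
    define z where "z = minv V *\<^sub>v x"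
    define u where "u = N *\<^sub>v z"
    define l where "l = ?L *\<^sub>v u"
    define h where "h = ?R *\<^sub>v l"
    define e where "e = ?H *\<^sub>v h"
    have z: "z \<in> carrier_vec n" using Vinv x by (simp add: z_def)
    have Vz: "V *\<^sub>v z = x" unfolding z_def by (rule mult_minv_vec[OF cc(2) Vinv x])
    have u: "u \<in> carrier_vec s" using cc z by (simp add: u_def)
    have l: "l \<in> carrier_vec s" using m u by (simp add: l_def)
    have h: "h \<in> carrier_vec s" using m l by (simp add: h_def)
    have e: "e \<in> carrier_vec s" using inv h by (simp add: e_def)
    have Gu: "?G *\<^sub>v u \<in> carrier_vec s" using m u by simp
    have pe: "p - e \<in> carrier_vec s" using p e by simp
    have le: "l + e \<in> carrier_vec s" using l e by simp
    have Qx: "?Q *\<^sub>v x \<in> carrier_vec n" and Wx: "?W *\<^sub>v x \<in> carrier_vec n"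
      using m Wc x by simp_all
    \<comment> \<open>\<open>(I - R) e = h\<close> eliminates the matrix \<open>R\<close> wherever it meets \<open>e\<close>.\<close>
    have Re: "t \<bullet> (?R *\<^sub>v e) = t \<bullet> e - t \<bullet> h" if t: "t \<in> carrier_vec s" for t
    proof -
      have "h = (1\<^sub>m s - ?R) *\<^sub>v e" unfolding e_def
        using pos_def_mult_minv_vec(1)[OF gap(2,1) h] by simp
      also have "\<dots> = e - ?R *\<^sub>v e" using m e by (simp add: minus_mult_distrib_mat_vec[of _ s s])
      finally have "t \<bullet> h = t \<bullet> e - t \<bullet> (?R *\<^sub>v e)"
        using m e t by (simp add: scalar_prod_minus_distrib[of _ s])
      then show ?thesis by simp
    qed
    have R1: "quad (?R - 1\<^sub>m s) v = quad ?R v - v \<bullet> v" if "v \<in> carrier_vec s" for v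
      using quad_minus[OF m(1) one_carrier_mat that] quad_one[OF that] by simp
    have pe2: "quad (?R - 1\<^sub>m s) (p - e) = quad ?R p - p \<bullet> p + 2 * (p \<bullet> h) - e \<bullet> h"
    proof -
      have "quad (1\<^sub>m s) (p - e) = p \<bullet> p - 2 * (p \<bullet> e) + e \<bullet> e"
        using quad_diff[OF one_carrier_mat transpose_one p e] p e by (simp add: quad_one)
      then show ?thesis
        using quad_minus[OF m(1) one_carrier_mat pe] quad_diff[OF m(1) RT p e] Re[OF p] Re[OF e]
        by (simp add: quad_def[of _ e])
    qed
    have e2: "quad (?R - 1\<^sub>m s) e = - (e \<bullet> h)"
      using R1[OF e] Re[OF e] by (simp add: quad_def)
    have lp: "quad ?R (l + p) = quad ?R l + 2 * (p \<bullet> h) + quad ?R p"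
      unfolding h_def by (rule quad_add[OF m(1) RT l p])
    have hl: "h \<bullet> l = quad ?R l" unfolding h_def quad_def
      by (rule comm_scalar_prod[OF h[unfolded h_def] l])
    have qh: "quad (minv ?R) h = quad ?R l"
      unfolding h_def by (rule quad_minv_mult[OF m(8,1) l])
    have qa: "quad (minv ?Q) (?Q *\<^sub>v x) = quad ?Q x" "quad (minv ?W) (?W *\<^sub>v x) = quad ?W x"
      by (rule quad_minv_mult[OF m(7,2) x]) (rule quad_minv_mult[OF W Wc x])
    have ax: "(?Q *\<^sub>v x) \<bullet> x = quad ?Q x" "(?W *\<^sub>v x) \<bullet> x = quad ?W x"
      unfolding quad_def by (rule comm_scalar_prod[OF Qx x]) (rule comm_scalar_prod[OF Wx x])
    have By: "y \<bullet> (?B *\<^sub>v (l + e)) + y \<bullet> (?B *\<^sub>v (p - e)) = y \<bullet> (?B *\<^sub>v (l + p))"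
      using m y l e p
      by (simp add: mult_add_distrib_mat_vec[of _ n s] mult_minus_distrib_mat_vec[of _ n s]
          scalar_prod_add_distrib[of _ n] scalar_prod_minus_distrib[of _ n])
    have Yy: "y \<bullet> (Y *\<^sub>v z) = z \<bullet> (Y *\<^sub>v y)"
      by (rule sym_form_commute[OF cc(1) YT y z])
    define vs where "vs = [z, y, vconcat [vconcat (map w (others S i)), p - e],
      vconcat [?Q *\<^sub>v x, ?W *\<^sub>v x], vconcat [h, ?G *\<^sub>v u, e], y]"
    note q = quad_lmi1[OF S W R c w, folded n_def s_def, OF z y pe Qx Wx h Gu e y,
        folded vs_def u_def, folded l_def, folded h_def, folded e_def, unfolded Vz]
    have d: "dim_row (lmi1 S i k Y V N) = dim_vec (vconcat vs)" by (rule q(1))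
    have "vconcat vs \<in> carrier_vec (dim_row (lmi1 S i k Y V N))" unfolding d by simp
    then have "quad (lmi1 S i k Y V N) (vconcat vs) \<le> - \<mu> * (vconcat vs \<bullet> vconcat vs)"
      by (rule \<mu>(2))
    also have "\<dots> \<le> - \<mu> * (y \<bullet> y)"
      using vconcat_component_le[of 1 vs] \<mu>(1) by (simp add: vs_def)
    finally have "quad (lmi1 S i k Y V N) (vconcat vs) \<le> - \<mu> * (y \<bullet> y)" .
    moreover have "quad (lmi1 S i k Y V N) (vconcat vs) =
      2 * (z \<bullet> (Y *\<^sub>v y) - z \<bullet> x) + 2 * (y \<bullet> x - y \<bullet> (Y *\<^sub>v y))
      + 2 * (y \<bullet> (?A *\<^sub>v x) + y \<bullet> (?B *\<^sub>v (l + p)) + (\<Sum>j\<in>?J. y \<bullet> (Gc S i j *\<^sub>v w j)))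
      - (\<Sum>j\<in>?J. w j \<bullet> w j)
      + quad ?Q x + quad ?W x + quad ?R (l + p) + (?G *\<^sub>v u) \<bullet> (?G *\<^sub>v u) - p \<bullet> p"
      unfolding q(2) pe2 e2 lp hl qh qa ax Yy By[symmetric]
      by (simp add: quad_def[of Y] algebra_simps)
    ultimately show "2 * ((minv V *\<^sub>v x) \<bullet> (Y *\<^sub>v y) - (minv V *\<^sub>v x) \<bullet> x) + 2 * (y \<bullet> x - y \<bullet> (Y *\<^sub>v y))
      + 2 * (y \<bullet> (?A *\<^sub>v x) + y \<bullet> (?B *\<^sub>v (?L *\<^sub>v (N *\<^sub>v (minv V *\<^sub>v x)) + p))
          + (\<Sum>j\<in>?J. y \<bullet> (Gc S i j *\<^sub>v w j)))
      - (\<Sum>j\<in>?J. w j \<bullet> w j)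
      + quad ?Q x + quad ?W x + quad ?R (?L *\<^sub>v (N *\<^sub>v (minv V *\<^sub>v x)) + p)
      + (?G *\<^sub>v (N *\<^sub>v (minv V *\<^sub>v x))) \<bullet> (?G *\<^sub>v (N *\<^sub>v (minv V *\<^sub>v x))) - p \<bullet> p \<le> - \<mu> * (y \<bullet> y)"
      by (simp add: z_def u_def l_def)
  qed
qed

section \<open>Averaging over the parameter simplex\<close>

lemma msum_carrier [simp]: "msum nr nc M I \<in> carrier_mat nr nc"
  by (simp add: msum_def)

lemma dim_msum [simp]: "dim_row (msum nr nc M I) = nr" "dim_col (msum nr nc M I) = nc"
  by (simp_all add: msum_def)

lemma form_msum:
  assumes M: "\<And>k. k \<in> I \<Longrightarrow> M k \<in> carrier_mat nr nc"
    and v: "v \<in> carrier_vec nr" and w: "w \<in> carrier_vec nc"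
  shows "v \<bullet> (msum nr nc M I *\<^sub>v w) = (\<Sum>k\<in>I. v \<bullet> (M k *\<^sub>v w))"
proof -
  have "v \<bullet> (msum nr nc M I *\<^sub>v w) = (\<Sum>r<nr. \<Sum>c<nc. \<Sum>k\<in>I. v $ r * M k $$ (r, c) * w $ c)"
    unfolding form_sum[OF msum_carrier v w]
    by (simp add: msum_def sum_distrib_left sum_distrib_right)
  also have "\<dots> = (\<Sum>r<nr. \<Sum>k\<in>I. \<Sum>c<nc. v $ r * M k $$ (r, c) * w $ c)"
    by (intro sum.cong refl sum.swap)
  also have "\<dots> = (\<Sum>k\<in>I. \<Sum>r<nr. \<Sum>c<nc. v $ r * M k $$ (r, c) * w $ c)"
    by (rule sum.swap)
  also have "\<dots> = (\<Sum>k\<in>I. v \<bullet> (M k *\<^sub>v w))"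
    by (intro sum.cong refl) (simp add: form_sum[OF M v w])
  finally show ?thesis .
qed

lemma form_smult:
  fixes M :: "real mat"
  assumes "M \<in> carrier_mat nr nc" "v \<in> carrier_vec nr" "w \<in> carrier_vec nc"
  shows "v \<bullet> ((a \<cdot>\<^sub>m M) *\<^sub>v w) = a * (v \<bullet> (M *\<^sub>v w))"
  using assms by (simp add: form_sum[of _ nr nc] sum_distrib_left mult_ac)

lemma form_weighted_msum:
  assumes M: "\<And>k. k \<in> I \<Longrightarrow> M k \<in> carrier_mat nr nc"
    and v: "v \<in> carrier_vec nr" and w: "w \<in> carrier_vec nc"
  shows "v \<bullet> (msum nr nc (\<lambda>k. a k \<cdot>\<^sub>m M k) I *\<^sub>v w) = (\<Sum>k\<in>I. a k * (v \<bullet> (M k *\<^sub>v w)))"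
proof -
  have "v \<bullet> (msum nr nc (\<lambda>k. a k \<cdot>\<^sub>m M k) I *\<^sub>v w) = (\<Sum>k\<in>I. v \<bullet> ((a k \<cdot>\<^sub>m M k) *\<^sub>v w))"
    by (rule form_msum) (use M v w in auto)
  then show ?thesis by (simp add: form_smult[OF M v w])
qed

lemma weighted_sum_pos:
  fixes a f :: "nat \<Rightarrow> real"
  assumes "(\<Sum>k<L. a k) = 1" "\<And>k. k < L \<Longrightarrow> 0 \<le> a k" "\<And>k. k < L \<Longrightarrow> 0 < f k"
  shows "0 < (\<Sum>k<L. a k * f k)"
proof -
  obtain k where k: "k < L" "a k \<noteq> 0" using assms(1) by (metis lessThan_iff sum.neutral zero_neq_one)
  show ?thesis
    by (rule sum_pos2[of _ k]) (use assms(2,3) k in \<open>auto simp: less_le mult_nonneg_nonneg\<close>)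
qed

lemma paramsD:
  assumes "\<alpha> \<in> params S"
  shows "(\<Sum>k<verts S. \<alpha> $ k) = 1" "k < verts S \<Longrightarrow> 0 \<le> \<alpha> $ k"
  using assms by (auto simp: params_def)

lemma convex_combination_pos_def:
  assumes "\<alpha> \<in> params S"
    and M': "\<forall>k<verts S. M k \<in> carrier_mat n n \<and> pos_def (M k)"
  shows "pos_def (msum n n (\<lambda>k. \<alpha> $ k \<cdot>\<^sub>m M k) {..<verts S})" (is "pos_def ?M")
proof -
  have c: "?M \<in> carrier_mat n n" by simp
  have M: "M k \<in> carrier_mat n n" "pos_def (M k)" if "k < verts S" for k using M' that by auto
  have d: "dim_row (M k) = n" "dim_col (M k) = n" if "k < verts S" for k using M[OF that] by auto
  have "M k $$ (r, q) = M k $$ (q, r)" if "k < verts S" "r < n" "q < n" for k r q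
  proof -
    have "(M k)\<^sup>T $$ (r, q) = M k $$ (q, r)"
      using d[OF that(1)] that by (intro index_transpose_mat(1)) auto
    moreover have "(M k)\<^sup>T = M k" using M(2)[OF that(1)] unfolding pos_def_def by (rule conjunct1)
    ultimately show ?thesis by simp
  qed
  then have "?M\<^sup>T = ?M"
    by (intro eq_matI) (auto simp: msum_def d intro!: sum.cong)
  moreover have "0 < quad ?M v" if v: "v \<in> carrier_vec n" "v \<noteq> 0\<^sub>v n" for v
  proof -
    have "quad ?M v = (\<Sum>k<verts S. \<alpha> $ k * quad (M k) v)"
      unfolding quad_def by (rule form_weighted_msum) (use M v in auto)
    also have "\<dots> > 0"
      using paramsD[OF assms(1)] M pos_def_pos v by (intro weighted_sum_pos) blast+
    finally show ?thesis .
  qed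
  ultimately show ?thesis using c by (auto simp: pos_def_def)
qed

lemma inv_of_mean_props:
  assumes "\<alpha> \<in> params S"
    and "\<forall>k<verts S. Y i k \<in> carrier_mat (xdim S i) (xdim S i) \<and> pos_def (Y i k)"
  shows "inv_of_mean S Y i \<alpha> \<in> carrier_mat (xdim S i) (xdim S i)"
    and "pos_def (inv_of_mean S Y i \<alpha>)"
    and "x \<in> carrier_vec (xdim S i) \<Longrightarrow>
      msum (xdim S i) (xdim S i) (\<lambda>k. \<alpha> $ k \<cdot>\<^sub>m Y i k) {..<verts S} *\<^sub>v (inv_of_mean S Y i \<alpha> *\<^sub>v x) = x"
proof -
  note p = convex_combination_pos_def[OF assms]
  show "inv_of_mean S Y i \<alpha> \<in> carrier_mat (xdim S i) (xdim S i)"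
    "pos_def (inv_of_mean S Y i \<alpha>)"
    unfolding inv_of_mean_def
    by (rule pos_def_minv(1)[OF p msum_carrier]) (rule pos_def_minv_pos_def[OF p msum_carrier])
  show "msum (xdim S i) (xdim S i) (\<lambda>k. \<alpha> $ k \<cdot>\<^sub>m Y i k) {..<verts S} *\<^sub>v (inv_of_mean S Y i \<alpha> *\<^sub>v x) = x"
    if "x \<in> carrier_vec (xdim S i)"
    unfolding inv_of_mean_def by (rule pos_def_mult_minv_vec(1)[OF p msum_carrier that])
qed

text \<open>With \<open>P\<close> the inverse of the mean and \<open>y = P x\<close>, the number \<open>x \<bullet> P x\<close> is the mean of
  \<open>2 (y \<bullet> x) - y \<bullet> Y\<^sub>k y\<close>, and completing the square bounds each of these by \<open>x \<bullet> Y\<^sub>k\<inverse> x\<close>. The second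
  bound removes the parameter.\<close>
lemma quad_inv_of_mean_le:
  assumes a: "\<alpha> \<in> params S"
    and Y': "\<forall>k<verts S. Y i k \<in> carrier_mat (xdim S i) (xdim S i) \<and> pos_def (Y i k)"
    and x: "x \<in> carrier_vec (xdim S i)"
  shows "quad (inv_of_mean S Y i \<alpha>) x \<le> quad (mean_of_inv S Y i \<alpha>) x"
    and "quad (mean_of_inv S Y i \<alpha>) x \<le> (\<Sum>k<verts S. quad (minv (Y i k)) x)"
proof -
  define n where "n = xdim S i"
  define P where "P = inv_of_mean S Y i \<alpha>"
  define y where "y = P *\<^sub>v x"
  note x = x[folded n_def]
  have Y: "Y i k \<in> carrier_mat n n" "pos_def (Y i k)" if "k < verts S" for k
    using Y' that by (auto simp: n_def)
  note P = inv_of_mean_props[where Y = Y and i = i, OF a Y', folded n_def P_def]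
  have y: "y \<in> carrier_vec n" using P(1) x by (simp add: y_def)
  have M: "msum n n (\<lambda>k. \<alpha> $ k \<cdot>\<^sub>m Y i k) {..<verts S} *\<^sub>v y = x"
    using P(3)[OF x] by (simp add: y_def)
  have inv: "minv (Y i k) \<in> carrier_mat n n" "pos_def (minv (Y i k))" if "k < verts S" for k
    by (rule pos_def_minv(1)[OF Y(2)[OF that] Y(1)[OF that]])
      (rule pos_def_minv_pos_def[OF Y(2)[OF that] Y(1)[OF that]])
  have yx: "y \<bullet> x = (\<Sum>k<verts S. \<alpha> $ k * quad (Y i k) y)"
    unfolding quad_def by (subst M[symmetric], rule form_weighted_msum) (use Y y in auto)
  have xy: "quad P x = y \<bullet> x"
    unfolding quad_def y_def[symmetric] by (rule comm_scalar_prod[OF x y])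
  have le: "2 * (y \<bullet> x) - quad (Y i k) y \<le> quad (minv (Y i k)) x" if k: "k < verts S" for k
  proof -
    note Yk = Y[OF k]
    define v where "v = minv (Y i k) *\<^sub>v x"
    have v: "v \<in> carrier_vec n" using inv(1)[OF k] x by (simp add: v_def)
    have Yv: "Y i k *\<^sub>v v = x" unfolding v_def by (rule pos_def_mult_minv_vec(1)[OF Yk(2,1) x])
    have "0 \<le> quad (Y i k) (y - v)"
      by (rule pos_def_nonneg[OF Yk(2,1)]) (use y v in simp)
    also have "\<dots> = quad (Y i k) y - 2 * (y \<bullet> x) + quad (Y i k) v"
      using quad_diff[of "Y i k" n y v] Yk y v Yv by (simp add: pos_def_def)
    also have "quad (Y i k) v = quad (minv (Y i k)) x"
      unfolding quad_def Yv v_def[symmetric] by (rule comm_scalar_prod[OF v x])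
    finally show ?thesis by simp
  qed
  have mean: "quad (mean_of_inv S Y i \<alpha>) x = (\<Sum>k<verts S. \<alpha> $ k * quad (minv (Y i k)) x)"
    unfolding quad_def mean_of_inv_def n_def[symmetric]
    by (rule form_weighted_msum) (use inv x in auto)
  have "quad P x = (\<Sum>k<verts S. \<alpha> $ k * (2 * (y \<bullet> x) - quad (Y i k) y))"
    using paramsD(1)[OF a] xy yx
    by (simp add: right_diff_distrib sum_subtractf flip: sum_distrib_right)
  also have "\<dots> \<le> (\<Sum>k<verts S. \<alpha> $ k * quad (minv (Y i k)) x)"
    using le paramsD(2)[OF a] by (intro sum_mono mult_left_mono) auto
  finally show "quad (inv_of_mean S Y i \<alpha>) x \<le> quad (mean_of_inv S Y i \<alpha>) x"
    by (simp add: mean P_def)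
  have "\<alpha> $ k \<le> 1" if "k < verts S" for k
    using member_le_sum[of k "{..<verts S}" "\<lambda>k. \<alpha> $ k"] paramsD[OF a] that by auto
  then show "quad (mean_of_inv S Y i \<alpha>) x \<le> (\<Sum>k<verts S. quad (minv (Y i k)) x)"
    unfolding mean
    using inv pos_def_nonneg x paramsD(2)[OF a]
    by (intro sum_mono) (metis lessThan_iff mult_left_le_one_le)
qed

lemma scalar_prod_finsum_vec:
  fixes f :: "'j \<Rightarrow> real vec"
  assumes "finite J" "\<And>j. j \<in> J \<Longrightarrow> f j \<in> carrier_vec n" "y \<in> carrier_vec n"
  shows "finsum_vec TYPE(real) n f J \<in> carrier_vec n"
    and "y \<bullet> finsum_vec TYPE(real) n f J = (\<Sum>j\<in>J. y \<bullet> f j)"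
proof -
  show c: "finsum_vec TYPE(real) n f J \<in> carrier_vec n"
    by (rule finsum_vec_closed) (use assms in auto)
  have "y \<bullet> finsum_vec TYPE(real) n f J = (\<Sum>r<n. y $ r * (\<Sum>j\<in>J. f j $ r))"
    using c assms by (simp add: scalar_prod_sum index_finsum_vec Pi_def)
  also have "\<dots> = (\<Sum>j\<in>J. \<Sum>r<n. y $ r * f j $ r)"
    unfolding sum_distrib_left by (rule sum.swap)
  also have "\<dots> = (\<Sum>j\<in>J. y \<bullet> f j)"
    by (intro sum.cong refl) (simp add: scalar_prod_sum carrier_vecD[OF assms(2)])
  finally show "y \<bullet> finsum_vec TYPE(real) n f J = (\<Sum>j\<in>J. y \<bullet> f j)" .
qed

text \<open>The vertex inequalities are averaged at \<open>y = P x\<close>. Since the mean of the \<open>Y\<^sub>k\<close> maps \<open>y\<close> back to \<open>x\<close>,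
  the terms that contain it cancel, and the remaining terms are linear in the vertex data, so they
  turn into those of \<open>A(\<alpha>)\<close> and \<open>B(\<alpha>)\<close>. The margin is a multiple of \<open>y \<bullet> y\<close>, hence of \<open>x \<bullet> P x\<close>, the
  form of the mean at \<open>y\<close>.\<close>
lemma subsystem_dissipation:
  fixes V N :: "real mat"
  assumes S: "well_formed S" "i < subs S"
    and W: "pos_def (W_of S i)" and R: "neg_def (Rw S i - 1\<^sub>m (udim S i))"
    and Y': "\<forall>k<verts S. Y i k \<in> carrier_mat (xdim S i) (xdim S i) \<and> pos_def (Y i k)"
    and c: "V \<in> carrier_mat (xdim S i) (xdim S i)" "N \<in> carrier_mat (udim S i) (xdim S i)"
    and lmi: "\<forall>k<verts S. neg_def (lmi1 S i k (Y i k) V N)"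
    and a: "\<alpha> \<in> params S"
  shows "\<exists>c>0. \<forall>x\<in>carrier_vec (xdim S i). \<forall>p\<in>carrier_vec (udim S i). \<forall>w.
    (\<forall>j<subs S. j \<noteq> i \<longrightarrow> w j \<in> carrier_vec (gdim S i)) \<longrightarrow>
    (let P = inv_of_mean S Y i \<alpha>; u = N *\<^sub>v (minv V *\<^sub>v x); v = Lam S i *\<^sub>v u + p in
      2 * ((P *\<^sub>v x) \<bullet> (A_of S \<alpha> i *\<^sub>v x + B_of S \<alpha> i *\<^sub>v v
          + finsum_vec TYPE(real) (xdim S i) (\<lambda>j. Gc S i j *\<^sub>v w j) ({..<subs S} - {i})))
      - (\<Sum>j\<in>{..<subs S} - {i}. w j \<bullet> w j)
      + quad (Qw S i) x + quad (W_of S i) x + quad (Rw S i) v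
      + (Gam S i *\<^sub>v u) \<bullet> (Gam S i *\<^sub>v u) - p \<bullet> p \<le> - c * quad P x)"
proof -
  define n s L where "n = xdim S i" and "s = udim S i" and "L = verts S"
  let ?J = "{..<subs S} - {i}"
  define P where "P = inv_of_mean S Y i \<alpha>"
  define M where "M = msum n n (\<lambda>k. \<alpha> $ k \<cdot>\<^sub>m Y i k) {..<L}"
  have Y: "Y i k \<in> carrier_mat n n" "pos_def (Y i k)" if "k < L" for k
    using Y' that by (auto simp: n_def L_def)
  have P: "P \<in> carrier_mat n n" "pos_def P" "x \<in> carrier_vec n \<Longrightarrow> M *\<^sub>v (P *\<^sub>v x) = x" for x
    using inv_of_mean_props[where Y = Y and i = i, OF a Y'] unfolding P_def M_def n_def L_def by blast+
  note a1 = paramsD(1)[OF a, folded L_def] and a0 = paramsD(2)[OF a, folded L_def]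
  have AB: "Av S i k \<in> carrier_mat n n" "Bv S i k \<in> carrier_mat n s" if "k < L" for k
    using S that by (auto simp: well_formed_def n_def s_def L_def)
  have Lc: "Lam S i \<in> carrier_mat s s" using S by (auto simp: well_formed_def s_def)
  have Gc: "Gc S i j \<in> carrier_mat n (gdim S i)" if "j \<in> ?J" for j
    using S that by (auto simp: well_formed_def n_def)
  have Vi: "minv V \<in> carrier_mat n n"
  proof -
    have "0 < verts S" using S by (simp add: well_formed_def)
    then show ?thesis
      using minv_inverse(1)[OF c(1)] lmi1_V_injective[OF S _ W R _ c] Y' lmi by (auto simp: n_def)
  qed
  define e where "e k x y p w = (let z = minv V *\<^sub>v x; u = N *\<^sub>v z; v = Lam S i *\<^sub>v u + p in
      2 * (z \<bullet> (Y i k *\<^sub>v y) - z \<bullet> x) + 2 * (y \<bullet> x - y \<bullet> (Y i k *\<^sub>v y))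
      + 2 * (y \<bullet> (Av S i k *\<^sub>v x) + y \<bullet> (Bv S i k *\<^sub>v v) + (\<Sum>j\<in>?J. y \<bullet> (Gc S i j *\<^sub>v w j)))
      - (\<Sum>j\<in>?J. w j \<bullet> w j)
      + quad (Qw S i) x + quad (W_of S i) x + quad (Rw S i) v
      + (Gam S i *\<^sub>v u) \<bullet> (Gam S i *\<^sub>v u) - p \<bullet> p)" for k x y p w
  have "\<exists>m. m > 0 \<and> (\<forall>x\<in>carrier_vec n. \<forall>y\<in>carrier_vec n. \<forall>p\<in>carrier_vec s. \<forall>w.
    (\<forall>j<subs S. j \<noteq> i \<longrightarrow> w j \<in> carrier_vec (gdim S i)) \<longrightarrow> e k x y p w \<le> - m * (y \<bullet> y))"
    if k: "k < verts S" for k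
    unfolding n_def s_def e_def Let_def
    by (rule vertex_dissipation[OF S k W R _ c, unfolded Let_def]) (use Y' lmi k in auto)
  then have "\<forall>k\<in>{..<L}. \<exists>m. m > 0 \<and> (\<forall>x\<in>carrier_vec n. \<forall>y\<in>carrier_vec n. \<forall>p\<in>carrier_vec s. \<forall>w.
    (\<forall>j<subs S. j \<noteq> i \<longrightarrow> w j \<in> carrier_vec (gdim S i)) \<longrightarrow> e k x y p w \<le> - m * (y \<bullet> y))"
    unfolding L_def by simp
  from bchoice[OF this] obtain m where m': "\<forall>k\<in>{..<L}. m k > 0 \<and>
    (\<forall>x\<in>carrier_vec n. \<forall>y\<in>carrier_vec n. \<forall>p\<in>carrier_vec s. \<forall>w.
    (\<forall>j<subs S. j \<noteq> i \<longrightarrow> w j \<in> carrier_vec (gdim S i)) \<longrightarrow> e k x y p w \<le> - m k * (y \<bullet> y))" ..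
  then have m: "m k > 0" if "k < L" for k using that by simp
  define \<mu> where "\<mu> = (\<Sum>k<L. \<alpha> $ k * m k)"
  have \<mu>: "\<mu> > 0" unfolding \<mu>_def by (rule weighted_sum_pos) (use a1 a0 m in auto)
  have Mc: "M \<in> carrier_mat n n" by (simp add: M_def)
  obtain C where C: "C > 0" "\<And>v. v \<in> carrier_vec n \<Longrightarrow> quad M v \<le> C * (v \<bullet> v)"
    using quad_upper_bound[OF Mc] by blast
  show ?thesis
    unfolding Let_def P_def[symmetric] n_def[symmetric] s_def[symmetric]
  proof (intro exI[of _ "\<mu> / C"] conjI ballI allI impI)
    show "0 < \<mu> / C" using \<mu> C(1) by simp
  next
    fix x p :: "real vec" and w :: "nat \<Rightarrow> real vec"
    assume x: "x \<in> carrier_vec n" and p: "p \<in> carrier_vec s"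
      and w: "\<forall>j<subs S. j \<noteq> i \<longrightarrow> w j \<in> carrier_vec (gdim S i)"
    define z where "z = minv V *\<^sub>v x"
    define u where "u = N *\<^sub>v z"
    define v where "v = Lam S i *\<^sub>v u + p"
    define y where "y = P *\<^sub>v x"
    have z: "z \<in> carrier_vec n" using Vi x by (simp add: z_def)
    have y: "y \<in> carrier_vec n" using P(1) x by (simp add: y_def)
    have My: "M *\<^sub>v y = x" using P(3)[OF x] by (simp add: y_def)
    have "u \<in> carrier_vec s" using c z by (simp add: u_def n_def s_def)
    then have v: "v \<in> carrier_vec s" using Lc p by (simp add: v_def)
    have lin: "z \<bullet> x = (\<Sum>k<L. \<alpha> $ k * (z \<bullet> (Y i k *\<^sub>v y)))"
      "y \<bullet> x = (\<Sum>k<L. \<alpha> $ k * (y \<bullet> (Y i k *\<^sub>v y)))"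
      by (subst My[symmetric], unfold M_def, rule form_weighted_msum; use Y z y in auto)+
    have linA: "y \<bullet> (A_of S \<alpha> i *\<^sub>v x) = (\<Sum>k<L. \<alpha> $ k * (y \<bullet> (Av S i k *\<^sub>v x)))"
      unfolding A_of_def n_def[symmetric] L_def[symmetric]
      by (rule form_weighted_msum) (use AB x y in auto)
    have linB: "y \<bullet> (B_of S \<alpha> i *\<^sub>v v) = (\<Sum>k<L. \<alpha> $ k * (y \<bullet> (Bv S i k *\<^sub>v v)))"
      unfolding B_of_def n_def[symmetric] s_def[symmetric] L_def[symmetric]
      by (rule form_weighted_msum) (use AB v y in auto)
    define F where "F = finsum_vec TYPE(real) n (\<lambda>j. Gc S i j *\<^sub>v w j) ?J"
    have Fj: "Gc S i j *\<^sub>v w j \<in> carrier_vec n" if "j \<in> ?J" for j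
      using Gc[OF that] w that by auto
    have F: "F \<in> carrier_vec n" "y \<bullet> F = (\<Sum>j\<in>?J. y \<bullet> (Gc S i j *\<^sub>v w j))"
      unfolding F_def by (rule scalar_prod_finsum_vec[OF _ Fj y]; simp)+
    have ABc: "A_of S \<alpha> i \<in> carrier_mat n n" "B_of S \<alpha> i \<in> carrier_mat n s"
      by (simp_all add: A_of_def B_of_def n_def s_def)
    have field: "y \<bullet> (A_of S \<alpha> i *\<^sub>v x + B_of S \<alpha> i *\<^sub>v v + F) =
        y \<bullet> (A_of S \<alpha> i *\<^sub>v x) + y \<bullet> (B_of S \<alpha> i *\<^sub>v v) + y \<bullet> F"
      using ABc x y v F(1) by (simp add: scalar_prod_add_distrib[of _ n])
    define r where "r = 2 * (y \<bullet> F) - (\<Sum>j\<in>?J. w j \<bullet> w j)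
      + quad (Qw S i) x + quad (W_of S i) x + quad (Rw S i) v
      + (Gam S i *\<^sub>v u) \<bullet> (Gam S i *\<^sub>v u) - p \<bullet> p"
    have e: "e k x y p w = 2 * (z \<bullet> (Y i k *\<^sub>v y)) - 2 * (z \<bullet> x) + 2 * (y \<bullet> x)
        - 2 * (y \<bullet> (Y i k *\<^sub>v y)) + 2 * (y \<bullet> (Av S i k *\<^sub>v x)) + 2 * (y \<bullet> (Bv S i k *\<^sub>v v)) + r" for k
      unfolding e_def Let_def z_def[symmetric] u_def[symmetric] v_def[symmetric] r_def F(2) by simp
    have "2 * (y \<bullet> (A_of S \<alpha> i *\<^sub>v x)) + 2 * (y \<bullet> (B_of S \<alpha> i *\<^sub>v v)) + r = (\<Sum>k<L. \<alpha> $ k * e k x y p w)"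
    proof -
      have "(\<Sum>k<L. \<alpha> $ k * e k x y p w) =
          2 * (\<Sum>k<L. \<alpha> $ k * (z \<bullet> (Y i k *\<^sub>v y))) - (\<Sum>k<L. \<alpha> $ k) * (2 * (z \<bullet> x))
          + (\<Sum>k<L. \<alpha> $ k) * (2 * (y \<bullet> x)) - 2 * (\<Sum>k<L. \<alpha> $ k * (y \<bullet> (Y i k *\<^sub>v y)))
          + 2 * (\<Sum>k<L. \<alpha> $ k * (y \<bullet> (Av S i k *\<^sub>v x)))
          + 2 * (\<Sum>k<L. \<alpha> $ k * (y \<bullet> (Bv S i k *\<^sub>v v))) + (\<Sum>k<L. \<alpha> $ k) * r"
        unfolding e
        by (simp add: distrib_left right_diff_distrib sum.distrib sum_subtractf sum_distrib_left
            sum_distrib_right mult_ac)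
      then show ?thesis unfolding a1 linA linB using lin by simp
    qed
    also have "\<dots> \<le> (\<Sum>k<L. \<alpha> $ k * (- m k * (y \<bullet> y)))"
      by (intro sum_mono mult_left_mono) (use m' x y p w a0 in auto)
    also have "\<dots> = - \<mu> * (y \<bullet> y)"
      by (simp add: \<mu>_def sum_distrib_left sum_negf mult_ac)
    also have "\<dots> \<le> - (\<mu> / C) * quad P x"
    proof -
      have "quad P x = y \<bullet> x"
        unfolding quad_def y_def[symmetric] by (rule comm_scalar_prod[OF x y])
      also have "\<dots> = quad M y" by (simp add: quad_def My)
      finally have "quad P x \<le> C * (y \<bullet> y)" using C(2)[OF y] by simp
      then have "\<mu> / C * quad P x \<le> \<mu> / C * (C * (y \<bullet> y))"
        using \<mu> C(1) by (intro mult_left_mono) auto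
      then show ?thesis using C(1) by simp
    qed
    finally have "2 * (y \<bullet> (A_of S \<alpha> i *\<^sub>v x + B_of S \<alpha> i *\<^sub>v v + F)) - (\<Sum>j\<in>?J. w j \<bullet> w j)
      + quad (Qw S i) x + quad (W_of S i) x + quad (Rw S i) v
      + (Gam S i *\<^sub>v u) \<bullet> (Gam S i *\<^sub>v u) - p \<bullet> p \<le> - (\<mu> / C) * quad P x"
      unfolding field r_def by simp
    then show "2 * ((P *\<^sub>v x) \<bullet> (A_of S \<alpha> i *\<^sub>v x
          + B_of S \<alpha> i *\<^sub>v (Lam S i *\<^sub>v (N *\<^sub>v (minv V *\<^sub>v x)) + p)
          + finsum_vec TYPE(real) n (\<lambda>j. Gc S i j *\<^sub>v w j) ?J))
      - (\<Sum>j\<in>?J. w j \<bullet> w j)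
      + quad (Qw S i) x + quad (W_of S i) x
      + quad (Rw S i) (Lam S i *\<^sub>v (N *\<^sub>v (minv V *\<^sub>v x)) + p)
      + (Gam S i *\<^sub>v (N *\<^sub>v (minv V *\<^sub>v x))) \<bullet> (Gam S i *\<^sub>v (N *\<^sub>v (minv V *\<^sub>v x))) - p \<bullet> p
      \<le> - (\<mu> / C) * quad P x"
      by (simp only: z_def u_def v_def y_def F_def)
  qed
qed

section \<open>Differential inequalities with exceptional times\<close>

text \<open>The mean value theorem is not available across the exceptional times, but the fundamental theorem of
  calculus for continuous functions tolerates finitely many of them.\<close>
lemma nonincreasing_off_finite:
  fixes f :: "real \<Rightarrow> real"
  assumes "finite X" "a \<le> b" "continuous_on {a..b} f"
    and "\<And>t. t \<in> {a<..<b} - X \<Longrightarrow> \<exists>D\<le>0. (f has_real_derivative D) (at t)"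
  shows "f b \<le> f a"
proof -
  obtain D where D: "\<And>t. t \<in> {a<..<b} - X \<Longrightarrow> D t \<le> 0 \<and> (f has_real_derivative D t) (at t)"
    using assms(4) by metis
  define d where "d t = (if t \<in> {a<..<b} - X then - D t else 0)" for t
  have "(d has_integral (- f b - - f a)) {a..b}"
  proof (rule fundamental_theorem_of_calculus_interior_strong[OF assms(1,2)])
    show "((\<lambda>t. - f t) has_vector_derivative d t) (at t)" if t: "t \<in> {a<..<b} - X" for t
    proof -
      have "((\<lambda>t. - f t) has_real_derivative - D t) (at t)"
        using D[OF t] by (intro DERIV_minus) simp
      then show ?thesis using t by (simp add: d_def has_real_derivative_iff_has_vector_derivative)
    qed
  qed (intro continuous_intros assms(3))
  moreover have "0 \<le> d t" for t using D by (simp add: d_def)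
  ultimately have "0 \<le> - f b - - f a" by (rule has_integral_nonneg)
  then show ?thesis by simp
qed

lemma exponential_decay:
  fixes v :: "real \<Rightarrow> real"
  assumes "finite X" "0 \<le> b" "continuous_on {0..b} v"
    and deriv: "\<And>t. t \<in> {0<..<b} - X \<Longrightarrow> \<exists>D. (v has_real_derivative D) (at t) \<and> D \<le> - c * v t"
  shows "v b \<le> v 0 * exp (- c * b)"
proof -
  have "v b * exp (c * b) \<le> v 0 * exp (c * 0)"
  proof (rule nonincreasing_off_finite[OF assms(1,2)])
    show "continuous_on {0..b} (\<lambda>t. v t * exp (c * t))" by (intro continuous_intros assms(3))
  next
    fix t assume "t \<in> {0<..<b} - X"
    from deriv[OF this] obtain D where D: "(v has_real_derivative D) (at t)" "D \<le> - c * v t" by blast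
    have "((\<lambda>t. v t * exp (c * t)) has_real_derivative (D + c * v t) * exp (c * t)) (at t)"
      by (rule derivative_eq_intros D(1) refl)+ (simp add: algebra_simps)
    moreover have "(D + c * v t) * exp (c * t) \<le> 0"
      using D(2) by (intro mult_nonpos_nonneg) auto
    ultimately show "\<exists>D\<le>0. ((\<lambda>t. v t * exp (c * t)) has_real_derivative D) (at t)" by blast
  qed
  then have "v b * exp (c * b) * exp (- c * b) \<le> v 0 * exp (- c * b)"
    by (intro mult_right_mono) auto
  then show ?thesis by (simp add: mult.assoc flip: exp_add)
qed

text \<open>Monotone convergence needs measurability, so it is applied to each simple function below \<open>f\<close>
  instead of \<open>f\<close> itself; the integral of \<open>f\<close> is the supremum over these.\<close>
lemma nn_integral_atLeast_le:
  fixes f :: "real \<Rightarrow> ennreal"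
  assumes "\<And>n. (\<integral>\<^sup>+t\<in>{0..real (Suc n)}. f t \<partial>lborel) \<le> C"
  shows "(\<integral>\<^sup>+t\<in>{0..}. f t \<partial>lborel) \<le> C"
  unfolding nn_integral_def[of lborel "\<lambda>t. f t * indicator {0..} t"]
proof (rule SUP_least, clarify)
  fix g :: "real \<Rightarrow> ennreal"
  assume g: "simple_function lborel g" "g \<le> (\<lambda>t. f t * indicator {0..} t)"
  have gm: "g \<in> borel_measurable lborel" using g(1) by (rule borel_measurable_simple_function)
  define h where "h n t = g t * indicator {0..real (Suc n)} t" for n t
  have hm: "h n \<in> borel_measurable lborel" for n
    unfolding h_def using gm by measurable
  have inc: "incseq h"
    by (auto simp: incseq_def le_fun_def h_def indicator_def)
  have sup: "g t = (SUP n. h n t)" for t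
  proof (rule antisym)
    obtain n where "t \<le> real n" using real_arch_simple by blast
    then have "g t \<le> h n t"
      using g(2)[THEN le_funD, of t] by (cases "0 \<le> t") (auto simp: h_def)
    then show "g t \<le> (SUP n. h n t)" by (rule SUP_upper2[OF UNIV_I])
    show "(SUP n. h n t) \<le> g t" by (rule SUP_least) (simp add: h_def indicator_def)
  qed
  have "integral\<^sup>S lborel g = (\<integral>\<^sup>+t. g t \<partial>lborel)"
    by (rule nn_integral_eq_simple_integral[OF g(1), symmetric])
  also have "\<dots> = (\<integral>\<^sup>+t. (SUP n. h n t) \<partial>lborel)" by (simp flip: sup)
  also have "\<dots> = (SUP n. \<integral>\<^sup>+t. h n t \<partial>lborel)"
    by (rule nn_integral_monotone_convergence_SUP[OF inc hm])
  also have "\<dots> \<le> C"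
  proof (rule SUP_least)
    fix n
    have "h n t \<le> f t * indicator {0..real (Suc n)} t" for t
      using g(2)[THEN le_funD, of t] by (auto simp: h_def indicator_def)
    then have "(\<integral>\<^sup>+t. h n t \<partial>lborel) \<le> (\<integral>\<^sup>+t\<in>{0..real (Suc n)}. f t \<partial>lborel)"
      by (intro nn_integral_mono) auto
    also have "\<dots> \<le> C" by (rule assms)
    finally show "(\<integral>\<^sup>+t. h n t \<partial>lborel) \<le> C" .
  qed
  finally show "integral\<^sup>S lborel g \<le> C" .
qed

text \<open>The function \<open>h t = v t + c * integral {0..t} v\<close> decreases at least at the rate \<open>s\<close>, so the integral
  of \<open>s\<close> over \<open>[0, b]\<close> is at most \<open>h 0 - h b\<close>. For \<open>b \<ge> 1\<close> this is at most \<open>v 0\<close> less the part of the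
  integral of \<open>v\<close> up to time \<open>1\<close>; this fixed loss is what makes the cost bound strict.\<close>
lemma nn_integral_dissipated_le:
  fixes v s :: "real \<Rightarrow> real"
  assumes c: "0 \<le> c" and s: "\<And>t. 0 \<le> t \<Longrightarrow> 0 \<le> s t" and v: "\<And>t. 0 \<le> t \<Longrightarrow> 0 \<le> v t"
    and cont: "continuous_on {0..} v"
    and fin: "\<And>b. finite {t \<in> X. t \<le> b}"
    and deriv: "\<And>t. 0 < t \<Longrightarrow> t \<notin> X \<Longrightarrow>
      \<exists>D. (v has_real_derivative D) (at t) \<and> D + s t \<le> - c * v t"
  shows "(\<integral>\<^sup>+t\<in>{0..}. ennreal (s t) \<partial>lborel) \<le> ennreal (v 0 - c * integral {0..1} v)"
proof (rule nn_integral_atLeast_le)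
  fix n
  define b where "b = real (Suc n)"
  have b: "1 \<le> b" by (simp add: b_def)
  \<comment> \<open>With the end points among the exceptions, the remaining times are interior.\<close>
  define Z where "Z = {0, b} \<union> {t \<in> X. t \<le> b}"
  have Z: "finite Z" using fin by (simp add: Z_def)
  have "\<exists>D. (v has_real_derivative D) (at t) \<and> D + s t \<le> - c * v t" if t: "t \<in> {0<..<b} - Z" for t
    by (rule deriv) (use t in \<open>auto simp: Z_def\<close>)
  then have "\<forall>t\<in>{0<..<b} - Z. \<exists>D. (v has_real_derivative D) (at t) \<and> D + s t \<le> - c * v t" by simp
  from bchoice[OF this] obtain D where
    "\<forall>t\<in>{0<..<b} - Z. (v has_real_derivative D t) (at t) \<and> D t + s t \<le> - c * v t" ..
  then have D: "(v has_real_derivative D t) (at t) \<and> D t + s t \<le> - c * v t" if "t \<in> {0<..<b} - Z" for t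
    using that by (rule bspec)
  define h where "h t = v t + c * integral {0..t} v" for t
  define d where "d t = (if t \<in> {0<..<b} - Z then - (D t + c * v t) else 0)" for t
  have cb: "continuous_on {0..b} v" by (rule continuous_on_subset[OF cont]) auto
  have I: "((\<lambda>t. integral {0..t} v) has_real_derivative v t) (at t within {0..b})" if "t \<in> {0..b}" for t
    by (rule integral_has_real_derivative[OF cb that])
  then have Ic: "continuous_on {0..b} (\<lambda>t. integral {0..t} v)"
    by (rule DERIV_continuous_on)
  have "(d has_integral (- h b - - h 0)) {0..b}"
  proof (rule fundamental_theorem_of_calculus_interior_strong[OF Z])
    show "((\<lambda>t. - h t) has_vector_derivative d t) (at t)" if t: "t \<in> {0<..<b} - Z" for t
    proof -
      have "((\<lambda>t. integral {0..t} v) has_real_derivative v t) (at t)"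
        using I[of t] t at_within_Icc_at[of 0 t b] by auto
      then have "((\<lambda>t. - h t) has_real_derivative d t) (at t)"
        unfolding h_def using D[OF t] t
        by (auto simp: d_def intro!: derivative_eq_intros)
      then show ?thesis by (simp add: has_real_derivative_iff_has_vector_derivative)
    qed
  qed (use b in \<open>auto simp: h_def intro!: continuous_intros cb Ic\<close>)
  moreover have d0: "0 \<le> d t" for t
    using D[of t] s[of t] by (cases "t \<in> {0<..<b} - Z") (auto simp: d_def)
  ultimately have dI: "(\<integral>\<^sup>+t. ennreal (d t) * indicator {0..b} t \<partial>lborel) = ennreal (- h b - - h 0)"
    by (intro nn_integral_has_integral_lebesgue')
  have "AE t in lborel. t \<notin> Z"
    using finite_imp_null_set_lborel[OF Z] by (rule AE_not_in)
  then have "AE t in lborel. ennreal (s t) * indicator {0..b} t \<le> ennreal (d t) * indicator {0..b} t"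
  proof eventually_elim
    case (elim t)
    show ?case
    proof (cases "t \<in> {0..b}")
      case True
      then have "t \<in> {0<..<b} - Z" using elim by (auto simp: Z_def)
      then have "s t \<le> d t" using D[of t] by (simp add: d_def)
      then show ?thesis using True by (simp add: ennreal_leI)
    qed simp
  qed
  then have "(\<integral>\<^sup>+t\<in>{0..b}. ennreal (s t) \<partial>lborel) \<le> ennreal (- h b - - h 0)"
    unfolding dI[symmetric] by (rule nn_integral_mono_AE)
  also have "\<dots> \<le> ennreal (v 0 - c * integral {0..1} v)"
  proof (rule ennreal_leI)
    have "integral {0..1} v \<le> integral {0..b} v"
      using b v by (intro integral_subset_le integrable_continuous_interval continuous_on_subset[OF cont]) auto
    then have "c * integral {0..1} v \<le> c * integral {0..b} v" using c by (rule mult_left_mono)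
    moreover have "0 \<le> v b" using b by (intro v) simp
    ultimately show "- h b - - h 0 \<le> v 0 - c * integral {0..1} v" by (simp add: h_def)
  qed
  finally show "(\<integral>\<^sup>+t\<in>{0..real (Suc n)}. ennreal (s t) \<partial>lborel) \<le> ennreal (v 0 - c * integral {0..1} v)"
    by (simp only: b_def)
qed

lemma integral_pos_of_initial_pos:
  fixes v :: "real \<Rightarrow> real"
  assumes cont: "continuous_on {0..1} v" and nonneg: "\<And>t. t \<in> {0..1} \<Longrightarrow> 0 \<le> v t" and "0 < v 0"
  shows "0 < integral {0..1} v"
proof -
  have int: "v integrable_on {0..1}" by (rule integrable_continuous_interval[OF cont])
  have "0 \<le> integral {0..1} v" by (rule integral_nonneg[OF int nonneg])
  moreover have "integral {0..1} v \<noteq> 0"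
  proof
    assume "integral {0..1} v = 0"
    then have "(v has_integral 0) (cbox 0 1)" using integrable_integral[OF int] by simp
    from has_integral_0_cbox_imp_0[OF _ _ this, of 0] cont nonneg assms(3) show False by auto
  qed
  ultimately show ?thesis by linarith
qed

lemma quad_has_derivative:
  assumes M: "M \<in> carrier_mat n n" "M\<^sup>T = M" and t: "t \<in> A"
    and x: "\<And>\<tau>. \<tau> \<in> A \<Longrightarrow> x \<tau> \<in> carrier_vec n" and d: "d \<in> carrier_vec n"
    and deriv: "\<And>r. r < n \<Longrightarrow> ((\<lambda>\<tau>. x \<tau> $ r) has_real_derivative d $ r) (at t within A)"
  shows "((\<lambda>\<tau>. quad M (x \<tau>)) has_real_derivative 2 * ((M *\<^sub>v x t) \<bullet> d)) (at t within A)"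
proof -
  have "((\<lambda>\<tau>. \<Sum>r<n. \<Sum>c<n. x \<tau> $ r * M $$ (r, c) * x \<tau> $ c) has_real_derivative
      (\<Sum>r<n. \<Sum>c<n. d $ r * M $$ (r, c) * x t $ c + x t $ r * M $$ (r, c) * d $ c)) (at t within A)"
    by (intro DERIV_sum) (auto intro!: derivative_eq_intros deriv simp: algebra_simps)
  also have "(\<Sum>r<n. \<Sum>c<n. d $ r * M $$ (r, c) * x t $ c + x t $ r * M $$ (r, c) * d $ c) =
      d \<bullet> (M *\<^sub>v x t) + x t \<bullet> (M *\<^sub>v d)"
    unfolding form_sum[OF M(1) d x[OF t]] form_sum[OF M(1) x[OF t] d] by (simp add: sum.distrib)
  also have "x t \<bullet> (M *\<^sub>v d) = d \<bullet> (M *\<^sub>v x t)" by (rule sym_form_commute[OF M x[OF t] d])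
  also have "d \<bullet> (M *\<^sub>v x t) = (M *\<^sub>v x t) \<bullet> d"
    by (rule comm_scalar_prod[OF d]) (use M x t in simp)
  finally have *: "((\<lambda>\<tau>. \<Sum>r<n. \<Sum>c<n. x \<tau> $ r * M $$ (r, c) * x \<tau> $ c) has_real_derivative
      2 * ((M *\<^sub>v x t) \<bullet> d)) (at t within A)" by simp
  show ?thesis
    using * by (rule has_field_derivative_transform_within[where d = 1])
      (simp_all add: t quad_sum[OF M(1) x])
qed

lemma quad_continuous_on:
  assumes M: "M \<in> carrier_mat n n" and x: "\<And>\<tau>. \<tau> \<in> A \<Longrightarrow> x \<tau> \<in> carrier_vec n"
    and cont: "\<And>r. r < n \<Longrightarrow> continuous_on A (\<lambda>\<tau>. x \<tau> $ r)"
  shows "continuous_on A (\<lambda>\<tau>. quad M (x \<tau>))"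
proof -
  have "continuous_on A (\<lambda>\<tau>. \<Sum>r<n. \<Sum>c<n. x \<tau> $ r * M $$ (r, c) * x \<tau> $ c)"
    by (intro continuous_intros cont) auto
  then show ?thesis by (rule continuous_on_eq) (simp add: quad_sum[OF M x])
qed

section \<open>Dissipation of the interconnected system\<close>

lemma actuator_carrier:
  "Lam S i \<in> carrier_mat (udim S i) (udim S i) \<Longrightarrow> actuator S K \<phi> \<xi> i \<in> carrier_vec (udim S i)"
  by (intro carrier_vecI) (simp add: actuator_def Let_def)

lemma vector_field_carrier:
  assumes S: "well_formed S" "i < subs S" and g: "admissible_coupling S g" and t: "0 \<le> t"
    and \<xi>: "\<forall>j<subs S. \<xi> j \<in> carrier_vec (xdim S j)"
  shows "vector_field S K \<alpha> g \<phi> t \<xi> i \<in> carrier_vec (xdim S i)"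
proof -
  have "Gc S i j *\<^sub>v g i j t (\<xi> j) \<in> carrier_vec (xdim S i)" if "j \<in> {..<subs S} - {i}" for j
  proof (rule mult_mat_vec_carrier)
    show "Gc S i j \<in> carrier_mat (xdim S i) (gdim S i)"
      using S that by (auto simp: well_formed_def)
    show "g i j t (\<xi> j) \<in> carrier_vec (gdim S i)"
      using S(2) g t \<xi> that by (auto simp: admissible_coupling_def)
  qed
  then have "finsum_vec TYPE(real) (xdim S i) (\<lambda>j. Gc S i j *\<^sub>v g i j t (\<xi> j)) ({..<subs S} - {i})
      \<in> carrier_vec (xdim S i)"
    by (intro finsum_vec_closed) auto
  moreover have "A_of S \<alpha> i \<in> carrier_mat (xdim S i) (xdim S i)"
    "B_of S \<alpha> i \<in> carrier_mat (xdim S i) (udim S i)" "\<xi> i \<in> carrier_vec (xdim S i)"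
    using \<xi> S(2) by (simp_all add: A_of_def B_of_def)
  moreover have "actuator S K \<phi> \<xi> i \<in> carrier_vec (udim S i)"
    using S by (intro actuator_carrier) (auto simp: well_formed_def)
  ultimately show ?thesis unfolding vector_field_def by (intro add_carrier_vec mult_mat_vec_carrier)
qed

lemma vnorm_le_iff: "vnorm v \<le> vnorm w \<longleftrightarrow> v \<bullet> v \<le> w \<bullet> w"
  by (simp add: vnorm_def)

lemma quad_W_of:
  assumes S: "well_formed S" "i < subs S" and x: "x \<in> carrier_vec (xdim S i)"
  shows "quad (W_of S i) x = (\<Sum>j\<in>{..<subs S} - {i}. (Wc S j i *\<^sub>v x) \<bullet> (Wc S j i *\<^sub>v x))"
proof -
  have W: "Wc S j i \<in> carrier_mat (dim_row (Wc S j i)) (xdim S i)" if "j \<in> {..<subs S} - {i}" for j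
    using S that by (intro carrier_matI) (auto simp: well_formed_def)
  have "quad (W_of S i) x = (\<Sum>j\<in>{..<subs S} - {i}. x \<bullet> (((Wc S j i)\<^sup>T * Wc S j i) *\<^sub>v x))"
    unfolding quad_def W_of_def
    by (rule form_msum[OF _ x x]) (rule mult_carrier_mat[OF transpose_carrier_mat[THEN iffD2, OF W] W])
  also have "\<dots> = (\<Sum>j\<in>{..<subs S} - {i}. (Wc S j i *\<^sub>v x) \<bullet> (Wc S j i *\<^sub>v x))"
  proof (intro sum.cong refl)
    fix j assume j: "j \<in> {..<subs S} - {i}"
    obtain m where m: "Wc S j i \<in> carrier_mat m (xdim S i)" using W[OF j] by blast
    have v: "Wc S j i *\<^sub>v x \<in> carrier_vec m" using m x by simp
    have eq: "((Wc S j i)\<^sup>T * Wc S j i) *\<^sub>v x = (Wc S j i)\<^sup>T *\<^sub>v (Wc S j i *\<^sub>v x)"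
      using m x by (simp add: assoc_mult_mat_vec[of _ "xdim S i" m _ "xdim S i"])
    have "x \<bullet> (((Wc S j i)\<^sup>T * Wc S j i) *\<^sub>v x) = ((Wc S j i)\<^sup>T *\<^sub>v (Wc S j i *\<^sub>v x)) \<bullet> x"
      unfolding eq by (rule comm_scalar_prod[OF x]) (use m v in simp)
    also have "\<dots> = (Wc S j i *\<^sub>v x) \<bullet> (Wc S j i *\<^sub>v x)"
      by (rule transpose_vec_mult_scalar[OF m x v])
    finally show "x \<bullet> (((Wc S j i)\<^sup>T * Wc S j i) *\<^sub>v x) = (Wc S j i *\<^sub>v x) \<bullet> (Wc S j i *\<^sub>v x)" .
  qed
  finally show ?thesis .
qed

lemma sum_off_diagonal_swap:
  fixes h :: "nat \<Rightarrow> nat \<Rightarrow> real"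
  shows "(\<Sum>i<n. \<Sum>j\<in>{..<n} - {i}. h i j) = (\<Sum>j<n. \<Sum>i\<in>{..<n} - {j}. h i j)"
proof -
  have 1: "(\<Sum>j\<in>{..<n} - {i}. h i j) = (\<Sum>j<n. if j = i then 0 else h i j)" for i
    by (rule sum.mono_neutral_cong_left) auto
  have 2: "(\<Sum>i\<in>{..<n} - {j}. h i j) = (\<Sum>i<n. if j = i then 0 else h i j)" for j
    by (rule sum.mono_neutral_cong_left) auto
  show ?thesis unfolding 1 2 by (rule sum.swap)
qed

text \<open>Exchanging the two sums collects, for each subsystem, what its state contributes to all the others;
  the matrix \<^const>\<open>W_of\<close> is the bound of exactly this contribution.\<close>
lemma coupling_bound:
  assumes S: "well_formed S" and g: "admissible_coupling S g" and t: "0 \<le> t"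
    and \<xi>: "\<forall>j<subs S. \<xi> j \<in> carrier_vec (xdim S j)"
  shows "(\<Sum>i<subs S. \<Sum>j\<in>{..<subs S} - {i}. g i j t (\<xi> j) \<bullet> g i j t (\<xi> j))
    \<le> (\<Sum>i<subs S. quad (W_of S i) (\<xi> i))"
proof -
  have "g i j t (\<xi> j) \<bullet> g i j t (\<xi> j) \<le> (Wc S i j *\<^sub>v \<xi> j) \<bullet> (Wc S i j *\<^sub>v \<xi> j)"
    if "i < subs S" "j \<in> {..<subs S} - {i}" for i j
    using g t \<xi> that unfolding vnorm_le_iff[symmetric] by (auto simp: admissible_coupling_def)
  then have "(\<Sum>i<subs S. \<Sum>j\<in>{..<subs S} - {i}. g i j t (\<xi> j) \<bullet> g i j t (\<xi> j))
      \<le> (\<Sum>i<subs S. \<Sum>j\<in>{..<subs S} - {i}. (Wc S i j *\<^sub>v \<xi> j) \<bullet> (Wc S i j *\<^sub>v \<xi> j))"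
    by (intro sum_mono) auto
  also have "\<dots> = (\<Sum>j<subs S. \<Sum>i\<in>{..<subs S} - {j}. (Wc S i j *\<^sub>v \<xi> j) \<bullet> (Wc S i j *\<^sub>v \<xi> j))"
    by (rule sum_off_diagonal_swap)
  also have "\<dots> = (\<Sum>j<subs S. quad (W_of S j) (\<xi> j))"
    using \<xi> by (intro sum.cong refl) (simp add: quad_W_of[OF S])
  finally show ?thesis .
qed

lemma fault_bound:
  assumes S: "well_formed S" "i < subs S" and \<phi>: "admissible_fault S \<phi>"
    and u: "u \<in> carrier_vec (udim S i)"
  shows "vec (udim S i) (\<lambda>j. \<phi> i j (u $ j)) \<bullet> vec (udim S i) (\<lambda>j. \<phi> i j (u $ j))
    \<le> (Gam S i *\<^sub>v u) \<bullet> (Gam S i *\<^sub>v u)"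
proof -
  let ?G = "Gam S i" and ?s = "udim S i"
  have G: "?G \<in> carrier_mat ?s ?s" "diagonal_mat ?G" using S by (auto simp: well_formed_def)
  have Gu: "(?G *\<^sub>v u) $ j = ?G $$ (j, j) * u $ j" if j: "j < ?s" for j
  proof -
    have "(?G *\<^sub>v u) $ j = (\<Sum>c<?s. ?G $$ (j, c) * u $ c)"
      using G u j by (simp add: scalar_prod_sum)
    also have "\<dots> = (\<Sum>c<?s. if c = j then ?G $$ (j, j) * u $ j else 0)"
      using G j by (intro sum.cong) (auto simp: diagonal_mat_def)
    finally show ?thesis using j by simp
  qed
  have "(\<Sum>j<?s. \<phi> i j (u $ j) * \<phi> i j (u $ j)) \<le> (\<Sum>j<?s. (?G *\<^sub>v u) $ j * (?G *\<^sub>v u) $ j)"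
  proof (rule sum_mono)
    fix j assume j: "j \<in> {..<?s}"
    then have "(\<phi> i j (u $ j))\<^sup>2 \<le> (?G $$ (j, j))\<^sup>2 * (u $ j)\<^sup>2"
      using \<phi> S(2) by (auto simp: admissible_fault_def)
    then show "\<phi> i j (u $ j) * \<phi> i j (u $ j) \<le> (?G *\<^sub>v u) $ j * (?G *\<^sub>v u) $ j"
      using j by (simp add: Gu power2_eq_square algebra_simps)
  qed
  then show ?thesis using G by (simp add: scalar_prod_sum)
qed

text \<open>In the sum over the subsystems the energy \<open>w \<bullet> w\<close> of the couplings is paid for by the terms with
  \<^const>\<open>W_of\<close>, and in each subsystem the energy \<open>p \<bullet> p\<close> of the fault by the term with \<open>\<Gamma>\<close>. The rate
  \<open>c\<close> depends on the parameter only, not on the couplings and faults.\<close>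
lemma system_dissipation:
  assumes S: "well_formed S" and W: "\<forall>i<subs S. pos_def (W_of S i)"
    and R: "\<forall>i<subs S. neg_def (Rw S i - 1\<^sub>m (udim S i))"
    and Y: "\<forall>i<subs S. \<forall>k<verts S. Y i k \<in> carrier_mat (xdim S i) (xdim S i) \<and> pos_def (Y i k)"
    and V: "\<forall>i<subs S. V i \<in> carrier_mat (xdim S i) (xdim S i)"
    and N: "\<forall>i<subs S. N i \<in> carrier_mat (udim S i) (xdim S i)"
    and Vi: "\<forall>i<subs S. minv (V i) \<in> carrier_mat (xdim S i) (xdim S i)"
    and lmi: "\<forall>i<subs S. \<forall>k<verts S. neg_def (lmi1 S i k (Y i k) (V i) (N i))"
    and a: "\<alpha> \<in> params S"
  defines "K \<equiv> \<lambda>i. N i * minv (V i)" and "P \<equiv> \<lambda>i. inv_of_mean S Y i \<alpha>"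
  shows "\<exists>c>0. \<forall>g \<phi> t \<xi>. admissible_coupling S g \<and> admissible_fault S \<phi> \<and> 0 \<le> t \<and>
    (\<forall>j<subs S. \<xi> j \<in> carrier_vec (xdim S j)) \<longrightarrow>
    (\<Sum>i<subs S. 2 * ((P i *\<^sub>v \<xi> i) \<bullet> vector_field S K \<alpha> g \<phi> t \<xi> i) + stage_cost S K \<phi> \<xi> i)
      \<le> - c * (\<Sum>i<subs S. quad (P i) (\<xi> i))"
proof -
  let ?M = "subs S"
  define e where "e i x p w = (let u = N i *\<^sub>v (minv (V i) *\<^sub>v x); v = Lam S i *\<^sub>v u + p in
      2 * ((P i *\<^sub>v x) \<bullet> (A_of S \<alpha> i *\<^sub>v x + B_of S \<alpha> i *\<^sub>v v
          + finsum_vec TYPE(real) (xdim S i) (\<lambda>j. Gc S i j *\<^sub>v w j) ({..<?M} - {i})))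
      - (\<Sum>j\<in>{..<?M} - {i}. w j \<bullet> w j)
      + quad (Qw S i) x + quad (W_of S i) x + quad (Rw S i) v
      + (Gam S i *\<^sub>v u) \<bullet> (Gam S i *\<^sub>v u) - p \<bullet> p)" for i x p w
  have Pi: "P i \<in> carrier_mat (xdim S i) (xdim S i)" "pos_def (P i)" if "i < ?M" for i
    unfolding P_def by (rule inv_of_mean_props[where Y = Y and i = i, OF a]; use Y that in blast)+
  have "\<exists>c. c > 0 \<and> (\<forall>x\<in>carrier_vec (xdim S i). \<forall>p\<in>carrier_vec (udim S i). \<forall>w.
    (\<forall>j<?M. j \<noteq> i \<longrightarrow> w j \<in> carrier_vec (gdim S i)) \<longrightarrow> e i x p w \<le> - c * quad (P i) x)"
    if i: "i < ?M" for i
    unfolding e_def P_def Let_def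
    by (rule subsystem_dissipation[OF S i, unfolded Let_def]) (use W R Y V N lmi a i in auto)
  then have "\<forall>i\<in>{..<?M}. \<exists>c. c > 0 \<and> (\<forall>x\<in>carrier_vec (xdim S i). \<forall>p\<in>carrier_vec (udim S i). \<forall>w.
    (\<forall>j<?M. j \<noteq> i \<longrightarrow> w j \<in> carrier_vec (gdim S i)) \<longrightarrow> e i x p w \<le> - c * quad (P i) x)"
    by simp
  from bchoice[OF this] obtain c where c: "\<forall>i\<in>{..<?M}. c i > 0 \<and>
    (\<forall>x\<in>carrier_vec (xdim S i). \<forall>p\<in>carrier_vec (udim S i). \<forall>w.
    (\<forall>j<?M. j \<noteq> i \<longrightarrow> w j \<in> carrier_vec (gdim S i)) \<longrightarrow> e i x p w \<le> - c i * quad (P i) x)" ..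
  define c0 where "c0 = Min (c ` {..<?M})"
  have M0: "0 < ?M" using S by (simp add: well_formed_def)
  then have ne: "c ` {..<?M} \<noteq> {}" by auto
  then have "c0 \<in> c ` {..<?M}" unfolding c0_def by (intro Min_in) auto
  then have c0: "c0 > 0" using c by auto
  have c0_le: "c0 \<le> c i" if "i < ?M" for i
    unfolding c0_def using that by (intro Min_le) auto
  show ?thesis
  proof (intro exI[of _ c0] conjI c0 allI impI)
    fix g :: "nat \<Rightarrow> nat \<Rightarrow> real \<Rightarrow> real vec \<Rightarrow> real vec" and \<phi> :: "nat \<Rightarrow> nat \<Rightarrow> real \<Rightarrow> real"
      and t :: real and \<xi> :: "nat \<Rightarrow> real vec"
    assume "admissible_coupling S g \<and> admissible_fault S \<phi> \<and> 0 \<le> t \<and>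
      (\<forall>j<?M. \<xi> j \<in> carrier_vec (xdim S j))"
    then have g: "admissible_coupling S g" and \<phi>: "admissible_fault S \<phi>" and t: "0 \<le> t"
      and \<xi>: "\<forall>j<?M. \<xi> j \<in> carrier_vec (xdim S j)" by auto
    define w where "w i = (\<lambda>j. g i j t (\<xi> j))" for i
    define p where "p i = vec (udim S i) (\<lambda>j. \<phi> i j ((K i *\<^sub>v \<xi> i) $ j))" for i
    have term_le: "2 * ((P i *\<^sub>v \<xi> i) \<bullet> vector_field S K \<alpha> g \<phi> t \<xi> i) + stage_cost S K \<phi> \<xi> i
        + quad (W_of S i) (\<xi> i) - (\<Sum>j\<in>{..<?M} - {i}. w i j \<bullet> w i j) \<le> - c0 * quad (P i) (\<xi> i)"
      if i: "i < ?M" for i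
    proof -
      have x: "\<xi> i \<in> carrier_vec (xdim S i)" using \<xi> i by simp
      have Kx: "K i *\<^sub>v \<xi> i = N i *\<^sub>v (minv (V i) *\<^sub>v \<xi> i)"
        unfolding K_def
        by (rule assoc_mult_mat_vec[of _ "udim S i" "xdim S i" _ "xdim S i"]) (use N Vi i x in auto)
      have u: "K i *\<^sub>v \<xi> i \<in> carrier_vec (udim S i)"
        unfolding Kx using N Vi i x by (auto intro!: mult_mat_vec_carrier)
      have act: "actuator S K \<phi> \<xi> i = Lam S i *\<^sub>v (K i *\<^sub>v \<xi> i) + p i"
        by (simp add: actuator_def p_def Let_def)
      have "e i (\<xi> i) (p i) (w i) = 2 * ((P i *\<^sub>v \<xi> i) \<bullet> vector_field S K \<alpha> g \<phi> t \<xi> i)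
          + stage_cost S K \<phi> \<xi> i + quad (W_of S i) (\<xi> i) - (\<Sum>j\<in>{..<?M} - {i}. w i j \<bullet> w i j)
          + ((Gam S i *\<^sub>v (K i *\<^sub>v \<xi> i)) \<bullet> (Gam S i *\<^sub>v (K i *\<^sub>v \<xi> i)) - p i \<bullet> p i)"
        unfolding e_def Let_def Kx[symmetric] act[symmetric] stage_cost_def vector_field_def w_def
        by simp
      moreover have "p i \<bullet> p i \<le> (Gam S i *\<^sub>v (K i *\<^sub>v \<xi> i)) \<bullet> (Gam S i *\<^sub>v (K i *\<^sub>v \<xi> i))"
        unfolding p_def by (rule fault_bound[OF S i \<phi> u])
      moreover have "e i (\<xi> i) (p i) (w i) \<le> - c i * quad (P i) (\<xi> i)"
      proof -
        have "p i \<in> carrier_vec (udim S i)" by (simp add: p_def)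
        moreover have "\<forall>j<?M. j \<noteq> i \<longrightarrow> w i j \<in> carrier_vec (gdim S i)"
          using g t \<xi> i by (auto simp: w_def admissible_coupling_def)
        ultimately show ?thesis using c i x by simp
      qed
      moreover have "c0 * quad (P i) (\<xi> i) \<le> c i * quad (P i) (\<xi> i)"
        by (rule mult_right_mono[OF c0_le[OF i] pos_def_nonneg[OF Pi(2)[OF i] Pi(1)[OF i] x]])
      ultimately show ?thesis by simp
    qed
    have "(\<Sum>i<?M. 2 * ((P i *\<^sub>v \<xi> i) \<bullet> vector_field S K \<alpha> g \<phi> t \<xi> i) + stage_cost S K \<phi> \<xi> i
        + quad (W_of S i) (\<xi> i) - (\<Sum>j\<in>{..<?M} - {i}. w i j \<bullet> w i j))
        \<le> (\<Sum>i<?M. - c0 * quad (P i) (\<xi> i))"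
      using term_le by (intro sum_mono) auto
    moreover have "(\<Sum>i<?M. \<Sum>j\<in>{..<?M} - {i}. w i j \<bullet> w i j) \<le> (\<Sum>i<?M. quad (W_of S i) (\<xi> i))"
      unfolding w_def by (rule coupling_bound[OF S g t \<xi>])
    ultimately show "(\<Sum>i<?M. 2 * ((P i *\<^sub>v \<xi> i) \<bullet> vector_field S K \<alpha> g \<phi> t \<xi> i) + stage_cost S K \<phi> \<xi> i)
      \<le> - c0 * (\<Sum>i<?M. quad (P i) (\<xi> i))"
      by (simp add: sum.distrib sum_subtractf sum_distrib_left)
  qed
qed

section \<open>Trajectories, stability and cost\<close>

definition lyap :: "interconnection \<Rightarrow> (nat \<Rightarrow> real mat) \<Rightarrow> (nat \<Rightarrow> real vec) \<Rightarrow> real" where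
  "lyap S P \<xi> = (\<Sum>i<subs S. quad (P i) (\<xi> i))"

text \<open>The left-hand side is the derivative of \<^const>\<open>lyap\<close> along the vector field plus the running cost. The
  right-hand side strengthens the mere negativity that a guaranteed cost control requires to a rate
  proportional to the Lyapunov function; stability and the strict cost bound both use this rate.\<close>
definition dissipates :: "interconnection \<Rightarrow> (nat \<Rightarrow> real mat) \<Rightarrow> real vec \<Rightarrow>
    (nat \<Rightarrow> nat \<Rightarrow> real \<Rightarrow> real vec \<Rightarrow> real vec) \<Rightarrow> (nat \<Rightarrow> nat \<Rightarrow> real \<Rightarrow> real) \<Rightarrow>
    (nat \<Rightarrow> real mat) \<Rightarrow> real \<Rightarrow> bool" where
  "dissipates S K \<alpha> g \<phi> P c \<longleftrightarrow> (\<forall>t \<xi>. 0 \<le> t \<and> (\<forall>j<subs S. \<xi> j \<in> carrier_vec (xdim S j)) \<longrightarrow>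
    (\<Sum>i<subs S. 2 * ((P i *\<^sub>v \<xi> i) \<bullet> vector_field S K \<alpha> g \<phi> t \<xi> i) + stage_cost S K \<phi> \<xi> i)
      \<le> - c * lyap S P \<xi>)"

lemma dissipatesD:
  assumes "dissipates S K \<alpha> g \<phi> P c" "0 \<le> t" "\<forall>j<subs S. \<xi> j \<in> carrier_vec (xdim S j)"
  shows "(\<Sum>i<subs S. 2 * ((P i *\<^sub>v \<xi> i) \<bullet> vector_field S K \<alpha> g \<phi> t \<xi> i) + stage_cost S K \<phi> \<xi> i)
    \<le> - c * lyap S P \<xi>"
  using assms unfolding dissipates_def by blast

lemma lyap_nonneg:
  assumes "\<forall>i<subs S. P i \<in> carrier_mat (xdim S i) (xdim S i) \<and> pos_def (P i)"
    and "\<forall>j<subs S. \<xi> j \<in> carrier_vec (xdim S j)"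
  shows "0 \<le> lyap S P \<xi>"
  unfolding lyap_def by (rule sum_nonneg) (use assms pos_def_nonneg in \<open>auto\<close>)

lemma lyap_pos:
  assumes "\<forall>i<subs S. P i \<in> carrier_mat (xdim S i) (xdim S i) \<and> pos_def (P i)"
    and "\<forall>j<subs S. \<xi> j \<in> carrier_vec (xdim S j)" and "nonzero_state S \<xi>"
  shows "0 < lyap S P \<xi>"
proof -
  obtain i where i: "i < subs S" "\<xi> i \<noteq> 0\<^sub>v (xdim S i)" using assms(3) by (auto simp: nonzero_state_def)
  have "0 < quad (P i) (\<xi> i)" using assms i pos_def_pos by blast
  then show ?thesis
    unfolding lyap_def using i assms(1,2) pos_def_nonneg by (intro sum_pos2[of _ i]) auto
qed

lemma stage_cost_nonneg:
  assumes S: "well_formed S" "i < subs S" and x: "\<xi> i \<in> carrier_vec (xdim S i)"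
  shows "0 \<le> stage_cost S K \<phi> \<xi> i"
proof -
  have "Lam S i \<in> carrier_mat (udim S i) (udim S i)"
    and Q: "Qw S i \<in> carrier_mat (xdim S i) (xdim S i)" "pos_def (Qw S i)"
    and R: "Rw S i \<in> carrier_mat (udim S i) (udim S i)" "pos_def (Rw S i)"
    using S by (auto simp: well_formed_def)
  then show ?thesis
    unfolding stage_cost_def
    by (intro add_nonneg_nonneg pos_def_nonneg[OF Q(2,1) x] pos_def_nonneg[OF R(2,1)] actuator_carrier)
qed

lemma horizon_zero: "t \<in> horizon T \<Longrightarrow> 0 \<in> horizon T"
  by (auto simp: horizon_def zero_ereal_def intro: le_less_trans[of _ "ereal t"])

lemma horizon_interval: "b \<in> horizon T \<Longrightarrow> {0..b} \<subseteq> horizon T"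
  by (auto simp: horizon_def intro: le_less_trans[of _ "ereal b"])

lemma trajectory_states:
  assumes "trajectory S K \<alpha> g \<phi> T x" "t \<in> horizon T"
  shows "\<forall>i<subs S. x t i \<in> carrier_vec (xdim S i)"
  using assms by (auto simp: trajectory_def)

lemma trajectory_quad_derivative:
  assumes S: "well_formed S" "i < subs S" and g: "admissible_coupling S g"
    and P: "P i \<in> carrier_mat (xdim S i) (xdim S i)" "pos_def (P i)"
    and x: "trajectory S K \<alpha> g \<phi> T x" and t: "t \<in> horizon T" and ode: "ode_at S K \<alpha> g \<phi> T x t"
  shows "((\<lambda>\<tau>. quad (P i) (x \<tau> i)) has_real_derivative
    2 * ((P i *\<^sub>v x t i) \<bullet> vector_field S K \<alpha> g \<phi> t (x t) i)) (at t within horizon T)"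
proof (rule quad_has_derivative[OF P(1) _ t])
  show "(P i)\<^sup>T = P i" using P(2) unfolding pos_def_def by (rule conjunct1)
  show "x \<tau> i \<in> carrier_vec (xdim S i)" if "\<tau> \<in> horizon T" for \<tau>
    using trajectory_states[OF x that] S(2) by blast
  show "vector_field S K \<alpha> g \<phi> t (x t) i \<in> carrier_vec (xdim S i)"
    by (rule vector_field_carrier[OF S g _ trajectory_states[OF x t]]) (use t in \<open>simp add: horizon_def\<close>)
  show "((\<lambda>\<tau>. x \<tau> i $ r) has_real_derivative vector_field S K \<alpha> g \<phi> t (x t) i $ r)
      (at t within horizon T)" if "r < xdim S i" for r
    using ode S(2) that by (simp add: ode_at_def)
qed

text \<open>One-sided derivatives within the horizon become two-sided because \<open>t\<close> lies strictly between \<open>0\<close> and a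
  later time \<open>b\<close> of the horizon.\<close>
lemma trajectory_lyap:
  assumes S: "well_formed S" and g: "admissible_coupling S g"
    and P: "\<forall>i<subs S. P i \<in> carrier_mat (xdim S i) (xdim S i) \<and> pos_def (P i)"
    and diss: "dissipates S K \<alpha> g \<phi> P c"
    and x: "trajectory S K \<alpha> g \<phi> T x"
  shows "continuous_on (horizon T) (\<lambda>t. lyap S P (x t))"
    and "b \<in> horizon T \<Longrightarrow> t \<in> {0<..<b} \<Longrightarrow> ode_at S K \<alpha> g \<phi> T x t \<Longrightarrow>
      \<exists>D. ((\<lambda>t. lyap S P (x t)) has_real_derivative D) (at t) \<and>
        D + (\<Sum>i<subs S. stage_cost S K \<phi> (x t) i) \<le> - c * lyap S P (x t)"
proof -
  show "continuous_on (horizon T) (\<lambda>t. lyap S P (x t))"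
    unfolding lyap_def
  proof (intro continuous_on_sum)
    fix i assume i: "i \<in> {..<subs S}"
    show "continuous_on (horizon T) (\<lambda>t. quad (P i) (x t i))"
      by (rule quad_continuous_on[of _ "xdim S i"]) (use P x i in \<open>auto simp: trajectory_def\<close>)
  qed
next
  assume b: "b \<in> horizon T" and t: "t \<in> {0<..<b}" and ode: "ode_at S K \<alpha> g \<phi> T x t"
  define D where "D = (\<Sum>i<subs S. 2 * ((P i *\<^sub>v x t i) \<bullet> vector_field S K \<alpha> g \<phi> t (x t) i))"
  have th: "t \<in> horizon T" using horizon_interval[OF b] t by auto
  have sub: "{0<..<b} \<subseteq> horizon T" using horizon_interval[OF b] by auto
  have "((\<lambda>t. lyap S P (x t)) has_real_derivative D) (at t within horizon T)"
    unfolding lyap_def D_def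
    by (intro DERIV_sum trajectory_quad_derivative[OF S _ g _ _ x th ode]) (use P in auto)
  then have "((\<lambda>t. lyap S P (x t)) has_real_derivative D) (at t within {0<..<b})"
    using sub by (rule has_field_derivative_subset)
  then have "((\<lambda>t. lyap S P (x t)) has_real_derivative D) (at t)"
    by (simp only: at_within_open[OF t open_greaterThanLessThan])
  moreover have "D + (\<Sum>i<subs S. stage_cost S K \<phi> (x t) i) \<le> - c * lyap S P (x t)"
    using dissipatesD[OF diss _ trajectory_states[OF x th]] t by (simp add: D_def sum.distrib)
  ultimately show "\<exists>D. ((\<lambda>t. lyap S P (x t)) has_real_derivative D) (at t) \<and>
      D + (\<Sum>i<subs S. stage_cost S K \<phi> (x t) i) \<le> - c * lyap S P (x t)" by blast
qed

lemma trajectory_decay: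
  assumes S: "well_formed S" and g: "admissible_coupling S g"
    and P: "\<forall>i<subs S. P i \<in> carrier_mat (xdim S i) (xdim S i) \<and> pos_def (P i)"
    and diss: "dissipates S K \<alpha> g \<phi> P c"
    and x: "trajectory S K \<alpha> g \<phi> T x" and b: "b \<in> horizon T"
  shows "lyap S P (x b) \<le> lyap S P (x 0) * exp (- c * b)"
proof (rule exponential_decay)
  let ?X = "{t \<in> horizon T. t \<le> b \<and> \<not> ode_at S K \<alpha> g \<phi> T x t}"
  show "finite ?X" using x by (simp add: trajectory_def)
  show "0 \<le> b" using b by (simp add: horizon_def)
  show "continuous_on {0..b} (\<lambda>t. lyap S P (x t))"
    by (rule continuous_on_subset[OF trajectory_lyap(1)[OF S g P diss x] horizon_interval[OF b]])
  fix t assume t: "t \<in> {0<..<b} - ?X"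
  have th: "t \<in> horizon T" using horizon_interval[OF b] t by auto
  then have "ode_at S K \<alpha> g \<phi> T x t" using t by auto
  then obtain D where D: "((\<lambda>t. lyap S P (x t)) has_real_derivative D) (at t)"
    "D + (\<Sum>i<subs S. stage_cost S K \<phi> (x t) i) \<le> - c * lyap S P (x t)"
    using trajectory_lyap(2)[OF S g P diss x b, of t] t by blast
  have "0 \<le> (\<Sum>i<subs S. stage_cost S K \<phi> (x t) i)"
    using trajectory_states[OF x th] by (intro sum_nonneg stage_cost_nonneg[OF S]) auto
  then show "\<exists>D. ((\<lambda>t. lyap S P (x t)) has_real_derivative D) (at t) \<and> D \<le> - c * lyap S P (x t)"
    using D by (intro exI[of _ D]) auto
qed

lemma horizon_infinity: "horizon \<infinity> = {0..}"
  by (auto simp: horizon_def)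

lemma trajectory_cost:
  assumes S: "well_formed S" and g: "admissible_coupling S g"
    and P: "\<forall>i<subs S. P i \<in> carrier_mat (xdim S i) (xdim S i) \<and> pos_def (P i)"
    and diss: "dissipates S K \<alpha> g \<phi> P c" and c: "0 < c"
    and x: "trajectory S K \<alpha> g \<phi> \<infinity> x"
  shows "cost S K \<phi> x \<le> ennreal (lyap S P (x 0))"
    and "nonzero_state S (x 0) \<Longrightarrow> cost S K \<phi> x < ennreal (lyap S P (x 0))"
proof -
  let ?v = "\<lambda>t. lyap S P (x t)"
  have st: "\<forall>i<subs S. x t i \<in> carrier_vec (xdim S i)" if "0 \<le> t" for t
    using trajectory_states[OF x] that by (simp add: horizon_infinity)
  have v0: "0 \<le> ?v t" if "0 \<le> t" for t by (rule lyap_nonneg[OF P st[OF that]])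
  have cont: "continuous_on {0..} ?v"
    using trajectory_lyap(1)[OF S g P diss x] by (simp add: horizon_infinity)
  have le: "cost S K \<phi> x \<le> ennreal (?v 0 - c * integral {0..1} ?v)"
    unfolding cost_def
  proof (rule nn_integral_dissipated_le[where X = "{t \<in> horizon \<infinity>. \<not> ode_at S K \<alpha> g \<phi> \<infinity> x t}", OF _ _ v0 cont])
    show "0 \<le> c" using c by simp
    show "0 \<le> (\<Sum>i<subs S. stage_cost S K \<phi> (x t) i)" if "0 \<le> t" for t
      using st[OF that] by (intro sum_nonneg stage_cost_nonneg[OF S]) auto
    show "finite {t \<in> {t \<in> horizon \<infinity>. \<not> ode_at S K \<alpha> g \<phi> \<infinity> x t}. t \<le> b}" for b
    proof (rule finite_subset)
      show "finite {t \<in> horizon \<infinity>. t \<le> b \<and> \<not> ode_at S K \<alpha> g \<phi> \<infinity> x t}"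
        using x by (simp add: trajectory_def)
    qed auto
    show "\<exists>D. (?v has_real_derivative D) (at t) \<and> D + (\<Sum>i<subs S. stage_cost S K \<phi> (x t) i) \<le> - c * ?v t"
      if "0 < t" "t \<notin> {t \<in> horizon \<infinity>. \<not> ode_at S K \<alpha> g \<phi> \<infinity> x t}" for t
      \<comment> \<open>Any time after \<open>t\<close> would do for \<open>t + 1\<close>.\<close>
      by (rule trajectory_lyap(2)[OF S g P diss x, of "t + 1"])
        (use that in \<open>auto simp: horizon_infinity\<close>)
  qed
  have c1: "continuous_on {0..1} ?v" by (rule continuous_on_subset[OF cont]) auto
  have I: "0 \<le> integral {0..1} ?v"
    by (rule integral_nonneg[OF integrable_continuous_interval[OF c1]]) (use v0 in auto)
  have "?v 0 - c * integral {0..1} ?v \<le> ?v 0" using I c by simp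
  with le show "cost S K \<phi> x \<le> ennreal (?v 0)" by (meson ennreal_leI order_trans)
  assume "nonzero_state S (x 0)"
  then have p: "0 < ?v 0" by (intro lyap_pos[OF P st]) simp_all
  have "0 < integral {0..1} ?v" by (rule integral_pos_of_initial_pos[OF c1 _ p]) (use v0 in auto)
  then have "?v 0 - c * integral {0..1} ?v < ?v 0" using c by simp
  then have "ennreal (?v 0 - c * integral {0..1} ?v) < ennreal (?v 0)"
    using p by (intro ennreal_lessI) auto
  with le show "cost S K \<phi> x < ennreal (?v 0)" by (rule le_less_trans)
qed

lemma uniform_constant:
  fixes Q :: "nat \<Rightarrow> real \<Rightarrow> bool"
  assumes "\<And>i. i < n \<Longrightarrow> \<exists>c>0. Q i c" and "\<And>i c d. Q i c \<Longrightarrow> 0 < d \<Longrightarrow> d \<le> c \<Longrightarrow> Q i d"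
  shows "\<exists>c>0. \<forall>i<n. Q i c"
  using assms(1)
proof (induction n)
  case 0
  show ?case by (intro exI[of _ 1]) simp
next
  case (Suc n)
  then obtain c d where c: "c > 0" "\<forall>i<n. Q i c" and d: "d > 0" "Q n d"
    by (metis less_SucI lessI)
  have "Q i (min c d)" if "i < Suc n" for i
  proof (cases "i = n")
    case True
    then show ?thesis using assms(2)[OF d(2)] c(1) d(1) by simp
  next
    case False
    then have "Q i c" using c(2) that by simp
    then show ?thesis by (rule assms(2)) (use c(1) d(1) in auto)
  qed
  then show ?case using c(1) d(1) by (intro exI[of _ "min c d"]) auto
qed

lemma state_norm_sq: "(state_norm S \<xi>)\<^sup>2 = (\<Sum>i<subs S. \<xi> i \<bullet> \<xi> i)"
  by (simp add: state_norm_def vnorm_def scalar_prod_self_nonneg sum_nonneg)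

lemma state_norm_nonneg: "0 \<le> state_norm S \<xi>"
  by (simp add: state_norm_def sum_nonneg)

text \<open>One constant serves for both estimates because each of them survives a decrease of \<open>m\<close>.\<close>
lemma lyap_equivalent_to_norm:
  assumes P: "\<forall>i<subs S. P i \<in> carrier_mat (xdim S i) (xdim S i) \<and> pos_def (P i)"
  shows "\<exists>m>0. \<forall>\<xi>. (\<forall>j<subs S. \<xi> j \<in> carrier_vec (xdim S j)) \<longrightarrow>
    m * (state_norm S \<xi>)\<^sup>2 \<le> lyap S P \<xi> \<and> m * lyap S P \<xi> \<le> (state_norm S \<xi>)\<^sup>2"
proof -
  define Q where "Q i m \<longleftrightarrow> (\<forall>v\<in>carrier_vec (xdim S i). m * (v \<bullet> v) \<le> quad (P i) v \<and>
      m * quad (P i) v \<le> v \<bullet> v)" for i m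
  have mono: "d * a \<le> b" if "c * a \<le> b" "0 < d" "d \<le> c" "0 \<le> a" for a b c d :: real
    using that mult_right_mono[of d c a] by linarith
  have "\<exists>m>0. \<forall>i<subs S. i < subs S \<and> Q i m"
  proof (rule uniform_constant)
    fix i assume i: "i < subs S"
    then have Pi: "P i \<in> carrier_mat (xdim S i) (xdim S i)" "pos_def (P i)" using P by auto
    obtain m where m: "m > 0" "\<And>v. v \<in> carrier_vec (xdim S i) \<Longrightarrow> m * (v \<bullet> v) \<le> quad (P i) v"
      using pos_def_coercive[OF Pi(2,1)] by blast
    obtain C where C: "C > 0" "\<And>v. v \<in> carrier_vec (xdim S i) \<Longrightarrow> quad (P i) v \<le> C * (v \<bullet> v)"
      using quad_upper_bound[OF Pi(1)] by blast
    define d where "d = min m (1 / C)"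
    have d: "0 < d" "d \<le> m" "d \<le> 1 / C" using m(1) C(1) by (auto simp: d_def)
    have "Q i d" unfolding Q_def
    proof (intro ballI conjI)
      fix v :: "real vec" assume v: "v \<in> carrier_vec (xdim S i)"
      show "d * (v \<bullet> v) \<le> quad (P i) v"
        by (rule mono[OF m(2)[OF v] d(1,2) scalar_prod_self_nonneg])
      have "1 / C * quad (P i) v \<le> v \<bullet> v" using C(2)[OF v] C(1) by (simp add: field_simps)
      then show "d * quad (P i) v \<le> v \<bullet> v"
        by (rule mono[OF _ d(1,3) pos_def_nonneg[OF Pi(2,1) v]])
    qed
    then show "\<exists>c>0. i < subs S \<and> Q i c" using i d(1) by blast
  next
    fix i c d assume "i < subs S \<and> Q i c" "0 < d" "d \<le> c"
    then show "i < subs S \<and> Q i d"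
      using P scalar_prod_self_nonneg pos_def_nonneg by (auto simp: Q_def intro!: mono[of c _ _ d])
  qed
  then obtain m where m: "m > 0" "\<forall>i<subs S. Q i m" by blast
  show ?thesis
  proof (intro exI[of _ m] conjI m(1) allI impI)
    fix \<xi> :: "nat \<Rightarrow> real vec" assume "\<forall>j<subs S. \<xi> j \<in> carrier_vec (xdim S j)"
    then show "m * (state_norm S \<xi>)\<^sup>2 \<le> lyap S P \<xi>" "m * lyap S P \<xi> \<le> (state_norm S \<xi>)\<^sup>2"
      using m(2) unfolding state_norm_sq lyap_def sum_distrib_left
      by (auto simp: Q_def intro!: sum_mono)
  qed
qed

text \<open>Exponential decay of the Lyapunov function and its equivalence to the squared norm bound the squared
  norm of the state by \<open>exp (- c t)\<close> times its initial value over \<open>m\<^sup>2\<close>.\<close>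
lemma dissipates_asymptotically_stable:
  assumes S: "well_formed S" and g: "admissible_coupling S g"
    and P: "\<forall>i<subs S. P i \<in> carrier_mat (xdim S i) (xdim S i) \<and> pos_def (P i)"
    and diss: "dissipates S K \<alpha> g \<phi> P c" and c: "0 < c"
  shows "asymptotically_stable S K \<alpha> g \<phi>"
proof -
  obtain m where m: "m > 0" "\<And>\<xi>. \<forall>j<subs S. \<xi> j \<in> carrier_vec (xdim S j) \<Longrightarrow>
      m * (state_norm S \<xi>)\<^sup>2 \<le> lyap S P \<xi> \<and> m * lyap S P \<xi> \<le> (state_norm S \<xi>)\<^sup>2"
    using lyap_equivalent_to_norm[OF P] by blast
  have bound: "(state_norm S (x t))\<^sup>2 \<le> (state_norm S (x 0) / m)\<^sup>2 * exp (- c * t)"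
    if x: "trajectory S K \<alpha> g \<phi> T x" and t: "t \<in> horizon T" for T x t
  proof -
    have "m * (m * (state_norm S (x t))\<^sup>2) \<le> m * lyap S P (x t)"
      using m(2)[OF trajectory_states[OF x t]] m(1) by (intro mult_left_mono) auto
    also have "\<dots> \<le> m * (lyap S P (x 0) * exp (- c * t))"
      using trajectory_decay[OF S g P diss x t] m(1) by (intro mult_left_mono) auto
    also have "\<dots> = m * lyap S P (x 0) * exp (- c * t)" by simp
    also have "\<dots> \<le> (state_norm S (x 0))\<^sup>2 * exp (- c * t)"
      using m(2)[OF trajectory_states[OF x horizon_zero[OF t]]] by (intro mult_right_mono) auto
    finally show ?thesis using m(1) by (simp add: field_simps power2_eq_square)
  qed
  show ?thesis
    unfolding asymptotically_stable_def
  proof (intro conjI allI impI)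
    fix e :: real assume e: "0 < e"
    show "\<exists>d>0. \<forall>T x. trajectory S K \<alpha> g \<phi> T x \<and> state_norm S (x 0) < d \<longrightarrow>
        (\<forall>t\<in>horizon T. state_norm S (x t) < e)"
    proof (intro exI[of _ "e * m"] conjI allI impI ballI)
      fix T x t assume x: "trajectory S K \<alpha> g \<phi> T x \<and> state_norm S (x 0) < e * m" and t: "t \<in> horizon T"
      have "(state_norm S (x t))\<^sup>2 \<le> (state_norm S (x 0) / m)\<^sup>2 * exp (- c * t)"
        using bound x t by blast
      also have "\<dots> \<le> (state_norm S (x 0) / m)\<^sup>2 * 1"
        using t c by (intro mult_left_mono) (auto simp: horizon_def)
      finally have "state_norm S (x t) \<le> state_norm S (x 0) / m"
        using m(1) state_norm_nonneg by (auto intro: power2_le_imp_le)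
      also have "\<dots> < e" using x m(1) by (simp add: divide_less_eq)
      finally show "state_norm S (x t) < e" .
    qed (use e m(1) in simp)
  next
    fix x assume x: "trajectory S K \<alpha> g \<phi> \<infinity> x"
    let ?r = "(state_norm S (x 0) / m)\<^sup>2"
    have "((\<lambda>t. exp (- c * t)) \<longlongrightarrow> 0) at_top"
      by (rule filterlim_compose[OF exp_at_bot
            filterlim_tendsto_neg_mult_at_bot[OF tendsto_const _ filterlim_ident]]) (use c in simp)
    then have lim: "((\<lambda>t. ?r * exp (- c * t)) \<longlongrightarrow> 0) at_top" by (rule tendsto_mult_right_zero)
    have "\<forall>\<^sub>F t in at_top. norm ((state_norm S (x t))\<^sup>2) \<le> ?r * exp (- c * t)"
      using eventually_ge_at_top[of 0]
    proof eventually_elim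
      case (elim t)
      then show ?case using bound[OF x, of t] by (simp add: horizon_infinity)
    qed
    then have "((\<lambda>t. (state_norm S (x t))\<^sup>2) \<longlongrightarrow> 0) at_top"
      using lim by (rule Lim_null_comparison)
    then have "((\<lambda>t. sqrt ((state_norm S (x t))\<^sup>2)) \<longlongrightarrow> sqrt 0) at_top"
      by (rule tendsto_real_sqrt)
    then show "((\<lambda>t. state_norm S (x t)) \<longlongrightarrow> 0) at_top"
      by (simp add: state_norm_nonneg)
  qed
qed

theorem theorem3:
  fixes S :: interconnection
    and Y :: "nat \<Rightarrow> nat \<Rightarrow> real mat"
    and V N K :: "nat \<Rightarrow> real mat"
  assumes "well_formed S"
    and "\<forall>i<subs S. pos_def (W_of S i)"
    and "\<forall>i<subs S. invertible_mat (Rw S i) \<and> neg_def (Rw S i - 1\<^sub>m (udim S i))"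
    and "\<forall>i<subs S. \<forall>k<verts S. Y i k \<in> carrier_mat (xdim S i) (xdim S i) \<and> pos_def (Y i k)"
    and "\<forall>i<subs S. V i \<in> carrier_mat (xdim S i) (xdim S i)"
    and "\<forall>i<subs S. N i \<in> carrier_mat (udim S i) (xdim S i)"
    and "\<forall>i<subs S. \<forall>k<verts S. neg_def (lmi1 S i k (Y i k) (V i) (N i))"
    and "\<forall>i<subs S. \<forall>k<verts S. neg_def (lmi2 S i k (Y i k))"
    and "K = (\<lambda>i. N i * minv (V i))"
  shows "reliable_guaranteed_cost_control S K (inv_of_mean S Y) \<and>
    (\<forall>\<alpha>\<in>params S. \<forall>g \<phi> x.
      admissible_coupling S g \<and> admissible_fault S \<phi> \<and> trajectory S K \<alpha> g \<phi> \<infinity> x \<and>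
      nonzero_state S (x 0) \<longrightarrow>
        cost S K \<phi> x < ennreal (\<Sum>i<subs S. quad (inv_of_mean S Y i \<alpha>) (x 0 i)) \<and>
        cost S K \<phi> x < ennreal (\<Sum>i<subs S. quad (mean_of_inv S Y i \<alpha>) (x 0 i)))"
proof -
  note S = assms(1) and W = assms(2) and Y = assms(4) and V = assms(5) and N = assms(6)
    and lmi = assms(7)
  have R: "\<forall>i<subs S. neg_def (Rw S i - 1\<^sub>m (udim S i))" using assms(3) by blast
  have L: "0 < verts S" using S by (simp add: well_formed_def)
  have Vi: "\<forall>i<subs S. minv (V i) \<in> carrier_mat (xdim S i) (xdim S i)"
  proof (intro allI impI)
    fix i assume i: "i < subs S"
    show "minv (V i) \<in> carrier_mat (xdim S i) (xdim S i)"
    proof (rule minv_inverse(1))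
      show "V i \<in> carrier_mat (xdim S i) (xdim S i)" using V i by blast
      show "v = 0\<^sub>v (xdim S i)" if "v \<in> carrier_vec (xdim S i)" "V i *\<^sub>v v = 0\<^sub>v (xdim S i)" for v
        by (rule lmi1_V_injective[OF S i L, of "Y i 0" "V i" "N i"])
          (use W R Y V N lmi i L that in auto)
    qed
  qed
  have K: "K i \<in> carrier_mat (udim S i) (xdim S i)" if "i < subs S" for i
    unfolding assms(9) using N Vi that by (auto intro!: mult_carrier_mat)
  define X where "X \<alpha> i = inv_of_mean S Y i \<alpha>" for \<alpha> i
  have X: "\<forall>i<subs S. X \<alpha> i \<in> carrier_mat (xdim S i) (xdim S i) \<and> pos_def (X \<alpha> i)"
    if "\<alpha> \<in> params S" for \<alpha>
    using inv_of_mean_props[where Y = Y, OF that] Y unfolding X_def by blast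
  have diss: "\<exists>c>0. \<forall>g \<phi>. admissible_coupling S g \<and> admissible_fault S \<phi> \<longrightarrow> dissipates S K \<alpha> g \<phi> (X \<alpha>) c"
    if a: "\<alpha> \<in> params S" for \<alpha>
    using system_dissipation[OF S W R Y V N Vi lmi a]
    unfolding assms(9) dissipates_def lyap_def X_def by blast
  have mean_le: "lyap S (X \<alpha>) \<xi> \<le> (\<Sum>i<subs S. quad (mean_of_inv S Y i \<alpha>) (\<xi> i))"
    "(\<Sum>i<subs S. quad (mean_of_inv S Y i \<alpha>) (\<xi> i)) \<le> (\<Sum>i<subs S. \<Sum>k<verts S. quad (minv (Y i k)) (\<xi> i))"
    if "\<alpha> \<in> params S" "\<forall>i<subs S. \<xi> i \<in> carrier_vec (xdim S i)" for \<alpha> \<xi>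
    unfolding lyap_def X_def
    using quad_inv_of_mean_le[where Y = Y, OF that(1)] Y that(2) by (auto intro!: sum_mono)
  have init: "\<forall>i<subs S. x 0 i \<in> carrier_vec (xdim S i)" if "trajectory S K \<alpha> g \<phi> \<infinity> x" for \<alpha> g \<phi> x
    by (rule trajectory_states[OF that]) (simp add: horizon_infinity)

  have "reliable_guaranteed_cost_control S K (inv_of_mean S Y)"
    unfolding reliable_guaranteed_cost_control_def
  proof (intro conjI ballI allI impI)
    fix \<alpha> g \<phi> assume a: "\<alpha> \<in> params S" and adm: "admissible_coupling S g \<and> admissible_fault S \<phi>"
    then obtain c where c: "c > 0" "dissipates S K \<alpha> g \<phi> (X \<alpha>) c" using diss by blast
    show "asymptotically_stable S K \<alpha> g \<phi>"
      using dissipates_asymptotically_stable[OF S _ X[OF a] c(2,1)] adm by blast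
    fix T x t assume x: "trajectory S K \<alpha> g \<phi> T x" and t: "t \<in> horizon T"
      and ode: "ode_at S K \<alpha> g \<phi> T x t \<and> nonzero_state S (x t)"
    let ?D = "\<lambda>i. 2 * ((X \<alpha> i *\<^sub>v x t i) \<bullet> vector_field S K \<alpha> g \<phi> t (x t) i)"
    note st = trajectory_states[OF x t]
    show "\<exists>D. (\<forall>i<subs S. ((\<lambda>\<tau>. quad (inv_of_mean S Y i \<alpha>) (x \<tau> i)) has_real_derivative D i)
          (at t within horizon T)) \<and> (\<Sum>i<subs S. D i + stage_cost S K \<phi> (x t) i) < 0"
    proof (intro exI[of _ ?D] conjI allI impI)
      fix i assume i: "i < subs S"
      have "((\<lambda>\<tau>. quad (X \<alpha> i) (x \<tau> i)) has_real_derivative ?D i) (at t within horizon T)"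
        by (rule trajectory_quad_derivative[OF S i _ _ _ x t]) (use adm X[OF a] i ode in auto)
      then show "((\<lambda>\<tau>. quad (inv_of_mean S Y i \<alpha>) (x \<tau> i)) has_real_derivative ?D i)
          (at t within horizon T)" by (simp add: X_def)
    next
      have "(\<Sum>i<subs S. ?D i + stage_cost S K \<phi> (x t) i) \<le> - c * lyap S (X \<alpha>) (x t)"
        by (rule dissipatesD[OF c(2) _ st]) (use t in \<open>simp add: horizon_def\<close>)
      also have "\<dots> < 0" using lyap_pos[OF X[OF a] st] ode c(1) by simp
      finally show "(\<Sum>i<subs S. ?D i + stage_cost S K \<phi> (x t) i) < 0" .
    qed
  next
    fix \<xi> :: "nat \<Rightarrow> real vec"
    \<comment> \<open>The bound may depend on the initial state but not on the parameter, hence the sum over the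
      vertices instead of their mean.\<close>
    let ?c = "\<Sum>i<subs S. \<Sum>k<verts S. quad (minv (Y i k)) (\<xi> i)"
    show "\<exists>c. \<forall>\<alpha>\<in>params S. \<forall>g \<phi> x. admissible_coupling S g \<and> admissible_fault S \<phi> \<and>
        trajectory S K \<alpha> g \<phi> \<infinity> x \<and> (\<forall>i<subs S. x 0 i = \<xi> i) \<longrightarrow> cost S K \<phi> x \<le> ennreal c"
    proof (intro exI[of _ ?c] ballI allI impI)
      fix \<alpha> g \<phi> x assume a: "\<alpha> \<in> params S"
        and h: "admissible_coupling S g \<and> admissible_fault S \<phi> \<and>
          trajectory S K \<alpha> g \<phi> \<infinity> x \<and> (\<forall>i<subs S. x 0 i = \<xi> i)"
      then obtain c where c: "c > 0" "dissipates S K \<alpha> g \<phi> (X \<alpha>) c" using diss by blast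
      have x: "trajectory S K \<alpha> g \<phi> \<infinity> x" using h by blast
      have "cost S K \<phi> x \<le> ennreal (lyap S (X \<alpha>) (x 0))"
        by (rule trajectory_cost(1)[OF S _ X[OF a] c(2,1) x]) (use h in blast)
      also have "\<dots> \<le> ennreal (\<Sum>i<subs S. \<Sum>k<verts S. quad (minv (Y i k)) (x 0 i))"
        by (rule ennreal_leI[OF order_trans[OF mean_le[OF a init[OF x]]]])
      also have "\<dots> = ennreal ?c" using h by simp
      finally show "cost S K \<phi> x \<le> ennreal ?c" .
    qed
  qed (use K X in \<open>auto simp: X_def\<close>)
  moreover have "cost S K \<phi> x < ennreal (\<Sum>i<subs S. quad (inv_of_mean S Y i \<alpha>) (x 0 i))"
    "cost S K \<phi> x < ennreal (\<Sum>i<subs S. quad (mean_of_inv S Y i \<alpha>) (x 0 i))"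
    if a: "\<alpha> \<in> params S" and h: "admissible_coupling S g" "admissible_fault S \<phi>"
      and x: "trajectory S K \<alpha> g \<phi> \<infinity> x" and nz: "nonzero_state S (x 0)" for \<alpha> g \<phi> x
  proof -
    obtain c where c: "c > 0" "dissipates S K \<alpha> g \<phi> (X \<alpha>) c" using diss a h by blast
    have less: "cost S K \<phi> x < ennreal (lyap S (X \<alpha>) (x 0))"
      by (rule trajectory_cost(2)[OF S h(1) X[OF a] c(2,1) x nz])
    then show "cost S K \<phi> x < ennreal (\<Sum>i<subs S. quad (inv_of_mean S Y i \<alpha>) (x 0 i))"
      by (simp add: lyap_def X_def)
    show "cost S K \<phi> x < ennreal (\<Sum>i<subs S. quad (mean_of_inv S Y i \<alpha>) (x 0 i))"
      using less ennreal_leI[OF mean_le(1)[OF a init[OF x]]] by (rule less_le_trans)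
  qed
  ultimately show ?thesis by blast
qed

end
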